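(* Let $\widetilde{\mathcal H}_{cc}=\{g\in L_2(\Omega)\otimes\mathbb S:\operatorname{inc}g\in\widetilde H^{-1}\otimes\mathbb S\}$ with norm $\|g\|^2=\|g\|_{L_2}^2+\|\operatorname{inc}g\|_{\widetilde H^{-1}}^2$. There exist continuous linear operators $S_0:\widetilde{\mathcal H}_{cc}\to\mathring H^1\otimes\mathbb S$ and $\tilde S_1:\widetilde{\mathcal H}_{cc}\to\mathring H^1\otimes\mathbb V$ such that every $g\in\widetilde{\mathcal H}_{cc}$ satisfies $g=S_0g+\operatorname{def}\tilde S_1g$. Consequently, $\mathcal D(\Omega)\otimes\mathbb S$ is dense in $\widetilde{\mathcal H}_{cc}$.
   Context: $\Omega\subset\mathbb R^3$ is bounded, open, connected and simply connected, with Lipschitz boundary, and $\partial\Omega$ is connected. $\mathbb V=\mathbb R^3$, $\mathbb S$ = symmetric $3\times3$ real matrices; $(\operatorname{grad}u)_{ij}=\partial_ju_i$, $\operatorname{def}u=\frac12(\operatorname{grad}u+(\operatorname{grad}u)^\top)$; curl acts row-wise on matrix fields; $\operatorname{inc}g=\operatorname{curl}((\operatorname{curl}g)^\top)$. Functions in $L_2(\Omega)$ are identified with their zero extensions to $\mathbb R^3$ and derivatives are distributional on $\mathbb R^3$. $\mathcal D(\Omega)$ = smooth functions compactly supported in $\Omega$; $\mathring H^1$ is its closure in $H^1(\Omega)$. $\widetilde H^{-1}=\{u\in H^{-1}(\mathbb R^3):\operatorname{supp}u\subset\overline\Omega\}$ with the $H^{-1}(\mathbb R^3)$ norm. *)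

theory Defs
  imports "HOL-Analysis.Analysis" "HOL-Analysis.Cross3"
begin

type_synonym sfield = "real^3 \<Rightarrow> real"
type_synonym vfield = "3 \<Rightarrow> sfield"
type_synonym mfield = "3 \<Rightarrow> 3 \<Rightarrow> sfield"

definition levi :: "3 \<Rightarrow> 3 \<Rightarrow> 3 \<Rightarrow> real" where
  "levi i j k = (cross3 (axis i 1) (axis j 1)) $ k"

definition pd :: "3 \<Rightarrow> sfield \<Rightarrow> sfield" where
  "pd i f = (\<lambda>x. frechet_derivative f (at x) (axis i 1))"

fun Ck :: "nat \<Rightarrow> sfield \<Rightarrow> bool" where
  "Ck 0 f = continuous_on UNIV f"
| "Ck (Suc k) f = ((\<forall>x. f differentiable (at x)) \<and> (\<forall>i. Ck k (pd i f)))"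

definition smooth :: "sfield \<Rightarrow> bool" where
  "smooth f \<longleftrightarrow> (\<forall>k. Ck k f)"

definition tsupport :: "sfield \<Rightarrow> (real^3) set" where
  "tsupport f = closure {x. f x \<noteq> 0}"

definition test :: "(real^3) set \<Rightarrow> sfield \<Rightarrow> bool" where
  "test U f \<longleftrightarrow> smooth f \<and> compact (tsupport f) \<and> tsupport f \<subseteq> U"

text \<open>L2 functions on R^3, and L2(Omega) identified with zero extensions\<close>
definition L2 :: "sfield set" where
  "L2 = {f. f \<in> borel_measurable lborel \<and> integrable lborel (\<lambda>x. (f x)\<^sup>2)}"

definition L2Om :: "(real^3) set \<Rightarrow> sfield set" where
  "L2Om \<Omega> = {f. f \<in> L2 \<and> (\<forall>x. x \<notin> \<Omega> \<longrightarrow> f x = 0)}"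

definition L2norm :: "sfield \<Rightarrow> real" where
  "L2norm f = sqrt (integral\<^sup>L lborel (\<lambda>x. (f x)\<^sup>2))"

definition is_wderiv :: "3 \<Rightarrow> sfield \<Rightarrow> sfield \<Rightarrow> bool" where
  "is_wderiv j u v \<longleftrightarrow> v \<in> L2 \<and>
     (\<forall>\<phi>. test UNIV \<phi> \<longrightarrow>
        integral\<^sup>L lborel (\<lambda>x. u x * pd j \<phi> x) = - integral\<^sup>L lborel (\<lambda>x. v x * \<phi> x))"

definition wderiv :: "3 \<Rightarrow> sfield \<Rightarrow> sfield" where
  "wderiv j u = (SOME v. is_wderiv j u v)"

definition H10 :: "(real^3) set \<Rightarrow> sfield set" where
  "H10 \<Omega> = {u. u \<in> L2Om \<Omega> \<and>
     (\<exists>v \<phi>. (\<forall>j. v j \<in> L2) \<and> (\<forall>n. test \<Omega> (\<phi> n)) \<and>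
        (\<lambda>n. L2norm (\<lambda>x. \<phi> n x - u x)) \<longlonglongrightarrow> 0 \<and>
        (\<forall>j. (\<lambda>n. L2norm (\<lambda>x. pd j (\<phi> n) x - v j x)) \<longlonglongrightarrow> 0))}"

definition H1norm :: "sfield \<Rightarrow> real" where
  "H1norm u = sqrt ((L2norm u)\<^sup>2 + (\<Sum>j\<in>UNIV. (L2norm (wderiv j u))\<^sup>2))"

definition H1norm_test :: "sfield \<Rightarrow> real" where
  "H1norm_test \<phi> = sqrt ((L2norm \<phi>)\<^sup>2 + (\<Sum>j\<in>UNIV. (L2norm (pd j \<phi>))\<^sup>2))"

text \<open>Distributions on R^3 are represented by their action on test functions.
  tilde H^{-1}(Omega): bounded w.r.t. the H^1(R^3) norm, support in closure Omega.\<close>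
definition Hm1_tilde :: "(real^3) set \<Rightarrow> (sfield \<Rightarrow> real) \<Rightarrow> bool" where
  "Hm1_tilde \<Omega> T \<longleftrightarrow>
     (\<exists>C. \<forall>\<phi>. test UNIV \<phi> \<longrightarrow> \<bar>T \<phi>\<bar> \<le> C * H1norm_test \<phi>) \<and>
     (\<forall>\<phi>. test (- closure \<Omega>) \<phi> \<longrightarrow> T \<phi> = 0)"

definition Hm1norm :: "(sfield \<Rightarrow> real) \<Rightarrow> real" where
  "Hm1norm T = Sup {\<bar>T \<phi>\<bar> | \<phi>. test UNIV \<phi> \<and> H1norm_test \<phi> \<le> 1}"

text \<open>(inc g)_{ab} = sum eps_{apq} eps_{blm} d_p d_l g_{mq}, distributionally\<close>
definition incD :: "mfield \<Rightarrow> 3 \<Rightarrow> 3 \<Rightarrow> (sfield \<Rightarrow> real)" where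
  "incD g a b = (\<lambda>\<phi>. \<Sum>p\<in>UNIV. \<Sum>q\<in>UNIV. \<Sum>l\<in>UNIV. \<Sum>m\<in>UNIV.
      levi a p q * levi b l m * integral\<^sup>L lborel (\<lambda>x. g m q x * pd p (pd l \<phi>) x))"

definition Hcc :: "(real^3) set \<Rightarrow> mfield set" where
  "Hcc \<Omega> = {g. (\<forall>i j. g i j \<in> L2Om \<Omega>) \<and> (\<forall>i j. g i j = g j i) \<and>
               (\<forall>a b. Hm1_tilde \<Omega> (incD g a b))}"

definition Hccnorm :: "mfield \<Rightarrow> real" where
  "Hccnorm g = sqrt ((\<Sum>i\<in>UNIV. \<Sum>j\<in>UNIV. (L2norm (g i j))\<^sup>2) +
                     (\<Sum>a\<in>UNIV. \<Sum>b\<in>UNIV. (Hm1norm (incD g a b))\<^sup>2))"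

definition lipschitz_boundary :: "(real^3) set \<Rightarrow> bool" where
  "lipschitz_boundary \<Omega> \<longleftrightarrow>
    (\<forall>x\<in>frontier \<Omega>. \<exists>r>0. \<exists>(R :: real^3 \<Rightarrow> real^3) (L :: real) (h :: real \<times> real \<Rightarrow> real).
       orthogonal_transformation R \<and> L-lipschitz_on UNIV h \<and>
       (\<forall>y\<in>ball x r. y \<in> \<Omega> \<longleftrightarrow> (R (y - x)) $ 3 < h ((R (y - x)) $ 1, (R (y - x)) $ 2)))"

end

theory Submission
  imports Defs
begin

text \<open>
  By a partition of unity it suffices to treat a field \<open>g\<close> supported near one boundary point, where
  a Lipschitz domain absorbs translations by a fixed open cone. Let \<open>A\<^sub>n\<close> be convolution
  with \<open>\<omega>\<close> dilated by \<open>2\<^sup>-\<^sup>n\<close>, where \<open>\<omega>\<close> lives in that cone and has vanishing first moments, so that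
  \<open>A\<^sub>n\<^sub>+\<^sub>1 - A\<^sub>n\<close> is a second order operator applied to dilated test functions \<open>\<theta>\<^sub>a\<^sub>b\<close>. In the telescoping
  sum \<open>g = A\<^sub>0\<^sup>2 g + \<Sum>(A\<^sub>n\<^sub>+\<^sub>1 - A\<^sub>n)(A\<^sub>n\<^sub>+\<^sub>1 + A\<^sub>n) g\<close> one trades \<open>\<partial>\<^sub>a\<partial>\<^sub>b g\<^sub>k\<^sub>l\<close> for the linearised
  curvature, which is a combination of the entries of \<open>inc g\<close>, plus terms of the form \<open>def w\<close>. The curvature
  terms sum up to \<open>S\<^sub>0 g\<close>, the others to \<open>def S\<^sub>1 g\<close>. Every partial sum is a test function in
  \<open>\<Omega>\<close>, and each summand contains two operators with cancellation, one from each factor, so almost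
  orthogonality of the scales gives the \<open>H\<^sup>1\<close> bounds and the convergence. The partial sums
  themselves approximate \<open>g\<close> in the graph norm because \<open>inc def = 0\<close>.
\<close>

section \<open>Calculus of \<open>Ck\<close> and \<open>smooth\<close>, including symmetry of second
  derivatives and test functions\<close>

section \<open>Smooth functions\<close>

text \<open>Counting orders explains the shape of the construction. A dyadic difference of squared
  averages carries a factor 4^{-n} against two derivatives of g. In the potential \<open>W\<close>,
  one factor 2^{-n} offsets a derivative falling on g, which leaves square summable pieces because g
  is in L2; the other factor buys the H^1 regularity. In the curvature part, one factor 2^{-n} turns
  inc g, known only in H^{-1}, into square summable L2 pieces \<open>H\<close>, and the other again
  buys H^1. The differentiated pieces do not decay with n, so absolute convergence is out of reach
  and orthogonality between scales has to replace it. A difference of single averages would have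
  cancellation in one factor only; squaring the averages supplies the second. A nonnegative kernel
  supported in a cone cannot have vanishing first moments, so the averaging kernel must change sign
  and is built from second derivatives. For density, L2 convergence of the partial sums says nothing
  about inc g. The H^1 convergence of the non-potential part has to be transferred to H^{-1}, by
  comparing two partial sums before passing to the limit.\<close>

lemma has_derivative_pd:
  assumes "f differentiable (at x)"
  shows "(f has_derivative (\<lambda>h. \<Sum>i\<in>UNIV. h $ i * pd i f x)) (at x)"
proof -
  have L: "linear (frechet_derivative f (at x))" using assms by (rule linear_frechet_derivative)
  have "frechet_derivative f (at x) h = (\<Sum>i\<in>UNIV. h $ i * pd i f x)" for h
  proof -
    have "frechet_derivative f (at x) h = frechet_derivative f (at x) (\<Sum>i\<in>UNIV. h $ i *\<^sub>R axis i 1)"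
      using basis_expansion[of h] by (simp add: scalar_mult_eq_scaleR)
    then show ?thesis by (simp add: linear_sum[OF L] linear_scale[OF L] pd_def)
  qed
  then have "frechet_derivative f (at x) = (\<lambda>h. \<Sum>i\<in>UNIV. h $ i * pd i f x)" by blast
  then show ?thesis using assms[unfolded frechet_derivative_works] by simp
qed

lemma pd_eqI: "(f has_derivative f') (at x) \<Longrightarrow> pd i f x = f' (axis i 1)"
  using frechet_derivative_at[of f f' x] by (simp add: pd_def)

lemma Ck_Suc_imp: "Ck (Suc k) f \<Longrightarrow> Ck k f"
proof (induction k arbitrary: f)
  case 0
  then show ?case
    by (auto intro!: differentiable_imp_continuous_on simp: differentiable_on_def)
next
  case (Suc k)
  have "Ck k (pd i f)" for i using Suc.prems Suc.IH[of "pd i f"] by simp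
  then show ?case using Suc.prems by simp
qed

lemma smooth_unfold:
  "smooth f \<longleftrightarrow> (\<forall>x. f differentiable (at x)) \<and> (\<forall>i. smooth (pd i f))"
proof
  assume s: "smooth f"
  have "Ck (Suc k) f" for k using s by (auto simp: smooth_def)
  then show "(\<forall>x. f differentiable (at x)) \<and> (\<forall>i. smooth (pd i f))"
    by (auto simp: smooth_def)
next
  assume a: "(\<forall>x. f differentiable (at x)) \<and> (\<forall>i. smooth (pd i f))"
  then have "Ck (Suc k) f" for k by (auto simp: smooth_def)
  then show "smooth f" using Ck_Suc_imp by (auto simp: smooth_def)
qed

lemma smooth_pd: "smooth f \<Longrightarrow> smooth (pd i f)"
  using smooth_unfold by blast

lemma smooth_differentiable: "smooth f \<Longrightarrow> f differentiable (at x)"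
  using smooth_unfold by blast

text \<open>Rescaled functions, convolutions and ridge functions each form a family of
  differentiable functions closed under \<open>pd\<close>; exhibiting the family as \<open>X\<close>
  replaces an induction on the order of differentiation.\<close>

lemma smooth_coinduct:
  assumes "X f"
    and "\<And>f. X f \<Longrightarrow> (\<forall>x. f differentiable (at x)) \<and> (\<forall>i. X (pd i f))"
  shows "smooth f"
proof -
  have "X f \<Longrightarrow> Ck (Suc k) f" for k f
  proof (induction k arbitrary: f)
    case 0
    have "Ck 0 (pd i f)" for i
      using assms(2)[OF 0] assms(2)[of "pd i f"]
      by (auto intro!: differentiable_imp_continuous_on simp: differentiable_on_def)
    then show ?case using assms(2)[OF 0] by simp
  next
    case (Suc k)
    then have "Ck (Suc k) (pd i f)" for i using assms(2) by blast
    then show ?case using assms(2)[OF Suc.prems] by (metis Ck.simps(2))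
  qed
  then show ?thesis using assms(1) Ck_Suc_imp by (auto simp: smooth_def)
qed

lemma smooth_has_derivative:
  "smooth f \<Longrightarrow> (f has_derivative (\<lambda>h. \<Sum>i\<in>UNIV. h $ i * pd i f x)) (at x)"
  by (rule has_derivative_pd[OF smooth_differentiable])

lemma smooth_continuous: "smooth f \<Longrightarrow> continuous_on S f"
  by (meson differentiable_imp_continuous_on differentiable_at_withinI differentiable_on_def
      smooth_differentiable)

lemma axis_sum [simp]: "(\<Sum>j\<in>UNIV. (axis i 1 :: real^3) $ j * c j) = c i"
  by (simp add: axis_def if_distrib[of "\<lambda>t. t * _"] cong: if_cong)

lemma pd_add: "f differentiable (at x) \<Longrightarrow> g differentiable (at x) \<Longrightarrow>
    pd i (\<lambda>x. f x + g x) x = pd i f x + pd i g x"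
  by (subst pd_eqI[OF has_derivative_add[OF has_derivative_pd has_derivative_pd]]) simp_all

lemma pd_cmult: "f differentiable (at x) \<Longrightarrow> pd i (\<lambda>x. c * f x) x = c * pd i f x"
  by (subst pd_eqI[OF has_derivative_mult_right[OF has_derivative_pd]]) simp_all

lemma pd_mult: "f differentiable (at x) \<Longrightarrow> g differentiable (at x) \<Longrightarrow>
    pd i (\<lambda>x. f x * g x) x = pd i f x * g x + f x * pd i g x"
  by (subst pd_eqI[OF has_derivative_mult[OF has_derivative_pd has_derivative_pd]]) simp_all

lemma pd_const [simp]: "pd i (\<lambda>x. c) = (\<lambda>x. 0)"
  by (simp add: pd_def)

lemma Ck_add: "Ck k f \<Longrightarrow> Ck k g \<Longrightarrow> Ck k (\<lambda>x. f x + g x)"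
proof (induction k arbitrary: f g)
  case (Suc k)
  have "pd i (\<lambda>x. f x + g x) = (\<lambda>x. pd i f x + pd i g x)" for i
    using Suc.prems by (auto intro!: pd_add)
  then show ?case using Suc by auto
qed (auto intro: continuous_intros)

lemma Ck_mult: "Ck k f \<Longrightarrow> Ck k g \<Longrightarrow> Ck k (\<lambda>x. f x * g x)"
proof (induction k arbitrary: f g)
  case (Suc k)
  have "pd i (\<lambda>x. f x * g x) = (\<lambda>x. pd i f x * g x + f x * pd i g x)" for i
    using Suc.prems by (auto intro!: pd_mult)
  moreover have "Ck k f" "Ck k g" using Suc.prems by (blast intro: Ck_Suc_imp)+
  ultimately show ?case using Suc.prems Suc.IH by (auto intro!: Ck_add)
qed (auto intro: continuous_intros)

lemma smooth_const [simp]: "smooth (\<lambda>x. c)"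
  by (rule smooth_coinduct[where X = "\<lambda>f. \<exists>c. f = (\<lambda>x. c)"]) auto

lemma smooth_add: "smooth f \<Longrightarrow> smooth g \<Longrightarrow> smooth (\<lambda>x. f x + g x)"
  by (simp add: smooth_def Ck_add)

lemma smooth_mult: "smooth f \<Longrightarrow> smooth g \<Longrightarrow> smooth (\<lambda>x. f x * g x)"
  by (simp add: smooth_def Ck_mult)

lemma smooth_cmult: "smooth f \<Longrightarrow> smooth (\<lambda>x. c * f x)"
  by (simp add: smooth_mult)

lemma smooth_diff: "smooth f \<Longrightarrow> smooth g \<Longrightarrow> smooth (\<lambda>x. f x - g x)"
  using smooth_add[of f "\<lambda>x. -1 * g x"] smooth_cmult[of g "-1"] by simp

lemma smooth_sum: "(\<And>i. i \<in> I \<Longrightarrow> smooth (f i)) \<Longrightarrow> smooth (\<lambda>x. \<Sum>i\<in>I. f i x)"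
  by (induction I rule: infinite_finite_induct) (auto intro: smooth_add)

lemma pd_add_smooth: "smooth f \<Longrightarrow> smooth g \<Longrightarrow>
    pd i (\<lambda>x. f x + g x) = (\<lambda>x. pd i f x + pd i g x)"
  by (auto intro!: pd_add smooth_differentiable)

lemma pd_cmult_smooth: "smooth f \<Longrightarrow> pd i (\<lambda>x. c * f x) = (\<lambda>x. c * pd i f x)"
  by (auto intro!: pd_cmult smooth_differentiable)

lemma pd_diff_smooth: "smooth f \<Longrightarrow> smooth g \<Longrightarrow>
    pd i (\<lambda>x. f x - g x) = (\<lambda>x. pd i f x - pd i g x)"
  using pd_add_smooth[of f "\<lambda>x. -1 * g x"] smooth_cmult[of g "-1"] pd_cmult_smooth[of g i "-1"] by simp

lemma pd_mult_smooth: "smooth f \<Longrightarrow> smooth g \<Longrightarrow>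
    pd i (\<lambda>x. f x * g x) = (\<lambda>x. pd i f x * g x + f x * pd i g x)"
  by (auto intro!: pd_mult smooth_differentiable)

lemma pd_sum_smooth: "(\<And>i. i \<in> I \<Longrightarrow> smooth (f i)) \<Longrightarrow>
    pd j (\<lambda>x. \<Sum>i\<in>I. f i x) = (\<lambda>x. \<Sum>i\<in>I. pd j (f i) x)"
  by (induction I rule: infinite_finite_induct) (auto simp: pd_add_smooth smooth_sum)

lemma affine_has_derivative:
  assumes "smooth f"
  shows "((\<lambda>x. f (a + c *\<^sub>R x)) has_derivative (\<lambda>h. \<Sum>i\<in>UNIV. h $ i * (c * pd i f (a + c *\<^sub>R x)))) (at x)"
proof -
  have "((\<lambda>x. a + c *\<^sub>R x) has_derivative (\<lambda>h. c *\<^sub>R h)) (at x)"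
    by (auto intro!: derivative_eq_intros)
  from has_derivative_compose[OF this smooth_has_derivative[OF assms]]
  show ?thesis by (simp add: ac_simps)
qed

lemma pd_affine: "smooth f \<Longrightarrow> pd i (\<lambda>x. f (a + c *\<^sub>R x)) = (\<lambda>x. c * pd i f (a + c *\<^sub>R x))"
  by (rule ext, subst pd_eqI[OF affine_has_derivative]) simp_all

lemma smooth_affine: "smooth f \<Longrightarrow> smooth (\<lambda>x. f (a + c *\<^sub>R x))"
proof (rule smooth_coinduct[where X = "\<lambda>g. \<exists>f d. smooth f \<and> g = (\<lambda>x. d * f (a + c *\<^sub>R x))"])
  assume "smooth f"
  then show "\<exists>f' d. smooth f' \<and> (\<lambda>x. f (a + c *\<^sub>R x)) = (\<lambda>x. d * f' (a + c *\<^sub>R x))"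
    by (intro exI[of _ f] exI[of _ 1]) simp
next
  fix g assume "\<exists>f d. smooth f \<and> g = (\<lambda>x. d * f (a + c *\<^sub>R x))"
  then obtain f d where f: "smooth f" and g: "g = (\<lambda>x. d * f (a + c *\<^sub>R x))" by blast
  have D: "(\<lambda>x. f (a + c *\<^sub>R x)) differentiable (at x)" for x
    using affine_has_derivative[OF f] by (auto simp: differentiable_def)
  have "pd i g = (\<lambda>x. (d * c) * pd i f (a + c *\<^sub>R x))" for i
    unfolding g by (rule ext) (simp add: pd_cmult[OF D] pd_affine[OF f])
  then show "(\<forall>x. g differentiable (at x)) \<and>
      (\<forall>i. \<exists>f d. smooth f \<and> pd i g = (\<lambda>x. d * f (a + c *\<^sub>R x)))"
    using smooth_pd[OF f] D unfolding g by (auto intro!: derivative_intros)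
qed

text \<open>The second difference is symmetric in \<open>i\<close> and \<open>j\<close>, while the
  mean value theorem, applied first in direction \<open>i\<close> and then in direction
  \<open>j\<close>, picks out one order of differentiation. Swapping the directions gives the other
  order for the same number.\<close>

lemma mixed_difference_mean_value:
  assumes f: "smooth f" and h: "h > 0"
  obtains \<xi> \<eta> where "0 < \<xi>" "\<xi> < h" "0 < \<eta>" "\<eta> < h"
    "f (x + h *\<^sub>R axis i 1 + h *\<^sub>R axis j 1) - f (x + h *\<^sub>R axis i 1) - f (x + h *\<^sub>R axis j 1) + f x
      = h\<^sup>2 * pd j (pd i f) (x + \<xi> *\<^sub>R axis i 1 + \<eta> *\<^sub>R axis j 1)"
proof -
  have line: "((\<lambda>t. g (y + t *\<^sub>R axis k 1)) has_real_derivative pd k g (y + t *\<^sub>R axis k 1)) (at t)"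
    if "smooth g" for g y k t
  proof -
    have "((\<lambda>t. y + t *\<^sub>R axis k 1) has_derivative (\<lambda>h. h *\<^sub>R axis k 1)) (at t)"
      by (auto intro!: derivative_eq_intros)
    from has_derivative_compose[OF this smooth_has_derivative[OF that]]
    show ?thesis by (simp add: has_field_derivative_def sum_distrib_left[symmetric] mult.assoc mult.commute[of "pd k _ _"] mult_commute_abs)
  qed
  define \<phi> where "\<phi> t = f ((x + h *\<^sub>R axis j 1) + t *\<^sub>R axis i 1) - f (x + t *\<^sub>R axis i 1)" for t
  have "\<exists>\<xi>>0. \<xi> < h \<and> \<phi> h - \<phi> 0 = (h - 0) *
     (pd i f ((x + h *\<^sub>R axis j 1) + \<xi> *\<^sub>R axis i 1) - pd i f (x + \<xi> *\<^sub>R axis i 1))"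
    unfolding \<phi>_def by (rule MVT2[OF h]) (intro DERIV_diff line f)
  then obtain \<xi> where \<xi>: "0 < \<xi>" "\<xi> < h" "\<phi> h - \<phi> 0 = (h - 0) *
     (pd i f ((x + h *\<^sub>R axis j 1) + \<xi> *\<^sub>R axis i 1) - pd i f (x + \<xi> *\<^sub>R axis i 1))" by blast
  have "\<exists>\<eta>>0. \<eta> < h \<and> pd i f ((x + \<xi> *\<^sub>R axis i 1) + h *\<^sub>R axis j 1) - pd i f ((x + \<xi> *\<^sub>R axis i 1) + 0 *\<^sub>R axis j 1)
     = (h - 0) * pd j (pd i f) ((x + \<xi> *\<^sub>R axis i 1) + \<eta> *\<^sub>R axis j 1)"
    by (rule MVT2[OF h]) (intro line smooth_pd f)
  then obtain \<eta> where \<eta>: "0 < \<eta>" "\<eta> < h" "pd i f ((x + \<xi> *\<^sub>R axis i 1) + h *\<^sub>R axis j 1) - pd i f ((x + \<xi> *\<^sub>R axis i 1) + 0 *\<^sub>R axis j 1)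
     = (h - 0) * pd j (pd i f) ((x + \<xi> *\<^sub>R axis i 1) + \<eta> *\<^sub>R axis j 1)" by blast
  show thesis
    by (rule that[OF \<xi>(1,2) \<eta>(1,2)])
      (use \<xi>(3) \<eta>(3) in \<open>simp add: \<phi>_def algebra_simps power2_eq_square\<close>)
qed

lemma pd_commute:
  assumes f: "smooth f"
  shows "pd i (pd j f) = pd j (pd i f)"
proof
  fix x
  have sm: "\<exists>d>0. \<forall>y. dist y x < d \<longrightarrow> \<bar>pd k (pd l f) y - pd k (pd l f) x\<bar> < e" if "e > 0" for k l e
    using smooth_continuous[OF smooth_pd[OF smooth_pd[OF f]], of UNIV k l] that
    unfolding continuous_on_iff dist_real_def by auto
  show "pd i (pd j f) x = pd j (pd i f) x"
  proof (rule ccontr)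
    assume ne: "pd i (pd j f) x \<noteq> pd j (pd i f) x"
    define e where "e = \<bar>pd i (pd j f) x - pd j (pd i f) x\<bar> / 2"
    have e: "e > 0" using ne by (simp add: e_def)
    from sm[OF e, of i j] obtain d1 where d1: "d1 > 0" "\<And>y. dist y x < d1 \<Longrightarrow> \<bar>pd i (pd j f) y - pd i (pd j f) x\<bar> < e" by blast
    from sm[OF e, of j i] obtain d2 where d2: "d2 > 0" "\<And>y. dist y x < d2 \<Longrightarrow> \<bar>pd j (pd i f) y - pd j (pd i f) x\<bar> < e" by blast
    \<comment> \<open>The intermediate points lie within \<open>2 * h\<close> of \<open>x\<close>,
      hence the division by 2.\<close>
    define h where "h = min d1 d2 / 2"
    have h: "h > 0" using d1 d2 by (simp add: h_def)
    have near: "dist (x + a *\<^sub>R axis k 1 + b *\<^sub>R axis l 1) x < min d1 d2"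
      if "0 < a" "a < h" "0 < b" "b < h" for a b k l
    proof -
      have "norm (a *\<^sub>R axis k 1 + b *\<^sub>R axis l 1 :: real^3) \<le> a + b"
        using norm_triangle_ineq[of "a *\<^sub>R axis k 1 :: real^3" "b *\<^sub>R axis l 1"] that by simp
      also have "\<dots> < min d1 d2" using that by (simp add: h_def)
      finally show ?thesis by (simp add: dist_norm add.assoc)
    qed
    obtain a b where ab: "0 < a" "a < h" "0 < b" "b < h"
      "f (x + h *\<^sub>R axis i 1 + h *\<^sub>R axis j 1) - f (x + h *\<^sub>R axis i 1) - f (x + h *\<^sub>R axis j 1) + f x
      = h\<^sup>2 * pd j (pd i f) (x + a *\<^sub>R axis i 1 + b *\<^sub>R axis j 1)"
      by (rule mixed_difference_mean_value[OF f h])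
    obtain a' b' where ab': "0 < a'" "a' < h" "0 < b'" "b' < h"
      "f (x + h *\<^sub>R axis j 1 + h *\<^sub>R axis i 1) - f (x + h *\<^sub>R axis j 1) - f (x + h *\<^sub>R axis i 1) + f x
      = h\<^sup>2 * pd i (pd j f) (x + a' *\<^sub>R axis j 1 + b' *\<^sub>R axis i 1)"
      by (rule mixed_difference_mean_value[OF f h])
    have "h\<^sup>2 * pd j (pd i f) (x + a *\<^sub>R axis i 1 + b *\<^sub>R axis j 1) = h\<^sup>2 * pd i (pd j f) (x + a' *\<^sub>R axis j 1 + b' *\<^sub>R axis i 1)"
      using ab(5) ab'(5) by (simp add: algebra_simps)
    then have "pd j (pd i f) (x + a *\<^sub>R axis i 1 + b *\<^sub>R axis j 1) = pd i (pd j f) (x + a' *\<^sub>R axis j 1 + b' *\<^sub>R axis i 1)"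
      using h by simp
    moreover have "\<bar>pd j (pd i f) (x + a *\<^sub>R axis i 1 + b *\<^sub>R axis j 1) - pd j (pd i f) x\<bar> < e"
      using d2(2) near[OF ab(1-4), of i j] by simp
    moreover have "\<bar>pd i (pd j f) (x + a' *\<^sub>R axis j 1 + b' *\<^sub>R axis i 1) - pd i (pd j f) x\<bar> < e"
      using d1(2) near[OF ab'(1-4), of j i] by simp
    ultimately show False unfolding e_def by argo
  qed
qed

subsection \<open>Test functions\<close>

text \<open>Any compact set outside which \<open>f\<close> vanishes certifies the support, so
  closures of supports never have to be computed.\<close>

lemma test_iff: "test U f \<longleftrightarrow> smooth f \<and> (\<exists>K. compact K \<and> K \<subseteq> U \<and> (\<forall>x. x \<notin> K \<longrightarrow> f x = 0))"
proof
  assume "test U f"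
  then show "smooth f \<and> (\<exists>K. compact K \<and> K \<subseteq> U \<and> (\<forall>x. x \<notin> K \<longrightarrow> f x = 0))"
    using closure_subset[of "{x. f x \<noteq> 0}"]
    by (intro conjI exI[of _ "closure {x. f x \<noteq> 0}"]) (auto simp: test_def tsupport_def)
next
  assume "smooth f \<and> (\<exists>K. compact K \<and> K \<subseteq> U \<and> (\<forall>x. x \<notin> K \<longrightarrow> f x = 0))"
  then obtain K where s: "smooth f" and K: "compact K" "K \<subseteq> U" "\<And>x. x \<notin> K \<Longrightarrow> f x = 0" by blast
  have "closure {x. f x \<noteq> 0} \<subseteq> K"
    using K by (intro closure_minimal) (auto intro: compact_imp_closed)
  moreover have "bounded {x. f x \<noteq> 0}"
    using K by (auto intro: bounded_subset[OF compact_imp_bounded[OF K(1)]])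
  ultimately show "test U f" using K s by (auto simp: test_def tsupport_def)
qed

lemma test_smooth: "test U f \<Longrightarrow> smooth f" by (simp add: test_def)

lemma test_mono: "test U f \<Longrightarrow> U \<subseteq> V \<Longrightarrow> test V f" by (auto simp: test_def)

lemma test_support:
  assumes "test U f" obtains K where "compact K" "K \<subseteq> U" "\<And>x. x \<notin> K \<Longrightarrow> f x = 0"
  using assms test_iff by blast

lemma test_zero [simp]: "test U (\<lambda>x. 0)"
  by (auto simp: test_iff intro!: exI[of _ "{}"])

lemma test_mult_smooth:
  assumes "test U f" "smooth g" shows "test U (\<lambda>x. f x * g x)" "test U (\<lambda>x. g x * f x)"
  using assms unfolding test_iff by (metis smooth_mult mult_eq_0_iff)+

lemma test_cmult: "test U f \<Longrightarrow> test U (\<lambda>x. c * f x)"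
  by (simp add: test_mult_smooth)

lemma test_add: assumes "test U f" "test U g" shows "test U (\<lambda>x. f x + g x)"
proof -
  obtain K L where "compact K" "K \<subseteq> U" "\<And>x. x \<notin> K \<Longrightarrow> f x = 0" "compact L" "L \<subseteq> U" "\<And>x. x \<notin> L \<Longrightarrow> g x = 0"
    using assms by (meson test_support)
  then show ?thesis unfolding test_iff using assms
    by (intro conjI exI[of _ "K \<union> L"]) (auto intro: smooth_add dest: test_smooth)
qed

lemma test_diff: "test U f \<Longrightarrow> test U g \<Longrightarrow> test U (\<lambda>x. f x - g x)"
  using test_add[of U f "\<lambda>x. -1 * g x"] test_cmult[of U g "-1"] by simp

lemma test_sum: "(\<And>i. i \<in> I \<Longrightarrow> test U (f i)) \<Longrightarrow> test U (\<lambda>x. \<Sum>i\<in>I. f i x)"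
  by (induction I rule: infinite_finite_induct) (auto intro: test_add)

lemma pd_zero_outside:
  assumes "closed K" "\<And>x. x \<notin> K \<Longrightarrow> f x = 0" "x \<notin> K"
  shows "pd i f x = 0"
proof -
  have "(f has_derivative (\<lambda>h. 0)) (at x)"
    by (rule has_derivative_transform_within_open[where f = "\<lambda>x. 0" and s = "- K"])
      (use assms in \<open>auto simp: open_Compl\<close>)
  from pd_eqI[OF this] show ?thesis by simp
qed

lemma test_pd: assumes "test U f" shows "test U (pd i f)"
proof -
  obtain K where "compact K" "K \<subseteq> U" "\<And>x. x \<notin> K \<Longrightarrow> f x = 0"
    using assms by (meson test_support)
  then show ?thesis unfolding test_iff using assms
    by (metis smooth_pd pd_zero_outside test_smooth compact_imp_closed)
qed

lemma test_affine:
  assumes f: "test UNIV f" and c: "c \<noteq> 0"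
  shows "test UNIV (\<lambda>x. f (a + c *\<^sub>R x))"
proof -
  obtain K where K: "compact K" "\<And>x. x \<notin> K \<Longrightarrow> f x = 0"
    using f by (meson test_support)
  have "f (a + c *\<^sub>R x) = 0" if "x \<notin> (\<lambda>y. (1 / c) *\<^sub>R (y - a)) ` K" for x
  proof (rule K(2), rule)
    assume "a + c *\<^sub>R x \<in> K"
    then have "(1 / c) *\<^sub>R ((a + c *\<^sub>R x) - a) \<in> (\<lambda>y. (1 / c) *\<^sub>R (y - a)) ` K" by blast
    then show False using that c by simp
  qed
  moreover have "compact ((\<lambda>y. (1 / c) *\<^sub>R (y - a)) ` K)"
    by (intro compact_continuous_image continuous_intros K)
  ultimately show ?thesis unfolding test_iff using smooth_affine[OF test_smooth[OF f]] by blast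
qed

lemma test_bounded:
  assumes "test U f" obtains B where "B \<ge> 0" "\<And>x. \<bar>f x\<bar> \<le> B"
proof -
  obtain K where K: "compact K" "\<And>x. x \<notin> K \<Longrightarrow> f x = 0"
    using assms by (meson test_support)
  have "bounded (f ` K)"
    by (intro compact_imp_bounded compact_continuous_image K smooth_continuous test_smooth[OF assms])
  then obtain B where "\<And>x. x \<in> K \<Longrightarrow> \<bar>f x\<bar> \<le> B" by (auto simp: bounded_iff)
  then have "\<bar>f x\<bar> \<le> \<bar>B\<bar>" for x using K(2)[of x] by (cases "x \<in> K") force+
  then show thesis using that[of "\<bar>B\<bar>"] by auto
qed

section \<open>Smooth functions of one real variable and the flat exponential\<close>

subsection \<open>One-dimensional building blocks\<close>

text \<open>Quantifying the derivative existentially lets the closure properties supply explicit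
  formulas as witnesses.\<close>

fun Dk :: "nat \<Rightarrow> (real \<Rightarrow> real) \<Rightarrow> bool" where
  "Dk 0 f = True"
| "Dk (Suc k) f = (\<exists>f'. (\<forall>x. (f has_real_derivative f' x) (at x)) \<and> Dk k f')"

definition smooth1 :: "(real \<Rightarrow> real) \<Rightarrow> bool" where "smooth1 f \<longleftrightarrow> (\<forall>k. Dk k f)"

lemma Dk_Suc_imp: "Dk (Suc k) f \<Longrightarrow> Dk k f"
  by (induction k arbitrary: f) auto

lemma Dk_cmult: "Dk k f \<Longrightarrow> Dk k (\<lambda>x. c * f x)"
proof (induction k arbitrary: f)
  case (Suc k)
  then obtain f' where "\<And>x. (f has_real_derivative f' x) (at x)" "Dk k f'" by auto
  then show ?case using Suc.IH[of f'] by (auto intro!: exI[of _ "\<lambda>x. c * f' x"] DERIV_cmult)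
qed auto

lemma Dk_add: "Dk k f \<Longrightarrow> Dk k g \<Longrightarrow> Dk k (\<lambda>x. f x + g x)"
proof (induction k arbitrary: f g)
  case (Suc k)
  then obtain f' g' where "\<And>x. (f has_real_derivative f' x) (at x)" "Dk k f'"
    "\<And>x. (g has_real_derivative g' x) (at x)" "Dk k g'" by auto
  then show ?case using Suc.IH[of f' g'] by (auto intro!: exI[of _ "\<lambda>x. f' x + g' x"] DERIV_add)
qed auto

lemma Dk_mult: "Dk k f \<Longrightarrow> Dk k g \<Longrightarrow> Dk k (\<lambda>x. f x * g x)"
proof (induction k arbitrary: f g)
  case (Suc k)
  then obtain f' g' where "\<And>x. (f has_real_derivative f' x) (at x)" "Dk k f'"
    "\<And>x. (g has_real_derivative g' x) (at x)" "Dk k g'" by auto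
  moreover have "Dk k f" "Dk k g" using Suc.prems by (blast intro: Dk_Suc_imp)+
  ultimately show ?case using Suc.IH[of f' g] Suc.IH[of g' f]
    by (auto intro!: exI[of _ "\<lambda>x. f' x * g x + g' x * f x"] DERIV_mult Dk_add)
qed auto

lemma Dk_affine: "Dk k f \<Longrightarrow> Dk k (\<lambda>x. f (a + c * x))"
proof (induction k arbitrary: f)
  case (Suc k)
  then obtain f' where f': "\<And>x. (f has_real_derivative f' x) (at x)" "Dk k f'" by auto
  have "((\<lambda>x. f (a + c * x)) has_real_derivative c * f' (a + c * x)) (at x)" for x
  proof -
    have "((\<lambda>x. a + c * x) has_real_derivative c) (at x)" by (auto intro!: derivative_eq_intros)
    from DERIV_chain2[OF f'(1) this] show ?thesis by (simp add: mult.commute)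
  qed
  then show ?case using Dk_cmult[OF Suc.IH[OF f'(2)], of c] by (auto intro!: exI[of _ "\<lambda>x. c * f' (a + c * x)"])
qed auto

lemma smooth1_cmult: "smooth1 f \<Longrightarrow> smooth1 (\<lambda>x. c * f x)" by (simp add: smooth1_def Dk_cmult)
lemma smooth1_add: "smooth1 f \<Longrightarrow> smooth1 g \<Longrightarrow> smooth1 (\<lambda>x. f x + g x)" by (simp add: smooth1_def Dk_add)
lemma smooth1_mult: "smooth1 f \<Longrightarrow> smooth1 g \<Longrightarrow> smooth1 (\<lambda>x. f x * g x)" by (simp add: smooth1_def Dk_mult)
lemma smooth1_affine: "smooth1 f \<Longrightarrow> smooth1 (\<lambda>x. f (a + c * x))" by (simp add: smooth1_def Dk_affine)

lemma smooth1_deriv: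
  assumes "smooth1 f" obtains f' where "smooth1 f'" "\<And>x. (f has_real_derivative f' x) (at x)"
proof -
  have "Dk (Suc 0) f" using assms by (auto simp: smooth1_def)
  then obtain f' where f': "\<And>x. (f has_real_derivative f' x) (at x)" by auto
  have "Dk k f'" for k
  proof -
    have "Dk (Suc k) f" using assms by (simp add: smooth1_def)
    then obtain f'' where "\<And>x. (f has_real_derivative f'' x) (at x)" "Dk k f''" by auto
    moreover have "f'' = f'" using calculation f' DERIV_unique by blast
    ultimately show ?thesis by simp
  qed
  then have "smooth1 f'" by (simp add: smooth1_def)
  then show thesis using that f' by blast
qed

lemma smooth1_derivI:
  assumes "smooth1 f'" "\<And>x. (f has_real_derivative f' x) (at x)" shows "smooth1 f"
proof -
  have "Dk k f" for k using assms by (cases k) (auto simp: smooth1_def)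
  then show ?thesis by (simp add: smooth1_def)
qed

lemma smooth1_DERIV:
  assumes "smooth1 f" "\<And>x. (f has_real_derivative f' x) (at x)" shows "smooth1 f'"
proof -
  obtain g where "smooth1 g" "\<And>x. (f has_real_derivative g x) (at x)" using smooth1_deriv[OF assms(1)] by blast
  moreover have "g = f'" using calculation assms(2) DERIV_unique by blast
  ultimately show ?thesis by simp
qed

lemma smooth1_const [simp]: "smooth1 (\<lambda>x. c)"
proof -
  have "Dk k (\<lambda>x. c)" for k c
    by (induction k arbitrary: c) (auto intro!: exI[of _ "\<lambda>x. 0"])
  then show ?thesis by (simp add: smooth1_def)
qed

lemma smooth1_ident [simp]: "smooth1 (\<lambda>x. x)"
  by (rule smooth1_derivI[of "\<lambda>x. 1"]) auto

lemma smooth1_isCont: "smooth1 f \<Longrightarrow> isCont f x"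
  by (metis DERIV_isCont smooth1_deriv)

text \<open>The functions \<open>F n\<close>, namely x^{-n} exp(-1/x) for positive x and 0
  otherwise, are closed under differentiation up to linear combinations: the derivative of
  \<open>F n\<close> is \<open>- n * F (n+1) + F (n+2)\<close>, also at 0. Hence all of them are
  smooth at once.\<close>

lemma smooth1_flat_exp: "smooth1 (\<lambda>x. if x \<le> 0 then 0 else exp (- (1 / x)))"
proof -
  define F where "F n x = (if x \<le> 0 then 0 else (1 / x) ^ n * exp (- (1 / x)))" for n :: nat and x :: real
  have lim: "(F n \<longlongrightarrow> 0) (at_right 0)" for n
  proof -
    have "((\<lambda>x. (inverse x) ^ n / exp (inverse x)) \<longlongrightarrow> 0) (at_right (0::real))"
      by (rule filterlim_compose[OF tendsto_power_div_exp_0 filterlim_inverse_at_top_right])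
    then show ?thesis
      by (rule Lim_transform_eventually)
        (auto simp: F_def eventually_at_filter exp_minus field_simps)
  qed
  have D: "(F n has_real_derivative (- real n * F (Suc n) x + F (Suc (Suc n)) x)) (at x)" for n x
  proof (cases "x = 0")
    case False
    show ?thesis
    proof (cases "x < 0")
      case True
      then have "((\<lambda>x. 0) has_real_derivative (- real n * F (Suc n) x + F (Suc (Suc n)) x)) (at x)"
        by (simp add: F_def)
      then show ?thesis
        by (rule has_field_derivative_transform_within_open[where S = "{..<0}"]) (use True in \<open>auto simp: F_def\<close>)
    next
      case False
      with \<open>x \<noteq> 0\<close> have x: "x > 0" by simp
      have "((\<lambda>x. (1 / x) ^ n * exp (- (1 / x))) has_real_derivative (- real n * F (Suc n) x + F (Suc (Suc n)) x)) (at x)"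
      proof -
        have "((\<lambda>x. inverse x) has_real_derivative - (inverse x * inverse x)) (at x)"
          using x by (auto intro!: derivative_eq_intros simp: power2_eq_square)
        note inv = this
        have "((\<lambda>x. inverse x ^ n) has_real_derivative - real n * inverse x ^ Suc n) (at x)"
        proof (cases n)
          case (Suc m)
          show ?thesis using DERIV_power[OF inv, of n] unfolding Suc by (simp add: algebra_simps)
        qed simp
        moreover have "((\<lambda>x. exp (- inverse x)) has_real_derivative exp (- inverse x) * (inverse x * inverse x)) (at x)"
          using DERIV_fun_exp[OF DERIV_minus[OF inv]] by simp
        ultimately show ?thesis
          using DERIV_mult x by (fastforce simp: F_def inverse_eq_divide algebra_simps)
      qed
      then show ?thesis
        by (rule has_field_derivative_transform_within_open[where S = "{0<..}"]) (use x in \<open>auto simp: F_def\<close>)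
    qed
  next
    case True
    \<comment> \<open>To the right of 0 this difference quotient is \<open>F (Suc n)\<close> itself,
      whose limit is \<open>lim\<close>.\<close>
    have "((\<lambda>y. (F n y - F n 0) / (y - 0)) \<longlongrightarrow> 0) (at_right 0)"
      by (rule Lim_transform_eventually[OF lim[of "Suc n"]])
        (auto simp: F_def eventually_at_filter)
    moreover have "((\<lambda>y. (F n y - F n 0) / (y - 0)) \<longlongrightarrow> 0) (at_left 0)"
      by (rule Lim_transform_eventually[OF tendsto_const])
        (auto simp: F_def eventually_at_filter)
    ultimately have "((\<lambda>y. (F n y - F n 0) / (y - 0)) \<longlongrightarrow> 0) (at 0)"
      by (rule filterlim_split_at_real[rotated])
    then show ?thesis using True by (simp add: has_field_derivative_iff F_def)
  qed
  have "Dk k (F n)" for k n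
  proof (induction k arbitrary: n)
    case (Suc k)
    then show ?case using D[of n]
      by (auto intro!: exI[of _ "\<lambda>x. - real n * F (Suc n) x + F (Suc (Suc n)) x"] Dk_add Dk_cmult)
  qed auto
  then have "smooth1 (F 0)" by (simp add: smooth1_def)
  then show ?thesis by (simp add: F_def[abs_def] cong: if_cong)
qed


section \<open>The Hilbert space \<open>L2\<close>, with functions instead of equivalence
  classes\<close>

section \<open>Square integrable functions\<close>

definition ip :: "sfield \<Rightarrow> sfield \<Rightarrow> real" where
  "ip f g = integral\<^sup>L lborel (\<lambda>x. f x * g x)"

lemma L2_measurable [measurable_dest]: "f \<in> L2 \<Longrightarrow> f \<in> borel_measurable borel"
  by (simp add: L2_def)

lemma L2_square_integrable: "f \<in> L2 \<Longrightarrow> integrable lborel (\<lambda>x. (f x)\<^sup>2)"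
  by (simp add: L2_def)

lemma L2I: "f \<in> borel_measurable borel \<Longrightarrow> integrable lborel (\<lambda>x. (f x)\<^sup>2) \<Longrightarrow> f \<in> L2"
  by (simp add: L2_def)

lemma L2_mult_integrable:
  assumes "f \<in> L2" "g \<in> L2" shows "integrable lborel (\<lambda>x. f x * g x)"
proof (rule Bochner_Integration.integrable_bound)
  show "integrable lborel (\<lambda>x. (f x)\<^sup>2 + (g x)\<^sup>2)"
    using assms by (simp add: L2_square_integrable)
  have "\<bar>a * b\<bar> \<le> a\<^sup>2 + b\<^sup>2" for a b :: real
  proof -
    have "2 * (\<bar>a\<bar> * \<bar>b\<bar>) \<le> a\<^sup>2 + b\<^sup>2"
      using sum_squares_bound[of "\<bar>a\<bar>" "\<bar>b\<bar>"] by simp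
    moreover have "0 \<le> \<bar>a\<bar> * \<bar>b\<bar>" by simp
    ultimately show ?thesis unfolding abs_mult by linarith
  qed
  then show "AE x in lborel. norm (f x * g x) \<le> norm ((f x)\<^sup>2 + (g x)\<^sup>2)" by auto
qed (use assms in measurable)

lemma L2_bound:
  assumes "g \<in> L2" "f \<in> borel_measurable borel" "\<And>x. \<bar>f x\<bar> \<le> \<bar>g x\<bar>" shows "f \<in> L2"
proof (rule L2I[OF assms(2)])
  show "integrable lborel (\<lambda>x. (f x)\<^sup>2)"
    by (rule Bochner_Integration.integrable_bound[OF L2_square_integrable[OF assms(1)]])
      (use assms in \<open>auto simp: abs_le_square_iff\<close>)
qed

lemma L2_cmult [intro]: "f \<in> L2 \<Longrightarrow> (\<lambda>x. c * f x) \<in> L2"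
  by (auto simp: L2_def power_mult_distrib)

lemma L2_add [intro]:
  assumes "f \<in> L2" "g \<in> L2" shows "(\<lambda>x. f x + g x) \<in> L2"
proof (rule L2I)
  show "(\<lambda>x. f x + g x) \<in> borel_measurable borel" using assms by measurable
  show "integrable lborel (\<lambda>x. (f x + g x)\<^sup>2)"
    using assms L2_mult_integrable[OF assms] by (simp add: power2_sum L2_square_integrable mult.assoc)
qed

lemma L2_zero [simp]: "(\<lambda>x. 0) \<in> L2" by (simp add: L2_def)

lemma L2_diff [intro]: "f \<in> L2 \<Longrightarrow> g \<in> L2 \<Longrightarrow> (\<lambda>x. f x - g x) \<in> L2"
  using L2_add[of f "\<lambda>x. -1 * g x"] L2_cmult[of g "-1"] by simp

lemma L2_sum: "(\<And>i. i \<in> I \<Longrightarrow> f i \<in> L2) \<Longrightarrow> (\<lambda>x. \<Sum>i\<in>I. f i x) \<in> L2"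
  by (induction I rule: infinite_finite_induct) auto

lemma L2norm_nonneg [simp]: "0 \<le> L2norm f" by (simp add: L2norm_def)

lemma L2norm_power2: "(L2norm f)\<^sup>2 = ip f f"
  by (simp add: L2norm_def ip_def power2_eq_square)

lemma L2norm_zero [simp]: "L2norm (\<lambda>x. 0) = 0" by (simp add: L2norm_def)

lemma ip_sym: "ip f g = ip g f" by (simp add: ip_def mult.commute)

lemma ip_add: "f \<in> L2 \<Longrightarrow> g \<in> L2 \<Longrightarrow> h \<in> L2 \<Longrightarrow> ip (\<lambda>x. f x + g x) h = ip f h + ip g h"
  by (simp add: ip_def algebra_simps L2_mult_integrable)

lemma ip_cmult: "ip (\<lambda>x. c * f x) h = c * ip f h"
  by (simp add: ip_def mult.assoc)

lemma ip_diff: "f \<in> L2 \<Longrightarrow> g \<in> L2 \<Longrightarrow> h \<in> L2 \<Longrightarrow> ip (\<lambda>x. f x - g x) h = ip f h - ip g h"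
  by (simp add: ip_def algebra_simps L2_mult_integrable)

lemma ip_zero [simp]: "ip (\<lambda>x. 0) h = 0" by (simp add: ip_def)

lemma ip_sum: "(\<And>i. i \<in> I \<Longrightarrow> f i \<in> L2) \<Longrightarrow> h \<in> L2 \<Longrightarrow> ip (\<lambda>x. \<Sum>i\<in>I. f i x) h = (\<Sum>i\<in>I. ip (f i) h)"
  by (induction I rule: infinite_finite_induct) (auto simp: ip_add L2_sum)

lemma L2norm_AE_zero:
  assumes "f \<in> L2" "L2norm f = 0" shows "AE x in lborel. f x = 0"
proof -
  have "integral\<^sup>L lborel (\<lambda>x. (f x)\<^sup>2) = 0" using assms by (simp add: L2norm_def)
  then have "AE x in lborel. (f x)\<^sup>2 = 0"
    using integral_nonneg_eq_0_iff_AE[OF L2_square_integrable[OF assms(1)]] by simp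
  then show ?thesis by simp
qed

lemma L2norm_cong_AE:
  assumes "f \<in> L2" "g \<in> L2" "AE x in lborel. f x = g x" shows "L2norm f = L2norm g"
  unfolding L2norm_def using assms by (auto intro!: arg_cong[where f = sqrt] integral_cong_AE)

lemma ip_square_add:
  assumes "f \<in> L2" "g \<in> L2"
  shows "(L2norm (\<lambda>x. a * f x + b * g x))\<^sup>2 = a\<^sup>2 * (L2norm f)\<^sup>2 + 2 * a * b * ip f g + b\<^sup>2 * (L2norm g)\<^sup>2"
proof -
  have A: "(\<lambda>x. a * f x) \<in> L2" "(\<lambda>x. b * g x) \<in> L2" "(\<lambda>x. a * f x + b * g x) \<in> L2" using assms by auto
  show ?thesis
    unfolding L2norm_power2
    by (simp add: ip_add A ip_cmult ip_sym[of f "\<lambda>x. a * f x + b * g x"]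
      ip_sym[of g "\<lambda>x. a * f x + b * g x"] assms ip_sym[of g f] power2_eq_square algebra_simps)
qed

lemma L2_Cauchy_Schwarz:
  assumes "f \<in> L2" "g \<in> L2" shows "\<bar>ip f g\<bar> \<le> L2norm f * L2norm g"
proof (cases "L2norm f = 0 \<or> L2norm g = 0")
  case True
  then have "AE x in lborel. f x * g x = 0"
    using L2norm_AE_zero assms by fastforce
  then have "ip f g = 0" unfolding ip_def by (rule integral_eq_zero_AE)
  then show ?thesis by simp
next
  case False
  define a b where "a = L2norm f" and "b = L2norm g"
  have ab: "a > 0" "b > 0" using False by (auto simp: a_def b_def less_le)
  \<comment> \<open>Expands the squared norm of \<open>b * f + c * a * g\<close>; the values 1 and
    -1 of \<open>c\<close> turn it into \<open>2 * a * b\<close> times \<open>a * b + ip f g\<close>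
    and \<open>a * b - ip f g\<close>.\<close>
  have 1: "0 \<le> b\<^sup>2 * a\<^sup>2 + 2 * b * (c * a) * ip f g + (c * a)\<^sup>2 * b\<^sup>2" for c
    using ip_square_add[OF assms, of b "c * a"] zero_le_power2[of "L2norm (\<lambda>x. b * f x + c * a * g x)"]
    unfolding a_def b_def by linarith
  have "0 \<le> (2 * a * b) * (a * b + ip f g)" "0 \<le> (2 * a * b) * (a * b - ip f g)"
    using 1[of 1] 1[of "-1"] by (simp_all add: algebra_simps power2_eq_square)
  moreover have "0 < 2 * a * b" using ab by simp
  ultimately have "0 \<le> a * b + ip f g" "0 \<le> a * b - ip f g"
    using zero_le_mult_iff[of "2 * a * b"] by (meson not_le)+
  then show ?thesis unfolding a_def b_def by linarith
qed

lemma L2norm_triangle: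
  assumes "f \<in> L2" "g \<in> L2" shows "L2norm (\<lambda>x. f x + g x) \<le> L2norm f + L2norm g"
proof (rule power2_le_imp_le)
  have "(L2norm (\<lambda>x. f x + g x))\<^sup>2 = (L2norm f)\<^sup>2 + 2 * ip f g + (L2norm g)\<^sup>2"
    using ip_square_add[OF assms, of 1 1] by simp
  also have "\<dots> \<le> (L2norm f + L2norm g)\<^sup>2"
    using L2_Cauchy_Schwarz[OF assms] by (simp add: power2_sum)
  finally show "(L2norm (\<lambda>x. f x + g x))\<^sup>2 \<le> (L2norm f + L2norm g)\<^sup>2" .
qed simp

lemma L2norm_cmult: "L2norm (\<lambda>x. c * f x) = \<bar>c\<bar> * L2norm f"
  by (simp add: L2norm_def power_mult_distrib real_sqrt_mult)

lemma L2norm_minus: "L2norm (\<lambda>x. f x - g x) = L2norm (\<lambda>x. g x - f x)"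
  by (simp add: L2norm_def power2_commute)

lemma L2norm_triangle_diff:
  assumes "f \<in> L2" "g \<in> L2" shows "L2norm (\<lambda>x. f x - g x) \<le> L2norm f + L2norm g"
  using L2norm_triangle[OF assms(1) L2_cmult[OF assms(2), of "-1"]] L2norm_cmult[of "-1" g] by simp

lemma L2norm_triangle3:
  assumes "f \<in> L2" "g \<in> L2" "h \<in> L2"
  shows "L2norm (\<lambda>x. f x - h x) \<le> L2norm (\<lambda>x. f x - g x) + L2norm (\<lambda>x. g x - h x)"
  using L2norm_triangle[OF L2_diff[OF assms(1,2)] L2_diff[OF assms(2,3)]] by simp

lemma L2norm_sum:
  "(\<And>i. i \<in> I \<Longrightarrow> f i \<in> L2) \<Longrightarrow> L2norm (\<lambda>x. \<Sum>i\<in>I. f i x) \<le> (\<Sum>i\<in>I. L2norm (f i))"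
proof (induction I rule: infinite_finite_induct)
  case (insert i I)
  have "L2norm (\<lambda>x. f i x + (\<Sum>i\<in>I. f i x)) \<le> L2norm (f i) + L2norm (\<lambda>x. \<Sum>i\<in>I. f i x)"
    by (rule L2norm_triangle) (use insert in \<open>auto intro: L2_sum\<close>)
  then show ?case using insert by (simp add: insert.hyps)
qed auto

lemma L2norm_mono:
  assumes "g \<in> L2" "f \<in> borel_measurable borel" "\<And>x. \<bar>f x\<bar> \<le> \<bar>g x\<bar>" shows "L2norm f \<le> L2norm g"
  unfolding L2norm_def
  by (intro real_sqrt_le_mono integral_mono L2_square_integrable L2_bound[OF assms] assms(1))
    (use assms(3) in \<open>simp add: abs_le_square_iff\<close>)

lemma test_measurable [measurable_dest]: "test U f \<Longrightarrow> f \<in> borel_measurable borel"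
  by (intro borel_measurable_continuous_onI smooth_continuous test_smooth)

lemma test_integrable:
  assumes "test U f" shows "integrable lborel f"
proof -
  obtain K where K: "compact K" "\<And>x. x \<notin> K \<Longrightarrow> f x = 0"
    using assms by (meson test_support)
  have "integrable lborel (\<lambda>x. indicator K x *\<^sub>R f x)"
    by (intro borel_integrable_compact K smooth_continuous test_smooth[OF assms])
  moreover have "(\<lambda>x. indicator K x *\<^sub>R f x) = f"
    using K(2) by (force simp: indicator_def)
  ultimately show ?thesis by simp
qed

lemma test_L2: assumes "test U f" shows "f \<in> L2"
proof (rule L2I)
  show "f \<in> borel_measurable borel" using assms by measurable
  have "test U (\<lambda>x. f x * f x)" by (intro test_mult_smooth test_smooth[OF assms] assms)
  then show "integrable lborel (\<lambda>x. (f x)\<^sup>2)" by (simp add: power2_eq_square test_integrable)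
qed

lemma L2_mult_bounded:
  assumes "f \<in> L2" "g \<in> borel_measurable borel" "\<And>x. \<bar>g x\<bar> \<le> B"
  shows "(\<lambda>x. g x * f x) \<in> L2" "L2norm (\<lambda>x. g x * f x) \<le> B * L2norm f"
proof -
  have B: "B \<ge> 0" using assms(3)[of 0] by linarith
  have m: "(\<lambda>x. g x * f x) \<in> borel_measurable borel" using assms by measurable
  have le: "\<bar>g x * f x\<bar> \<le> \<bar>B * f x\<bar>" for x
    using assms(3)[of x] B by (simp add: abs_mult mult_right_mono)
  show "(\<lambda>x. g x * f x) \<in> L2" by (rule L2_bound[OF L2_cmult[OF assms(1)] m le])
  show "L2norm (\<lambda>x. g x * f x) \<le> B * L2norm f"
    using L2norm_mono[OF L2_cmult[OF assms(1)] m le] B by (simp add: L2norm_cmult)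
qed

subsection \<open>Affine substitutions\<close>

lemma lborel_affine_measure:
  assumes "c \<noteq> 0"
  shows "(lborel :: (real^3) measure) = density (distr lborel borel (\<lambda>x. t + c *\<^sub>R x)) (\<lambda>_. \<bar>c\<bar> ^ 3)"
  using lborel_affine[OF assms, where t = t] by simp

lemma integral_affine:
  fixes f :: "real^3 \<Rightarrow> real"
  assumes "f \<in> borel_measurable borel" "c \<noteq> 0"
  shows "integral\<^sup>L lborel f = \<bar>c\<bar> ^ 3 * integral\<^sup>L lborel (\<lambda>x. f (t + c *\<^sub>R x))"
  using assms by (subst lborel_affine_measure[of c t]) (simp_all add: integral_density integral_distr)

lemma integrable_affine:
  fixes f :: "real^3 \<Rightarrow> real"
  assumes "f \<in> borel_measurable borel" "c \<noteq> 0"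
  shows "integrable lborel (\<lambda>x. f (t + c *\<^sub>R x)) \<longleftrightarrow> integrable lborel f"
  using assms by (subst (2) lborel_affine_measure[of c t])
    (simp_all add: integrable_density integrable_distr_eq)

lemma L2_affine:
  assumes "f \<in> L2" "c \<noteq> 0"
  shows "(\<lambda>x. f (t + c *\<^sub>R x)) \<in> L2" "\<bar>c\<bar> ^ 3 * (L2norm (\<lambda>x. f (t + c *\<^sub>R x)))\<^sup>2 = (L2norm f)\<^sup>2"
proof -
  have [measurable]: "f \<in> borel_measurable borel" using assms by measurable
  show "(\<lambda>x. f (t + c *\<^sub>R x)) \<in> L2"
    by (rule L2I) (use integrable_affine[of "\<lambda>x. (f x)\<^sup>2" c t] assms L2_square_integrable in auto)
  show "\<bar>c\<bar> ^ 3 * (L2norm (\<lambda>x. f (t + c *\<^sub>R x)))\<^sup>2 = (L2norm f)\<^sup>2"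
    using integral_affine[of "\<lambda>x. (f x)\<^sup>2" c t] assms by (simp add: L2norm_def)
qed

subsection \<open>Completeness\<close>

definition L2_Cauchy :: "(nat \<Rightarrow> sfield) \<Rightarrow> bool" where
  "L2_Cauchy F \<longleftrightarrow> (\<forall>e>0. \<exists>M. \<forall>m\<ge>M. \<forall>n\<ge>M. L2norm (\<lambda>x. F m x - F n x) \<le> e)"

lemma ennreal_L2norm:
  assumes "f \<in> L2" shows "(\<integral>\<^sup>+x. ennreal ((f x)\<^sup>2) \<partial>lborel) = ennreal ((L2norm f)\<^sup>2)"
  using nn_integral_eq_integral[OF L2_square_integrable[OF assms]] by (simp add: L2norm_def)

text \<open>Tonelli and Fatou work with the extended integral, where integrability need not be known
  beforehand; this turns their outcome into membership in \<open>L2\<close> together with a norm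
  bound.\<close>

lemma L2norm_le_nn:
  assumes "f \<in> borel_measurable borel" "(\<integral>\<^sup>+x. ennreal ((f x)\<^sup>2) \<partial>lborel) \<le> ennreal (B\<^sup>2)" "B \<ge> 0"
  shows "f \<in> L2" "L2norm f \<le> B"
proof -
  have i: "integrable lborel (\<lambda>x. (f x)\<^sup>2)"
    by (rule integrableI_nonneg) (use assms in \<open>auto intro: le_less_trans\<close>)
  then show L: "f \<in> L2" by (rule L2I[OF assms(1)])
  have "(L2norm f)\<^sup>2 \<le> B\<^sup>2" using assms(2) unfolding ennreal_L2norm[OF L] by simp
  then show "L2norm f \<le> B" using assms(3) by (rule power2_le_imp_le)
qed

text \<open>The squared norms decay like (1/4)^k, so they can afford the weight 2^k. Where the
  weighted sum of squares is finite, \<open>d k x\<close> is dominated by a geometric sequence of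
  ratio sqrt(1/2).\<close>

lemma fast_Cauchy_AE_convergent:
  assumes L: "\<And>k. d k \<in> L2" and d: "\<And>k. L2norm (d k) \<le> (1/2) ^ k"
  shows "AE x in lborel. summable (\<lambda>k. d k x)"
proof -
  have [measurable]: "d k \<in> borel_measurable borel" for k using L by measurable
  have "(\<integral>\<^sup>+x. (\<Sum>k. ennreal (2 ^ k * (d k x)\<^sup>2)) \<partial>lborel) = (\<Sum>k. \<integral>\<^sup>+x. ennreal (2 ^ k * (d k x)\<^sup>2) \<partial>lborel)"
    by (rule nn_integral_suminf) measurable
  also have "\<dots> \<le> (\<Sum>k. ennreal ((1/2) ^ k))"
  proof (rule suminf_le)
    fix k
    have "(\<integral>\<^sup>+x. ennreal (2 ^ k * (d k x)\<^sup>2) \<partial>lborel) = ennreal (2 ^ k) * ennreal ((L2norm (d k))\<^sup>2)"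
      by (simp add: ennreal_mult nn_integral_cmult ennreal_L2norm[OF L])
    also have "\<dots> = ennreal (2 ^ k * (L2norm (d k))\<^sup>2)" by (simp add: ennreal_mult)
    also have "\<dots> \<le> ennreal ((1/2) ^ k)"
    proof (rule ennreal_leI)
      have "(L2norm (d k))\<^sup>2 \<le> ((1/2) ^ k)\<^sup>2" using d by (intro power_mono) auto
      then have "2 ^ k * (L2norm (d k))\<^sup>2 \<le> 2 ^ k * ((1/2) ^ k)\<^sup>2" by simp
      also have "\<dots> = (1/2) ^ k" by (simp add: power2_eq_square power_divide)
      finally show "2 ^ k * (L2norm (d k))\<^sup>2 \<le> (1/2) ^ k" .
    qed
    finally show "(\<integral>\<^sup>+x. ennreal (2 ^ k * (d k x)\<^sup>2) \<partial>lborel) \<le> ennreal ((1/2) ^ k)" .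
  qed auto
  also have "\<dots> < \<infinity>"
    by (subst suminf_ennreal2) (auto intro!: summable_geometric)
  finally have "AE x in lborel. (\<Sum>k. ennreal (2 ^ k * (d k x)\<^sup>2)) \<noteq> \<infinity>"
    by (intro nn_integral_PInf_AE) auto
  then show ?thesis
  proof eventually_elim
    fix x assume fin: "(\<Sum>k. ennreal (2 ^ k * (d k x)\<^sup>2)) \<noteq> \<infinity>"
    then obtain C where C: "(\<Sum>k. ennreal (2 ^ k * (d k x)\<^sup>2)) = ennreal C" "C \<ge> 0"
      by (metis ennreal_cases infinity_ennreal_def)
    have le: "\<bar>d k x\<bar> \<le> sqrt C * (sqrt (1/2)) ^ k" for k
    proof -
      have "(\<Sum>k\<in>{k}. ennreal (2 ^ k * (d k x)\<^sup>2)) \<le> (\<Sum>k. ennreal (2 ^ k * (d k x)\<^sup>2))"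
        by (rule sum_le_suminf) (auto intro: summableI)
      then have "ennreal (2 ^ k * (d k x)\<^sup>2) \<le> ennreal C"
        unfolding C(1) by (simp only: sum.insert sum.empty finite.emptyI empty_iff not_False_eq_True add_0_right)
      then have "2 ^ k * (d k x)\<^sup>2 \<le> C" by (subst (asm) ennreal_le_iff[OF C(2)])
      then have "(1/2) ^ k * (2 ^ k * (d k x)\<^sup>2) \<le> (1/2) ^ k * C" by (rule mult_left_mono) simp
      then have "(d k x)\<^sup>2 \<le> C * (1/2) ^ k" by (simp add: power_divide mult.commute)
      then have "sqrt ((d k x)\<^sup>2) \<le> sqrt (C * (1/2) ^ k)" by (rule real_sqrt_le_mono)
      moreover have "sqrt (C * (1/2) ^ k) = sqrt C * (sqrt (1/2)) ^ k"
        by (simp only: real_sqrt_mult real_sqrt_power)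
      ultimately show ?thesis by (simp only: real_sqrt_abs)
    qed
    show "summable (\<lambda>k. d k x)"
      by (rule summable_comparison_test'[where N = 0, OF summable_mult[OF summable_geometric]])
        (use le in \<open>auto simp: real_sqrt_divide\<close>)
  qed
qed

text \<open>The limit is a pointwise \<open>lim\<close> along a subsequence. Hence it vanishes at
  every single point where all \<open>F n\<close> do, which keeps limits of functions on the domain
  extended by zero.\<close>

lemma L2_complete:
  assumes L: "\<And>n. F n \<in> L2" and C: "L2_Cauchy F"
  shows "\<exists>u\<in>L2. (\<lambda>n. L2norm (\<lambda>x. F n x - u x)) \<longlonglongrightarrow> 0 \<and> (\<forall>x. (\<forall>n. F n x = 0) \<longrightarrow> u x = 0)"
proof -
  have [measurable]: "F n \<in> borel_measurable borel" for n using L by measurable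
  have "\<exists>M. \<forall>m\<ge>M. \<forall>n\<ge>M. L2norm (\<lambda>x. F m x - F n x) \<le> (1/2) ^ k" for k
    using C[unfolded L2_Cauchy_def, rule_format, of "(1/2) ^ k"] by simp
  then obtain M where M: "\<And>k m n. m \<ge> M k \<Longrightarrow> n \<ge> M k \<Longrightarrow> L2norm (\<lambda>x. F m x - F n x) \<le> (1/2) ^ k"
    by metis
  \<comment> \<open>Partial sums make the index increasing and at least \<open>M k\<close> at
    once.\<close>
  define r where "r k = (\<Sum>i\<le>k. M i)" for k
  have r: "r k \<ge> M k" for k unfolding r_def by (rule member_le_sum) auto
  have r': "r (Suc k) \<ge> M k" for k using r[of k] by (simp add: r_def)
  define d where "d k x = F (r (Suc k)) x - F (r k) x" for k x
  have dL: "d k \<in> L2" for k unfolding d_def using L by auto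
  have dn: "L2norm (d k) \<le> (1/2) ^ k" for k
    unfolding d_def by (rule M) (use r r' in auto)
  define u where "u x = lim (\<lambda>k. F (r k) x)" for x
  have [measurable]: "u \<in> borel_measurable borel" unfolding u_def by measurable
  have ae: "AE x in lborel. (\<lambda>k. F (r k) x) \<longlonglongrightarrow> u x"
    using fast_Cauchy_AE_convergent[OF dL dn]
  proof eventually_elim
    fix x assume "summable (\<lambda>k. d k x)"
    then have "convergent (\<lambda>n. \<Sum>k<n. d k x)" by (simp add: summable_iff_convergent)
    then have "convergent (\<lambda>n. F (r n) x - F (r 0) x)"
      unfolding d_def sum_lessThan_telescope[of "\<lambda>k. F (r k) x"] .
    then have "convergent (\<lambda>n. (F (r n) x - F (r 0) x) + F (r 0) x)"
      by (intro convergent_add convergent_const)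
    then show "(\<lambda>k. F (r k) x) \<longlonglongrightarrow> u x" by (simp add: u_def convergent_LIMSEQ_iff)
  qed
  \<comment> \<open>Fatou along the subsequence carries the Cauchy bound over to the limit, for
    every index \<open>m\<close> beyond \<open>M k\<close> and not only for those in the
    subsequence.\<close>
  have le: "(\<lambda>x. F m x - u x) \<in> L2 \<and> L2norm (\<lambda>x. F m x - u x) \<le> (1/2) ^ k" if m: "m \<ge> M k" for m k
  proof -
    have "(\<integral>\<^sup>+x. ennreal ((F m x - u x)\<^sup>2) \<partial>lborel)
        = (\<integral>\<^sup>+x. liminf (\<lambda>i. ennreal ((F m x - F (r i) x)\<^sup>2)) \<partial>lborel)"
    proof (rule nn_integral_cong_AE, use ae in eventually_elim)
      fix x assume "(\<lambda>k. F (r k) x) \<longlonglongrightarrow> u x"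
      then have "(\<lambda>i. ennreal ((F m x - F (r i) x)\<^sup>2)) \<longlonglongrightarrow> ennreal ((F m x - u x)\<^sup>2)"
        by (intro tendsto_intros)
      then show "ennreal ((F m x - u x)\<^sup>2) = liminf (\<lambda>i. ennreal ((F m x - F (r i) x)\<^sup>2))"
        by (rule lim_imp_Liminf[OF trivial_limit_sequentially, symmetric])
    qed
    also have "\<dots> \<le> liminf (\<lambda>i. \<integral>\<^sup>+x. ennreal ((F m x - F (r i) x)\<^sup>2) \<partial>lborel)"
      by (rule nn_integral_liminf) measurable
    also have "\<dots> \<le> liminf (\<lambda>i::nat. ennreal (((1/2) ^ k)\<^sup>2))"
    proof (rule Liminf_mono, rule eventually_sequentiallyI[of k])
      fix i assume "k \<le> i"
      then have "r i \<ge> M k" using r[of k] unfolding r_def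
        by (meson atMost_subset_iff finite_atMost le_trans order_refl sum_mono2 zero_le)
      then have "(L2norm (\<lambda>x. F m x - F (r i) x))\<^sup>2 \<le> ((1/2) ^ k)\<^sup>2"
        by (intro power_mono M m) auto
      then show "(\<integral>\<^sup>+x. ennreal ((F m x - F (r i) x)\<^sup>2) \<partial>lborel) \<le> ennreal (((1/2) ^ k)\<^sup>2)"
        by (subst ennreal_L2norm) (use L in auto)
    qed
    also have "\<dots> = ennreal (((1/2) ^ k)\<^sup>2)" by (simp add: Liminf_const)
    finally show ?thesis by (intro conjI L2norm_le_nn) auto
  qed
  have "u \<in> L2"
    using L2_diff[OF L[of "M 0"] conjunct1[OF le[of 0 "M 0"]]] by simp
  moreover have "(\<lambda>n. L2norm (\<lambda>x. F n x - u x)) \<longlonglongrightarrow> 0"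
  proof (rule LIMSEQ_I)
    fix e :: real assume "e > 0"
    then obtain k where k: "(1/2) ^ k < e" using one_less_inverse real_arch_pow_inv[of e "1/2"] by auto
    show "\<exists>no. \<forall>n\<ge>no. norm (L2norm (\<lambda>x. F n x - u x) - 0) < e"
      using le k by (auto intro!: exI[of _ "M k"] intro: le_less_trans)
  qed
  moreover have "\<forall>x. (\<forall>n. F n x = 0) \<longrightarrow> u x = 0" by (simp add: u_def)
  ultimately show ?thesis by blast
qed

lemma L2_limit_unique:
  assumes "\<And>n. F n \<in> L2" "u \<in> L2" "v \<in> L2"
    and "(\<lambda>n. L2norm (\<lambda>x. F n x - u x)) \<longlonglongrightarrow> 0" "(\<lambda>n. L2norm (\<lambda>x. F n x - v x)) \<longlonglongrightarrow> 0"
  shows "AE x in lborel. u x = v x"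
proof -
  have "L2norm (\<lambda>x. u x - v x) \<le> L2norm (\<lambda>x. F n x - u x) + L2norm (\<lambda>x. F n x - v x)" for n
    using L2norm_triangle3[OF assms(2) assms(1)[of n] assms(3)] by (simp add: L2norm_minus[of u])
  moreover have "(\<lambda>n. L2norm (\<lambda>x. F n x - u x) + L2norm (\<lambda>x. F n x - v x)) \<longlonglongrightarrow> 0"
    using tendsto_add[OF assms(4,5)] by simp
  ultimately have "L2norm (\<lambda>x. u x - v x) \<le> 0" by (intro LIMSEQ_le_const) auto
  then have "AE x in lborel. u x - v x = 0"
    using L2norm_nonneg[of "\<lambda>x. u x - v x"] by (intro L2norm_AE_zero) (use assms in auto)
  then show ?thesis by simp
qed

section \<open>Density of compactly supported continuous functions, by regularity of Lebesgue
  measure and Urysohn functions\<close>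

subsection \<open>Density of continuous functions\<close>

definition Cc :: "sfield \<Rightarrow> bool" where
  "Cc c \<longleftrightarrow> continuous_on UNIV c \<and> (\<exists>R. \<forall>x. norm x > R \<longrightarrow> c x = 0)"

definition Cc_approx :: "sfield \<Rightarrow> bool" where
  "Cc_approx f \<longleftrightarrow> f \<in> L2 \<and> (\<forall>e>0. \<exists>c. Cc c \<and> c \<in> L2 \<and> L2norm (\<lambda>x. f x - c x) < e)"

lemma Cc_zero [simp]: "Cc (\<lambda>x. 0)" by (simp add: Cc_def)

lemma Cc_L2:
  assumes "Cc c" shows "c \<in> L2"
proof (rule L2I)
  have cont: "continuous_on UNIV c" using assms by (simp add: Cc_def)
  then show "c \<in> borel_measurable borel" by (rule borel_measurable_continuous_onI)
  obtain R where R: "\<And>x. norm x > R \<Longrightarrow> c x = 0" using assms by (auto simp: Cc_def)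
  have "integrable lborel (\<lambda>x. indicator (cball 0 R) x *\<^sub>R (c x)\<^sup>2)"
    by (intro borel_integrable_compact compact_cball continuous_intros continuous_on_subset[OF cont]) auto
  moreover have "(\<lambda>x. indicator (cball 0 R) x *\<^sub>R (c x)\<^sup>2) = (\<lambda>x. (c x)\<^sup>2)"
    using R by (auto simp: indicator_def fun_eq_iff not_le)
  ultimately show "integrable lborel (\<lambda>x. (c x)\<^sup>2)" by simp
qed

lemma Cc_approx_add:
  assumes "Cc_approx f" "Cc_approx g" shows "Cc_approx (\<lambda>x. f x + g x)"
proof -
  have L: "f \<in> L2" "g \<in> L2" using assms by (auto simp: Cc_approx_def)
  have "\<exists>c. Cc c \<and> c \<in> L2 \<and> L2norm (\<lambda>x. f x + g x - c x) < e" if e: "e > 0" for e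
  proof -
    obtain c d where c: "Cc c" "c \<in> L2" "L2norm (\<lambda>x. f x - c x) < e / 2"
      and d: "Cc d" "d \<in> L2" "L2norm (\<lambda>x. g x - d x) < e / 2"
      using assms e unfolding Cc_approx_def by (meson half_gt_zero)
    obtain R S where "\<And>x. norm x > R \<Longrightarrow> c x = 0" "\<And>x. norm x > S \<Longrightarrow> d x = 0"
      using c d unfolding Cc_def by auto
    then have "Cc (\<lambda>x. c x + d x)" using c d
      by (auto simp: Cc_def intro!: continuous_intros exI[of _ "max R S"])
    moreover have "L2norm (\<lambda>x. f x + g x - (c x + d x)) < e"
      using L2norm_triangle[OF L2_diff[OF L(1) c(2)] L2_diff[OF L(2) d(2)]] c(3) d(3)
      by (simp add: algebra_simps)
    ultimately show ?thesis using c d by (intro exI[of _ "\<lambda>x. c x + d x"]) auto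
  qed
  then show ?thesis using L by (auto simp: Cc_approx_def)
qed

lemma Cc_approx_cmult:
  assumes "Cc_approx f" shows "Cc_approx (\<lambda>x. k * f x)"
proof -
  have "\<exists>c. Cc c \<and> c \<in> L2 \<and> L2norm (\<lambda>x. k * f x - c x) < e" if e: "e > 0" for e
  proof -
    have "e / (\<bar>k\<bar> + 1) > 0" using e by simp
    then obtain c where c: "Cc c" "c \<in> L2" "L2norm (\<lambda>x. f x - c x) < e / (\<bar>k\<bar> + 1)"
      using assms unfolding Cc_approx_def by blast
    have "Cc (\<lambda>x. k * c x)" using c(1) by (auto simp: Cc_def intro!: continuous_intros)
    moreover have "L2norm (\<lambda>x. k * f x - k * c x) < e"
    proof -
      have "L2norm (\<lambda>x. k * f x - k * c x) = \<bar>k\<bar> * L2norm (\<lambda>x. f x - c x)"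
        using L2norm_cmult[of k "\<lambda>x. f x - c x"] by (simp add: algebra_simps)
      also have "\<dots> \<le> (\<bar>k\<bar> + 1) * L2norm (\<lambda>x. f x - c x)" by (intro mult_right_mono) auto
      also have "\<dots> < e" using c(3) by (simp add: field_simps)
      finally show ?thesis .
    qed
    ultimately show ?thesis using c by (intro exI[of _ "\<lambda>x. k * c x"]) auto
  qed
  then show ?thesis using assms by (auto simp: Cc_approx_def)
qed

lemma Cc_approx_sum: "(\<And>i. i \<in> I \<Longrightarrow> Cc_approx (f i)) \<Longrightarrow> Cc_approx (\<lambda>x. \<Sum>i\<in>I. f i x)"
proof (induction I rule: infinite_finite_induct)
  case (infinite A)
  then show ?case by (auto simp: Cc_approx_def intro!: exI[of _ "\<lambda>x. 0"])
next
  case empty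
  then show ?case by (auto simp: Cc_approx_def intro!: exI[of _ "\<lambda>x. 0"])
qed (auto intro: Cc_approx_add)

lemma Cc_approx_indicator:
  assumes A: "A \<in> sets borel" "A \<subseteq> cball 0 R" shows "Cc_approx (indicator A)"
proof -
  have mA: "emeasure lborel A \<le> emeasure lborel (cball 0 R :: (real^3) set)"
    using A by (intro emeasure_mono) auto
  have fin: "emeasure lborel (cball 0 R' :: (real^3) set) < \<infinity>" for R' by (rule emeasure_compact_finite[OF compact_cball])
  have IL2: "(indicator B :: sfield) \<in> L2" if "B \<in> sets borel" "emeasure lborel B < \<infinity>" for B
  proof (rule L2I)
    have "(\<lambda>x. (indicator B x :: real)\<^sup>2) = indicator B" by (auto simp: indicator_def)
    then show "integrable lborel (\<lambda>x. (indicator B x :: real)\<^sup>2)" using that by simp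
  qed (use that in simp)
  have L: "(indicator A :: sfield) \<in> L2" using IL2 A(1) mA fin[of R] by (simp add: le_less_trans)
  have "\<exists>c. Cc c \<and> c \<in> L2 \<and> L2norm (\<lambda>x. indicator A x - c x) < e" if e: "e > 0" for e
  proof -
    \<comment> \<open>Two measure defects of size \<open>\<delta>\<close> add up to (e/2)^2, the
      square of the allowed error in L2.\<close>
    define \<delta> where "\<delta> = (e / 2)\<^sup>2 / 2"
    have \<delta>: "\<delta> > 0" using e by (simp add: \<delta>_def)
    obtain U where U: "open U" "A \<subseteq> U" "emeasure lborel (U - A) < \<delta>"
      using outer_regular_lborel[OF A(1) \<delta>] by blast
    have "cball 0 R - A \<in> sets borel" using A(1) by auto
    then obtain T where T: "open T" "cball 0 R - A \<subseteq> T" "emeasure lborel (T - (cball 0 R - A)) < \<delta>"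
      using outer_regular_lborel[OF _ \<delta>] by blast
    \<comment> \<open>Outer regularity of the complement of \<open>A\<close> in the ball yields
      inner regularity of \<open>A\<close>.\<close>
    define K where "K = cball 0 R - T"
    \<comment> \<open>Cutting \<open>U\<close> down to a ball gives the Urysohn function bounded
      support.\<close>
    define V where "V = U \<inter> ball 0 (R + 1)"
    have K: "closed K" "K \<subseteq> A" using T by (auto simp: K_def)
    have V: "open V" "A \<subseteq> V" using U A by (auto simp: V_def)
    obtain c :: sfield where c: "continuous_on UNIV c" "\<And>x. c x \<in> closed_segment 1 0"
      "\<And>x. x \<in> K \<Longrightarrow> c x = 1" "\<And>x. x \<in> - V \<Longrightarrow> c x = 0"
      by (rule Urysohn[of K "- V" 1 0]) (use K V in auto)
    have c01: "0 \<le> c x" "c x \<le> 1" for x using c(2)[of x] by (auto simp: closed_segment_eq_real_ivl)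
    have Cc: "Cc c" unfolding Cc_def using c by (auto simp: V_def intro!: exI[of _ "R + 1"])
    then have cL: "c \<in> L2" by (rule Cc_L2)
    have mV: "V - K \<in> sets borel" using K V by auto
    have "emeasure lborel (V - K) \<le> emeasure lborel ((U - A) \<union> (T - (cball 0 R - A)))"
      using A(2) K(1) V(1) U(1) T(1) A(1) by (intro emeasure_mono) (auto simp: V_def K_def)
    also have "\<dots> \<le> emeasure lborel (U - A) + emeasure lborel (T - (cball 0 R - A))"
      using U(1) T(1) A(1) by (intro emeasure_subadditive) auto
    also have "\<dots> \<le> ennreal \<delta> + ennreal \<delta>" using U(3) T(3) by (intro add_mono) auto
    also have "\<dots> = ennreal ((e / 2)\<^sup>2)" using \<delta> by (simp add: ennreal_plus[symmetric] \<delta>_def)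
    finally have mle: "emeasure lborel (V - K) \<le> ennreal ((e / 2)\<^sup>2)" .
    have "(\<integral>\<^sup>+x. ennreal ((indicator A x - c x)\<^sup>2) \<partial>lborel) \<le> (\<integral>\<^sup>+x. indicator (V - K) x \<partial>lborel)"
    proof (rule nn_integral_mono)
      fix x
      have "x \<in> K \<Longrightarrow> x \<in> A" "x \<in> A \<Longrightarrow> x \<in> V" using K(2) V(2) by auto
      moreover have "(indicator A x - c x)\<^sup>2 \<le> 1"
        using c01[of x] by (auto simp: indicator_def power2_eq_square abs_le_iff intro: mult_le_one)
      ultimately show "ennreal ((indicator A x - c x)\<^sup>2) \<le> indicator (V - K) x"
        using c(3)[of x] c(4)[of x] by (auto simp: indicator_def)
    qed
    also have "\<dots> = emeasure lborel (V - K)" using mV by simp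
    also note mle
    finally have "L2norm (\<lambda>x. indicator A x - c x) \<le> e / 2"
      using e L cL by (intro L2norm_le_nn(2)) auto
    then show ?thesis using Cc cL e by (intro exI[of _ c]) auto
  qed
  then show ?thesis using L by (auto simp: Cc_approx_def)
qed

lemma Cc_approx_limit:
  assumes "\<And>n. Cc_approx (F n)" "f \<in> L2" "(\<lambda>n. L2norm (\<lambda>x. f x - F n x)) \<longlonglongrightarrow> 0"
  shows "Cc_approx f"
proof -
  have "\<exists>c. Cc c \<and> c \<in> L2 \<and> L2norm (\<lambda>x. f x - c x) < e" if e: "e > 0" for e
  proof -
    obtain n where "L2norm (\<lambda>x. f x - F n x) < e / 2"
      using LIMSEQ_D[OF assms(3), of "e / 2"] e by auto
    moreover obtain c where c: "Cc c" "c \<in> L2" "L2norm (\<lambda>x. F n x - c x) < e / 2"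
      using assms(1)[of n] e unfolding Cc_approx_def by (meson half_gt_zero)
    moreover have "F n \<in> L2" using assms(1) by (auto simp: Cc_approx_def)
    ultimately show ?thesis using L2norm_triangle3[OF assms(2) _ c(2), of "F n"]
      by (intro exI[of _ c]) auto
  qed
  then show ?thesis using assms by (auto simp: Cc_approx_def)
qed

lemma L2_dominated:
  assumes "g \<in> L2" "\<And>n. F n \<in> borel_measurable borel" "f \<in> borel_measurable borel"
    and "\<And>n x. \<bar>f x - F n x\<bar> \<le> \<bar>g x\<bar>" "\<And>x. (\<lambda>n. F n x) \<longlonglongrightarrow> f x"
  shows "(\<lambda>n. L2norm (\<lambda>x. f x - F n x)) \<longlonglongrightarrow> 0"
proof -
  have "(\<lambda>n. integral\<^sup>L lborel (\<lambda>x. (f x - F n x)\<^sup>2)) \<longlonglongrightarrow> integral\<^sup>L lborel (\<lambda>x::real^3. 0::real)"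
  proof (rule integral_dominated_convergence[where w = "\<lambda>x. (g x)\<^sup>2"])
    show "AE x in lborel. (\<lambda>n. (f x - F n x)\<^sup>2) \<longlonglongrightarrow> 0"
    proof (rule AE_I2)
      fix x
      have "(\<lambda>n. (f x - F n x)\<^sup>2) \<longlonglongrightarrow> (f x - f x)\<^sup>2" by (intro tendsto_intros assms)
      then show "(\<lambda>n. (f x - F n x)\<^sup>2) \<longlonglongrightarrow> 0" by simp
    qed
    show "AE x in lborel. norm ((f x - F n x)\<^sup>2) \<le> (g x)\<^sup>2" for n
      using assms(4) by (auto simp: abs_le_square_iff)
  qed (use assms in \<open>auto simp: L2_square_integrable\<close>)
  from tendsto_real_sqrt[OF this] show ?thesis by (simp add: L2norm_def)
qed

lemma L2_Cc_approx:
  assumes f: "f \<in> L2" shows "Cc_approx f"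
proof -
  have [measurable]: "f \<in> borel_measurable borel" using f by measurable
  obtain F where F: "\<And>i. simple_function lborel (F i)" "\<And>x. (\<lambda>i. F i x) \<longlonglongrightarrow> f x" "\<And>i x. dist (F i x) 0 \<le> 2 * dist (f x) 0"
    using borel_measurable_implies_sequence_metric[of f lborel 0] by auto
  have [measurable]: "F i \<in> borel_measurable borel" for i
    using borel_measurable_simple_function[OF F(1)[of i]] by simp
  define G where "G i x = F i x * indicator (cball 0 (real i)) x" for i x
  have [measurable]: "G i \<in> borel_measurable borel" for i
    unfolding G_def by (intro borel_measurable_times borel_measurable_indicator) auto
  have G: "Cc_approx (G i)" for i
  proof -
    have fin: "finite (F i ` UNIV)" using simple_functionD(1)[OF F(1)[of i]] by simp
    have "G i = (\<lambda>x. \<Sum>y\<in>F i ` UNIV. y * indicator (F i -` {y} \<inter> cball 0 (real i)) x)"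
    proof
      fix x
      have "(\<Sum>y\<in>F i ` UNIV. y * indicator (F i -` {y} \<inter> cball 0 (real i)) x)
        = (\<Sum>y\<in>{F i x}. y * indicator (F i -` {y} \<inter> cball 0 (real i)) x)"
        by (rule sum.mono_neutral_right) (use fin in \<open>auto simp: indicator_def\<close>)
      then show "G i x = (\<Sum>y\<in>F i ` UNIV. y * indicator (F i -` {y} \<inter> cball 0 (real i)) x)"
        by (simp add: G_def indicator_def)
    qed
    moreover have "Cc_approx (\<lambda>x. \<Sum>y\<in>F i ` UNIV. y * indicator (F i -` {y} \<inter> cball 0 (real i)) x)"
      by (intro Cc_approx_sum Cc_approx_cmult Cc_approx_indicator[where R = "real i"] sets.Int
          measurable_sets_borel[where M = borel]) auto
    ultimately show ?thesis by simp
  qed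
  have "(\<lambda>n. L2norm (\<lambda>x. f x - G n x)) \<longlonglongrightarrow> 0"
  \<comment> \<open>The simple functions satisfy |F| \<le> 2 |f|, and truncation only shrinks them,
    so the error is at most 3 |f|.\<close>
  proof (rule L2_dominated[where g = "\<lambda>x. 3 * f x"])
    show "\<bar>f x - G n x\<bar> \<le> \<bar>3 * f x\<bar>" for n x
      using F(3)[of n x] by (auto simp: G_def indicator_def)
    show "(\<lambda>n. G n x) \<longlonglongrightarrow> f x" for x
    proof (rule Lim_transform_eventually[OF F(2)[of x]])
      obtain N where "norm x \<le> real N" using real_arch_simple by blast
      then show "\<forall>\<^sub>F n in sequentially. F n x = G n x"
        by (intro eventually_sequentiallyI[of N]) (auto simp: G_def indicator_def)
    qed
  qed (use f in auto)
  with G f show ?thesis by (rule Cc_approx_limit)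
qed


section \<open>Convolution operators carrying a scale: Young's inequality, adjoints, derivatives,
  approximate identities\<close>

section \<open>Scaled convolutions\<close>

text \<open>The scale sits in the argument of the function, so no normalising factor appears, the
  adjoint is obtained by \<open>s \<mapsto> - s\<close>, and operators with different kernels and scales commute.\<close>

lemma indicator_cball_L2: "(indicator (cball a R) :: sfield) \<in> L2"
proof (rule L2I)
  have "(\<lambda>x. (indicator (cball a R) x :: real)\<^sup>2) = indicator (cball a R)" by (auto simp: indicator_def)
  moreover have "integrable lborel (indicator (cball a R) :: sfield)"
    using emeasure_compact_finite[OF compact_cball[of a R]] by (intro integrable_real_indicator) auto
  ultimately show "integrable lborel (\<lambda>x. (indicator (cball a R) x :: real)\<^sup>2)" by simp
qed (auto intro!: borel_measurable_indicator)

definition cv :: "sfield \<Rightarrow> real \<Rightarrow> sfield \<Rightarrow> sfield" where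
  "cv K s f x = integral\<^sup>L lborel (\<lambda>z. K z * f (x - s *\<^sub>R z))"

definition L1norm :: "sfield \<Rightarrow> real" where
  "L1norm K = integral\<^sup>L lborel (\<lambda>z. \<bar>K z\<bar>)"

lemma L1norm_nonneg [simp]: "0 \<le> L1norm K" by (simp add: L1norm_def)

lemma L2_reflect:
  assumes "f \<in> L2" "s \<noteq> 0"
  shows "(\<lambda>z. f (x - s *\<^sub>R z)) \<in> L2" "\<bar>s\<bar> ^ 3 * (L2norm (\<lambda>z. f (x - s *\<^sub>R z)))\<^sup>2 = (L2norm f)\<^sup>2"
  using L2_affine[of f "- s" x] assms by simp_all

lemma L2_translate:
  assumes "f \<in> L2"
  shows "(\<lambda>z. f (z - x)) \<in> L2" "L2norm (\<lambda>z. f (z - x)) = L2norm f"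
proof -
  show "(\<lambda>z. f (z - x)) \<in> L2" using L2_affine(1)[of f 1 "- x"] assms by simp
  have "(L2norm (\<lambda>z. f (z - x)))\<^sup>2 = (L2norm f)\<^sup>2" using L2_affine(2)[of f 1 "- x"] assms by simp
  then show "L2norm (\<lambda>z. f (z - x)) = L2norm f" by simp
qed

lemma cv_integrable:
  "test UNIV K \<Longrightarrow> f \<in> L2 \<Longrightarrow> s \<noteq> 0 \<Longrightarrow> integrable lborel (\<lambda>z. K z * f (x - s *\<^sub>R z))"
  using L2_mult_integrable[OF test_L2 L2_reflect(1)] by blast

lemma cv_measurable [measurable]:
  assumes [measurable]: "K \<in> borel_measurable borel" "f \<in> borel_measurable borel"
  shows "cv K s f \<in> borel_measurable borel"
proof -
  have "(\<lambda>x. integral\<^sup>L lborel (\<lambda>z. K z * f (x - s *\<^sub>R z))) \<in> borel_measurable lborel"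
    by measurable
  then show ?thesis by (simp add: cv_def[abs_def])
qed

text \<open>Splitting |K| into two square roots, Cauchy-Schwarz bounds the square pointwise and
  Tonelli integrates it. For fixed \<open>z\<close> only a translation by
  \<open>s *\<^sub>R z\<close> is involved, so the constant does not depend on the scale; all dyadic
  sums rely on this uniformity.\<close>

lemma cv_Young:
  assumes K: "test UNIV K" and f: "f \<in> L2" and s: "s \<noteq> 0"
  shows "cv K s f \<in> L2" "L2norm (cv K s f) \<le> L1norm K * L2norm f"
proof -
  have [measurable]: "K \<in> borel_measurable borel" "f \<in> borel_measurable borel" using K f by measurable
  obtain B where B: "\<And>x. \<bar>K x\<bar> \<le> B" using test_bounded[OF K] by blast
  have Kint: "integrable lborel (\<lambda>z. \<bar>K z\<bar>)" using test_integrable[OF K] by simp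
  have a: "(\<lambda>z. sqrt \<bar>K z\<bar>) \<in> L2" using Kint by (intro L2I) auto
  have "\<bar>sqrt \<bar>K z\<bar>\<bar> \<le> sqrt B" for z using B[of z] by simp
  then have b: "(\<lambda>z. sqrt \<bar>K z\<bar> * f (x - s *\<^sub>R z)) \<in> L2" for x
    by (intro L2_mult_bounded(1)[where B = "sqrt B"] L2_reflect(1) f s) auto
  have intb: "integrable lborel (\<lambda>z. \<bar>K z\<bar> * (f (x - s *\<^sub>R z))\<^sup>2)" for x
    using L2_square_integrable[OF b[of x]] by (simp add: power_mult_distrib)
  have pt: "(cv K s f x)\<^sup>2 \<le> L1norm K * integral\<^sup>L lborel (\<lambda>z. \<bar>K z\<bar> * (f (x - s *\<^sub>R z))\<^sup>2)" for x
  proof -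
    have "\<bar>cv K s f x\<bar> \<le> integral\<^sup>L lborel (\<lambda>z. norm (K z * f (x - s *\<^sub>R z)))"
      unfolding cv_def using integral_norm_bound[of lborel "\<lambda>z. K z * f (x - s *\<^sub>R z)"] by simp
    also have "\<dots> = ip (\<lambda>z. sqrt \<bar>K z\<bar>) (\<lambda>z. sqrt \<bar>K z\<bar> * \<bar>f (x - s *\<^sub>R z)\<bar>)"
      by (simp add: ip_def abs_mult flip: mult.assoc)
    also have "\<dots> \<le> L2norm (\<lambda>z. sqrt \<bar>K z\<bar>) * L2norm (\<lambda>z. sqrt \<bar>K z\<bar> * \<bar>f (x - s *\<^sub>R z)\<bar>)"
    proof -
      have "(\<lambda>z. sqrt \<bar>K z\<bar> * \<bar>f (x - s *\<^sub>R z)\<bar>) \<in> L2"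
        by (rule L2_bound[OF b[of x]]) (auto simp: abs_mult)
      from L2_Cauchy_Schwarz[OF a this] show ?thesis by linarith
    qed
    finally have "\<bar>cv K s f x\<bar>\<^sup>2 \<le> (L2norm (\<lambda>z. sqrt \<bar>K z\<bar>) * L2norm (\<lambda>z. sqrt \<bar>K z\<bar> * \<bar>f (x - s *\<^sub>R z)\<bar>))\<^sup>2"
      by (rule power_mono) simp
    moreover have "(L2norm (\<lambda>z. sqrt \<bar>K z\<bar>))\<^sup>2 = L1norm K"
      by (simp add: L2norm_power2 ip_def L1norm_def)
    moreover have "(L2norm (\<lambda>z. sqrt \<bar>K z\<bar> * \<bar>f (x - s *\<^sub>R z)\<bar>))\<^sup>2 = integral\<^sup>L lborel (\<lambda>z. \<bar>K z\<bar> * (f (x - s *\<^sub>R z))\<^sup>2)"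
      unfolding L2norm_def by (simp add: power_mult_distrib)
    ultimately show ?thesis by (simp only: power_mult_distrib power2_abs)
  qed
  have "(\<integral>\<^sup>+x. ennreal ((cv K s f x)\<^sup>2) \<partial>lborel)
     \<le> (\<integral>\<^sup>+x. ennreal (L1norm K) * (\<integral>\<^sup>+z. ennreal (\<bar>K z\<bar> * (f (x - s *\<^sub>R z))\<^sup>2) \<partial>lborel) \<partial>lborel)"
  proof (rule nn_integral_mono)
    fix x
    have "ennreal ((cv K s f x)\<^sup>2) \<le> ennreal (L1norm K * integral\<^sup>L lborel (\<lambda>z. \<bar>K z\<bar> * (f (x - s *\<^sub>R z))\<^sup>2))"
      by (rule ennreal_leI[OF pt])
    also have "\<dots> = ennreal (L1norm K) * ennreal (integral\<^sup>L lborel (\<lambda>z. \<bar>K z\<bar> * (f (x - s *\<^sub>R z))\<^sup>2))"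
      by (intro ennreal_mult) auto
    also have "ennreal (integral\<^sup>L lborel (\<lambda>z. \<bar>K z\<bar> * (f (x - s *\<^sub>R z))\<^sup>2)) = (\<integral>\<^sup>+z. ennreal (\<bar>K z\<bar> * (f (x - s *\<^sub>R z))\<^sup>2) \<partial>lborel)"
      by (rule nn_integral_eq_integral[symmetric]) (use intb in auto)
    finally show "ennreal ((cv K s f x)\<^sup>2) \<le> ennreal (L1norm K) * (\<integral>\<^sup>+z. ennreal (\<bar>K z\<bar> * (f (x - s *\<^sub>R z))\<^sup>2) \<partial>lborel)" .
  qed
  also have "\<dots> = ennreal (L1norm K) * (\<integral>\<^sup>+x. (\<integral>\<^sup>+z. ennreal (\<bar>K z\<bar> * (f (x - s *\<^sub>R z))\<^sup>2) \<partial>lborel) \<partial>lborel)"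
    by (rule nn_integral_cmult) measurable
  also have "(\<integral>\<^sup>+x. (\<integral>\<^sup>+z. ennreal (\<bar>K z\<bar> * (f (x - s *\<^sub>R z))\<^sup>2) \<partial>lborel) \<partial>lborel)
     = (\<integral>\<^sup>+z. (\<integral>\<^sup>+x. ennreal (\<bar>K z\<bar> * (f (x - s *\<^sub>R z))\<^sup>2) \<partial>lborel) \<partial>lborel)"
    by (rule lborel_pair.Fubini') measurable
  also have "\<dots> = (\<integral>\<^sup>+z. ennreal \<bar>K z\<bar> * ennreal ((L2norm f)\<^sup>2) \<partial>lborel)"
  proof (rule nn_integral_cong)
    fix z
    have "(\<integral>\<^sup>+x. ennreal (\<bar>K z\<bar> * (f (x - s *\<^sub>R z))\<^sup>2) \<partial>lborel) = ennreal \<bar>K z\<bar> * (\<integral>\<^sup>+x. ennreal ((f (x - s *\<^sub>R z))\<^sup>2) \<partial>lborel)"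
      by (simp add: ennreal_mult nn_integral_cmult)
    also have "(\<integral>\<^sup>+x. ennreal ((f (x - s *\<^sub>R z))\<^sup>2) \<partial>lborel) = ennreal ((L2norm f)\<^sup>2)"
      using ennreal_L2norm[OF L2_translate(1)[OF f, of "s *\<^sub>R z"]] L2_translate(2)[OF f, of "s *\<^sub>R z"] by simp
    finally show "(\<integral>\<^sup>+x. ennreal (\<bar>K z\<bar> * (f (x - s *\<^sub>R z))\<^sup>2) \<partial>lborel) = ennreal \<bar>K z\<bar> * ennreal ((L2norm f)\<^sup>2)" .
  qed
  also have "\<dots> = ennreal (L1norm K) * ennreal ((L2norm f)\<^sup>2)"
    using nn_integral_eq_integral[OF Kint] by (simp add: nn_integral_multc L1norm_def)
  also have "ennreal (L1norm K) * (ennreal (L1norm K) * ennreal ((L2norm f)\<^sup>2)) = ennreal ((L1norm K * L2norm f)\<^sup>2)"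
    by (simp add: ennreal_mult[symmetric] power2_eq_square ac_simps)
  finally have fin: "(\<integral>\<^sup>+x. ennreal ((cv K s f x)\<^sup>2) \<partial>lborel) \<le> ennreal ((L1norm K * L2norm f)\<^sup>2)" .
  show "cv K s f \<in> L2" by (rule L2norm_le_nn(1)[OF _ fin]) auto
  show "L2norm (cv K s f) \<le> L1norm K * L2norm f" by (rule L2norm_le_nn(2)[OF _ fin]) auto
qed

text \<open>The integrability hypothesis for the exchanges of integrals in \<open>cv_adjoint\<close>
  and \<open>cv_commute\<close>: a kernel weights a family of integrands with uniformly bounded L1
  norms.\<close>

lemma pair_integrable:
  fixes K :: sfield and F :: "real^3 \<Rightarrow> real^3 \<Rightarrow> real"
  assumes K: "integrable lborel K"
    and F [measurable]: "(\<lambda>(z, x). F z x) \<in> borel_measurable (lborel \<Otimes>\<^sub>M lborel)"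
    and "\<And>z. integrable lborel (F z)" "\<And>z. integral\<^sup>L lborel (\<lambda>x. \<bar>F z x\<bar>) \<le> B"
  shows "integrable (lborel \<Otimes>\<^sub>M lborel) (\<lambda>(z, x). K z * F z x)"
proof (rule lborel_pair.Fubini_integrable)
  have [measurable]: "K \<in> borel_measurable borel" using borel_measurable_integrable[OF K] by simp
  show "(\<lambda>(z, x). K z * F z x) \<in> borel_measurable (lborel \<Otimes>\<^sub>M lborel)" by measurable
  show "integrable lborel (\<lambda>z. LINT x|lborel. norm (case (z, x) of (z, x) \<Rightarrow> K z * F z x))"
  proof (rule Bochner_Integration.integrable_bound[where f = "\<lambda>z. K z * B"])
    show "integrable lborel (\<lambda>z. K z * B)" using K by simp
    show "AE z in lborel. norm (LINT x|lborel. norm (case (z, x) of (z, x) \<Rightarrow> K z * F z x)) \<le> norm (K z * B)"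
    proof (rule AE_I2)
      fix z
      have "(LINT x|lborel. norm (K z * F z x)) = \<bar>K z\<bar> * (LINT x|lborel. \<bar>F z x\<bar>)" by (simp add: abs_mult)
      also have "\<dots> \<le> \<bar>K z\<bar> * B" by (intro mult_left_mono assms) auto
      finally show "norm (LINT x|lborel. norm (case (z, x) of (z, x) \<Rightarrow> K z * F z x)) \<le> norm (K z * B)"
        by (simp add: abs_mult abs_le_iff) (meson abs_ge_self abs_ge_zero mult_left_mono order_trans)
    qed
  qed measurable
  show "AE z in lborel. integrable lborel (\<lambda>x. case (z, x) of (z, x) \<Rightarrow> K z * F z x)"
    using assms(3) by simp
qed

lemma ip_abs_le:
  assumes "f \<in> L2" "g \<in> L2" shows "integral\<^sup>L lborel (\<lambda>x. \<bar>f x * g x\<bar>) \<le> L2norm f * L2norm g"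
proof -
  have A: "(\<lambda>x. \<bar>f x\<bar>) \<in> L2" "(\<lambda>x. \<bar>g x\<bar>) \<in> L2"
    by (rule L2_bound[OF assms(1)] L2_bound[OF assms(2)]; use assms in auto)+
  have "L2norm (\<lambda>x. \<bar>f x\<bar>) = L2norm f" "L2norm (\<lambda>x. \<bar>g x\<bar>) = L2norm g" by (simp_all add: L2norm_def)
  then show ?thesis using L2_Cauchy_Schwarz[OF A] by (simp add: ip_def abs_mult)
qed

lemma cv_adjoint:
  assumes K: "test UNIV K" and f: "f \<in> L2" and h: "h \<in> L2" and s: "s \<noteq> 0"
  shows "ip (cv K s f) h = ip f (cv K (- s) h)"
proof -
  have [measurable]: "K \<in> borel_measurable borel" "f \<in> borel_measurable borel" "h \<in> borel_measurable borel"
    using K f h by measurable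
  have I1: "integrable (lborel \<Otimes>\<^sub>M lborel) (\<lambda>(z, x). K z * (f (x - s *\<^sub>R z) * h x))"
  proof (rule pair_integrable[OF test_integrable[OF K]])
    show "integral\<^sup>L lborel (\<lambda>x. \<bar>f (x - s *\<^sub>R z) * h x\<bar>) \<le> L2norm f * L2norm h" for z
      using ip_abs_le[OF L2_translate(1)[OF f, of "s *\<^sub>R z"] h] L2_translate(2)[OF f, of "s *\<^sub>R z"] by simp
    show "integrable lborel (\<lambda>x. f (x - s *\<^sub>R z) * h x)" for z
      by (intro L2_mult_integrable L2_translate f h)
  qed measurable
  have I2: "integrable (lborel \<Otimes>\<^sub>M lborel) (\<lambda>(z, x). K z * (f x * h (x + s *\<^sub>R z)))"
  proof (rule pair_integrable[OF test_integrable[OF K]])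
    show "integral\<^sup>L lborel (\<lambda>x. \<bar>f x * h (x + s *\<^sub>R z)\<bar>) \<le> L2norm f * L2norm h" for z
      using ip_abs_le[OF f L2_translate(1)[OF h, of "- (s *\<^sub>R z)"]] L2_translate(2)[OF h, of "- (s *\<^sub>R z)"] by simp
    show "integrable lborel (\<lambda>x. f x * h (x + s *\<^sub>R z))" for z
      using L2_mult_integrable[OF f L2_translate(1)[OF h, of "- (s *\<^sub>R z)"]] by simp
  qed measurable
  have "ip (cv K s f) h = (LINT x|lborel. LINT z|lborel. K z * (f (x - s *\<^sub>R z) * h x))"
    by (simp add: ip_def cv_def mult.assoc flip: integral_mult_left_zero)
  also have "\<dots> = (LINT z|lborel. LINT x|lborel. K z * (f (x - s *\<^sub>R z) * h x))"
    by (rule lborel_pair.Fubini_integral[OF I1])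
  also have "\<dots> = (LINT z|lborel. LINT x|lborel. K z * (f x * h (x + s *\<^sub>R z)))"
  proof (rule Bochner_Integration.integral_cong[OF refl])
    fix z
    show "(LINT x|lborel. K z * (f (x - s *\<^sub>R z) * h x)) = (LINT x|lborel. K z * (f x * h (x + s *\<^sub>R z)))"
      by (subst integral_affine[where c = 1 and t = "s *\<^sub>R z"]) (simp_all add: add.commute)
  qed
  also have "\<dots> = (LINT x|lborel. LINT z|lborel. K z * (f x * h (x + s *\<^sub>R z)))"
    by (rule lborel_pair.Fubini_integral[OF I2, symmetric])
  also have "\<dots> = ip f (cv K (- s) h)"
    by (simp add: ip_def cv_def mult.left_commute[of "K _" "f _"])
  finally show ?thesis .
qed

lemma cv_commute:
  assumes K: "test UNIV K" and L: "test UNIV L" and f: "f \<in> L2" and s: "s \<noteq> 0" "t \<noteq> 0"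
  shows "cv K s (cv L t f) = cv L t (cv K s f)"
proof
  fix x
  have [measurable]: "K \<in> borel_measurable borel" "L \<in> borel_measurable borel" "f \<in> borel_measurable borel"
    using K f L by measurable
  have I: "integrable (lborel \<Otimes>\<^sub>M lborel) (\<lambda>(z, z'). K z * (L z' * f (x - s *\<^sub>R z - t *\<^sub>R z')))"
  proof (rule pair_integrable[OF test_integrable[OF K]])
    show "integral\<^sup>L lborel (\<lambda>z'. \<bar>L z' * f (x - s *\<^sub>R z - t *\<^sub>R z')\<bar>) \<le> L2norm L * sqrt ((L2norm f)\<^sup>2 / \<bar>t\<bar> ^ 3)" for z
    proof -
      have "(L2norm (\<lambda>z'. f (x - s *\<^sub>R z - t *\<^sub>R z')))\<^sup>2 = (L2norm f)\<^sup>2 / \<bar>t\<bar> ^ 3"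
        using L2_reflect(2)[OF f s(2), of "x - s *\<^sub>R z"] s(2) by (simp add: field_simps)
      then have "L2norm (\<lambda>z'. f (x - s *\<^sub>R z - t *\<^sub>R z')) = sqrt ((L2norm f)\<^sup>2 / \<bar>t\<bar> ^ 3)"
        by (metis L2norm_nonneg real_sqrt_unique)
      then show ?thesis
        using ip_abs_le[OF test_L2[OF L] L2_reflect(1)[OF f s(2), of "x - s *\<^sub>R z"]] by simp
    qed
    show "integrable lborel (\<lambda>z'. L z' * f (x - s *\<^sub>R z - t *\<^sub>R z'))" for z
      by (rule cv_integrable[OF L f s(2)])
  qed measurable
  have "cv K s (cv L t f) x = (LINT z|lborel. LINT z'|lborel. K z * (L z' * f (x - s *\<^sub>R z - t *\<^sub>R z')))"
    by (simp add: cv_def)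
  also have "\<dots> = (LINT z'|lborel. LINT z|lborel. K z * (L z' * f (x - s *\<^sub>R z - t *\<^sub>R z')))"
    by (rule lborel_pair.Fubini_integral[OF I, symmetric])
  also have "\<dots> = cv L t (cv K s f) x"
    by (simp add: cv_def mult.left_commute[of "K _" "L _"] diff_diff_eq add.commute)
  finally show "cv K s (cv L t f) x = cv L t (cv K s f) x" .
qed

lemma cv_add: "test UNIV K \<Longrightarrow> f \<in> L2 \<Longrightarrow> g \<in> L2 \<Longrightarrow> s \<noteq> 0 \<Longrightarrow>
    cv K s (\<lambda>x. f x + g x) = (\<lambda>x. cv K s f x + cv K s g x)"
  by (rule ext) (simp add: cv_def distrib_left cv_integrable)

lemma cv_cmult: "cv K s (\<lambda>x. c * f x) = (\<lambda>x. c * cv K s f x)"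
  by (rule ext) (simp add: cv_def mult.left_commute)

lemma cv_diff: "test UNIV K \<Longrightarrow> f \<in> L2 \<Longrightarrow> g \<in> L2 \<Longrightarrow> s \<noteq> 0 \<Longrightarrow>
    cv K s (\<lambda>x. f x - g x) = (\<lambda>x. cv K s f x - cv K s g x)"
  by (rule ext) (simp add: cv_def right_diff_distrib cv_integrable)

lemma cv_zero [simp]: "cv K s (\<lambda>x. 0) = (\<lambda>x. 0)"
  by (rule ext) (simp add: cv_def)

lemma cv_sum: "test UNIV K \<Longrightarrow> (\<And>i. i \<in> I \<Longrightarrow> f i \<in> L2) \<Longrightarrow> s \<noteq> 0 \<Longrightarrow>
    cv K s (\<lambda>x. \<Sum>i\<in>I. f i x) = (\<lambda>x. \<Sum>i\<in>I. cv K s (f i) x)"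
  by (induction I rule: infinite_finite_induct) (auto simp: cv_add L2_sum)

lemma cv_kernel_add: "test UNIV K \<Longrightarrow> test UNIV L \<Longrightarrow> f \<in> L2 \<Longrightarrow> s \<noteq> 0 \<Longrightarrow>
    cv (\<lambda>z. K z + L z) s f = (\<lambda>x. cv K s f x + cv L s f x)"
  by (rule ext) (simp add: cv_def distrib_right cv_integrable)

lemma cv_kernel_diff: "test UNIV K \<Longrightarrow> test UNIV L \<Longrightarrow> f \<in> L2 \<Longrightarrow> s \<noteq> 0 \<Longrightarrow>
    cv (\<lambda>z. K z - L z) s f = (\<lambda>x. cv K s f x - cv L s f x)"
  by (rule ext) (simp add: cv_def left_diff_distrib cv_integrable)

lemma cv_kernel_zero [simp]: "cv (\<lambda>x. 0) s f = (\<lambda>x. 0)"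
  by (rule ext) (simp add: cv_def)

lemma cv_kernel_sum: "(\<And>i. i \<in> I \<Longrightarrow> test UNIV (K i)) \<Longrightarrow> f \<in> L2 \<Longrightarrow> s \<noteq> 0 \<Longrightarrow>
    cv (\<lambda>x. \<Sum>i\<in>I. K i x) s f = (\<lambda>x. \<Sum>i\<in>I. cv (K i) s f x)"
  by (induction I rule: infinite_finite_induct) (auto simp: cv_kernel_add test_sum)

text \<open>Rewrites an average at the next finer scale with a contracted kernel at the present
  scale, so that sums and differences of neighbouring averages become single convolutions. The 8 is
  the Jacobian 2^3.\<close>

lemma cv_halve:
  assumes [measurable]: "K \<in> borel_measurable borel" "f \<in> borel_measurable borel"
  shows "cv K (s / 2) f = cv (\<lambda>z. 8 * K (2 *\<^sub>R z)) s f"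
  by (rule ext, unfold cv_def, subst integral_affine[where c = 2 and t = 0]) (simp_all add: mult.assoc)

lemma cv_support:
  assumes "cv K s f x \<noteq> 0" shows "\<exists>z. K z \<noteq> 0 \<and> f (x - s *\<^sub>R z) \<noteq> 0"
proof (rule ccontr)
  assume "\<not> ?thesis"
  then have "(\<lambda>z. K z * f (x - s *\<^sub>R z)) = (\<lambda>z. 0)" by auto
  with assms show False by (simp add: cv_def)
qed

subsection \<open>Differentiation\<close>

lemma Cc_uniformly_continuous:
  assumes "Cc c" "e > 0"
  obtains d where "d > 0" "\<And>x y. dist x y < d \<Longrightarrow> \<bar>c x - c y\<bar> < e"
proof -
  obtain R where R: "\<And>x. norm x > R \<Longrightarrow> c x = 0" and c: "continuous_on UNIV c"
    using assms by (auto simp: Cc_def)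
  have "uniformly_continuous_on (cball 0 (R + 1)) c"
    by (intro compact_uniformly_continuous continuous_on_subset[OF c]) auto
  then obtain d where d: "d > 0" "\<And>x y. x \<in> cball 0 (R + 1) \<Longrightarrow> y \<in> cball 0 (R + 1) \<Longrightarrow> dist x y < d \<Longrightarrow> dist (c x) (c y) < e"
    using assms(2) unfolding uniformly_continuous_on_def by blast
  have "\<bar>c x - c y\<bar> < e" if xy: "dist x y < min d 1" for x y
  proof (cases "x \<in> cball 0 (R + 1) \<and> y \<in> cball 0 (R + 1)")
    case True
    then show ?thesis using d(2)[of x y] xy by (auto simp: dist_real_def)
  next
    case False
    then have "norm x > R" "norm y > R"
      using xy norm_triangle_ineq2[of x y] norm_triangle_ineq2[of y x]
      by (auto simp: dist_norm norm_minus_commute not_le)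
    then show ?thesis using R assms(2) by simp
  qed
  then show thesis using that[of "min d 1"] d(1) by simp
qed

lemma test_Cc: assumes "test U f" shows "Cc f"
proof -
  obtain K where K: "compact K" "\<And>x. x \<notin> K \<Longrightarrow> f x = 0" using assms by (meson test_support)
  obtain R where "\<And>x. x \<in> K \<Longrightarrow> norm x \<le> R" using compact_imp_bounded[OF K(1)] by (auto simp: bounded_iff)
  then have "\<forall>x. norm x > R \<longrightarrow> f x = 0" using K(2) by force
  then show ?thesis using smooth_continuous[OF test_smooth[OF assms]] by (auto simp: Cc_def)
qed

text \<open>A first order Taylor bound uniform in the base point, which is what differentiation
  under an integral asks for. Each of the three partial derivatives contributes
  \<open>e / 3\<close>.\<close>

lemma test_uniformly_differentiable:
  assumes K: "test UNIV K" and e: "e > 0"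
  obtains d where "d > 0"
    "\<And>x h. norm h < d \<Longrightarrow> \<bar>K (x + h) - K x - (\<Sum>j\<in>UNIV. h $ j * pd j K x)\<bar> \<le> e * norm h"
proof -
  have "\<exists>d>0. \<forall>x y. dist x y < d \<longrightarrow> \<bar>pd j K x - pd j K y\<bar> < e / 3" for j
    using Cc_uniformly_continuous[OF test_Cc[OF test_pd[OF K]], of "e / 3" j] e
    by (metis divide_pos_pos zero_less_numeral)
  then obtain D where D: "\<And>j. D j > 0" "\<And>j x y. dist x y < D j \<Longrightarrow> \<bar>pd j K x - pd j K y\<bar> < e / 3" by metis
  define d where "d = Min (range D)"
  have d: "d > 0" "\<And>j. d \<le> D j" unfolding d_def using D(1) by auto
  have "\<bar>K (x + h) - K x - (\<Sum>j\<in>UNIV. h $ j * pd j K x)\<bar> \<le> e * norm h" if h: "norm h < d" for x h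
  proof -
    have "norm (K (x + h) - K x - (\<lambda>y. \<lambda>h. \<Sum>j\<in>UNIV. h $ j * pd j K y) x ((x + h) - x)) \<le> norm ((x + h) - x) * e"
    proof (rule differentiable_bound_linearization[where S = "ball x d"])
      show "x + t *\<^sub>R (x + h - x) \<in> ball x d" if "t \<in> {0..1}" for t
      proof -
        have "\<bar>t\<bar> * norm h \<le> 1 * norm h" using that by (intro mult_right_mono) auto
        then show ?thesis using h by (simp add: dist_norm)
      qed
      show "(K has_derivative (\<lambda>h. \<Sum>j\<in>UNIV. h $ j * pd j K y)) (at y within ball x d)" for y
        by (rule has_derivative_at_withinI[OF smooth_has_derivative[OF test_smooth[OF K]]])
      show "onorm ((\<lambda>i. \<Sum>j\<in>UNIV. i $ j * pd j K u) - (\<lambda>i. \<Sum>j\<in>UNIV. i $ j * pd j K x)) \<le> e" if "u \<in> ball x d" for u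
      proof (rule onorm_le)
        fix i :: "real^3"
        have "norm (((\<lambda>i. \<Sum>j\<in>UNIV. i $ j * pd j K u) - (\<lambda>i. \<Sum>j\<in>UNIV. i $ j * pd j K x)) i) = norm ((\<Sum>j\<in>UNIV. i $ j * pd j K u) - (\<Sum>j\<in>UNIV. i $ j * pd j K x))"
          by (simp add: fun_diff_def)
        also have "\<dots>
          = \<bar>\<Sum>j\<in>UNIV. i $ j * (pd j K u - pd j K x)\<bar>"
          by (simp add: sum_subtractf right_diff_distrib)
        also have "\<dots> \<le> (\<Sum>j\<in>UNIV. \<bar>i $ j * (pd j K u - pd j K x)\<bar>)" by (rule sum_abs)
        also have "\<dots> \<le> (\<Sum>j\<in>(UNIV::3 set). norm i * (e / 3))"
        proof (rule sum_mono)
          fix j :: 3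
          have "dist u x < D j" using that d(2)[of j] by (simp add: dist_commute)
          then show "\<bar>i $ j * (pd j K u - pd j K x)\<bar> \<le> norm i * (e / 3)"
            unfolding abs_mult using D(2)[of u x j] component_le_norm_cart[of i j]
            by (intro mult_mono) auto
        qed
        also have "\<dots> = e * norm i" by simp
        finally show "norm (((\<lambda>i. \<Sum>j\<in>UNIV. i $ j * pd j K u) - (\<lambda>i. \<Sum>j\<in>UNIV. i $ j * pd j K x)) i) \<le> e * norm i" .
      qed
      show "x \<in> ball x d" using d by simp
    qed
    then show ?thesis by (simp add: mult.commute)
  qed
  then show thesis using that d(1) by blast
qed

text \<open>The Taylor remainder of \<open>K\<close> is uniformly small and lives in one fixed ball
  for all small increments, so Cauchy-Schwarz against \<open>w\<close> suffices; neither smoothness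
  nor boundedness of \<open>w\<close> enters.\<close>

lemma translate_integral_has_derivative:
  assumes K: "test UNIV K" and w: "w \<in> L2"
  shows "((\<lambda>a. integral\<^sup>L lborel (\<lambda>z. K (a + z) * w z)) has_derivative
          (\<lambda>h. \<Sum>j\<in>UNIV. h $ j * integral\<^sup>L lborel (\<lambda>z. pd j K (a + z) * w z))) (at a)"
    (is "(?G has_derivative ?D) (at a)")
proof -
  have tr: "(\<lambda>z. F (b + z)) \<in> L2" if "test UNIV F" for F b
    using L2_affine(1)[OF test_L2[OF that], of 1 b] by simp
  have int: "integrable lborel (\<lambda>z. F (b + z) * w z)" if "test UNIV F" for F b
    by (rule L2_mult_integrable[OF tr[OF that] w])
  obtain R where R: "\<And>x. norm x > R \<Longrightarrow> K x = 0" using test_Cc[OF K] by (auto simp: Cc_def)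
  have K0: "K x = 0" "pd j K x = 0" if "x \<notin> cball 0 R" for x j
  proof -
    have 0: "\<And>x. x \<notin> cball 0 R \<Longrightarrow> K x = 0" using R by simp
    show "K x = 0" "pd j K x = 0" using pd_zero_outside[OF closed_cball 0 that] 0 that by auto
  qed
  \<comment> \<open>For increments below 1 the ball of radius \<open>R + 1\<close> about
    \<open>- a\<close> contains the supports of both translates of \<open>K\<close>.\<close>
  define J :: sfield where "J = indicator (cball (- a) (R + 1))"
  have JL: "J \<in> L2" by (simp add: J_def indicator_cball_L2)
  \<comment> \<open>The added 1 keeps the divisor positive when the product of norms
    vanishes.\<close>
  define C where "C = L2norm J * L2norm w + 1"
  have C: "C > 0" by (simp add: C_def add_nonneg_pos)
  have "bounded_linear ?D"
    by (rule bounded_linear_sum, rule bounded_linear_mult_const, rule bounded_linear_vec_nth)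
  moreover have "\<exists>d>0. \<forall>y. norm (y - a) < d \<longrightarrow> norm (?G y - ?G a - ?D (y - a)) \<le> e * norm (y - a)" if e: "e > 0" for e
  proof -
    have eC: "e / C > 0" using e C by simp
    obtain d where d: "d > 0" "\<And>x h. norm h < d \<Longrightarrow> \<bar>K (x + h) - K x - (\<Sum>j\<in>UNIV. h $ j * pd j K x)\<bar> \<le> e / C * norm h"
      using test_uniformly_differentiable[OF K eC] by blast
    have "norm (?G y - ?G a - ?D (y - a)) \<le> e * norm (y - a)" if y: "norm (y - a) < min d 1" for y
    proof -
      define h where "h = y - a"
      define r where "r z = K (y + z) - K (a + z) - (\<Sum>j\<in>UNIV. h $ j * pd j K (a + z))" for z
      have tj: "test UNIV (pd j K)" for j by (rule test_pd[OF K])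
      have rL: "r \<in> L2" unfolding r_def
        by (intro L2_diff L2_sum L2_cmult tr K tj)
      have "?G y - ?G a - ?D (y - a) = integral\<^sup>L lborel (\<lambda>z. r z * w z)"
        by (simp add: r_def h_def left_diff_distrib sum_distrib_right mult.assoc int K tj
            Bochner_Integration.integral_sum integrable_sum)
      also have "\<bar>\<dots>\<bar> \<le> L2norm r * L2norm w" using L2_Cauchy_Schwarz[OF rL w] by (simp add: ip_def)
      also have "\<dots> \<le> (e / C * norm h * L2norm J) * L2norm w"
      proof (rule mult_right_mono)
        have "\<bar>r z\<bar> \<le> \<bar>(e / C * norm h) * J z\<bar>" for z
        proof (cases "z \<in> cball (- a) (R + 1)")
          case True
          then show ?thesis
            using d(2)[of h "a + z"] y e C by (simp add: r_def h_def J_def algebra_simps)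
        next
          case False
          then have n: "norm (a + z) > R + 1" by (simp add: dist_norm norm_minus_commute algebra_simps)
          moreover have "norm (a + z) \<le> norm (y + z) + norm (y - a)"
            using norm_triangle_ineq4[of "y + z" "y - a"] by (simp add: algebra_simps)
          ultimately have "norm (y + z) > R" "norm (a + z) > R" using y by auto
          then show ?thesis using K0 by (simp add: r_def J_def)
        qed
        then have "L2norm r \<le> L2norm (\<lambda>z. (e / C * norm h) * J z)"
          by (intro L2norm_mono L2_cmult JL) (use rL in auto)
        then show "L2norm r \<le> e / C * norm h * L2norm J" using e C by (simp only: L2norm_cmult) simp
      qed simp
      also have "\<dots> = (e * norm h) * ((L2norm J * L2norm w) / C)" by simp
      also have "\<dots> \<le> (e * norm h) * 1"
        using e C by (intro mult_left_mono) (auto simp: C_def)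
      finally show ?thesis by (simp add: h_def)
    qed
    then show ?thesis using d(1) by (intro exI[of _ "min d 1"]) auto
  qed
  ultimately show ?thesis by (auto simp: has_derivative_at_alt)
qed

text \<open>Translating the integration variable moves the dependence on \<open>x\<close> into the
  kernel, where it can be differentiated although \<open>f\<close> is merely in
  \<open>L2\<close>.\<close>

lemma cv_shift:
  assumes [measurable]: "K \<in> borel_measurable borel" "f \<in> borel_measurable borel" and s: "s \<noteq> 0"
  shows "cv K s f x = integral\<^sup>L lborel (\<lambda>z. K ((1 / s) *\<^sub>R x + z) * f (0 - s *\<^sub>R z))"
  unfolding cv_def
  by (subst integral_affine[where c = 1 and t = "(1 / s) *\<^sub>R x"]) (use s in \<open>simp_all add: scaleR_add_right\<close>)

lemma cv_has_derivative:
  assumes K: "test UNIV K" and f: "f \<in> L2" and s: "s \<noteq> 0"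
  shows "(cv K s f has_derivative (\<lambda>h. \<Sum>j\<in>UNIV. h $ j * ((1 / s) * cv (pd j K) s f x))) (at x)"
proof -
  have m: "K \<in> borel_measurable borel" "pd j K \<in> borel_measurable borel" "f \<in> borel_measurable borel" for j
    using K f test_pd[OF K, of j] by measurable
  have "((\<lambda>x. (1 / s) *\<^sub>R x) has_derivative (\<lambda>h. (1 / s) *\<^sub>R h)) (at x)"
    by (auto intro!: derivative_eq_intros)
  from has_derivative_compose[OF this translate_integral_has_derivative[OF K L2_reflect(1)[OF f s]], of 0]
  show ?thesis
    unfolding cv_shift[OF m(1,3) s] cv_shift[OF m(2,3) s, of _ x] cv_shift[OF m(1,3) s, abs_def]
    by (simp add: ac_simps)
qed

lemma pd_cv:
  "test UNIV K \<Longrightarrow> f \<in> L2 \<Longrightarrow> s \<noteq> 0 \<Longrightarrow> pd j (cv K s f) = (\<lambda>x. (1 / s) * cv (pd j K) s f x)"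
  by (rule ext, subst pd_eqI[OF cv_has_derivative]) (simp_all only: axis_sum not_False_eq_True)

lemma smooth_cv:
  assumes K: "test UNIV K" and f: "f \<in> L2" and s: "s \<noteq> 0"
  shows "smooth (cv K s f)"
proof (rule smooth_coinduct[where X = "\<lambda>g. \<exists>K c. test UNIV K \<and> g = (\<lambda>x. c * cv K s f x)"])
  show "\<exists>K' c. test UNIV K' \<and> cv K s f = (\<lambda>x. c * cv K' s f x)"
    by (intro exI[of _ K] exI[of _ 1]) (simp add: K)
next
  fix g assume "\<exists>K c. test UNIV K \<and> g = (\<lambda>x. c * cv K s f x)"
  then obtain K c where K: "test UNIV K" and g: "g = (\<lambda>x. c * cv K s f x)" by blast
  have D: "cv K s f differentiable (at x)" for x
    using cv_has_derivative[OF K f s] by (auto simp: differentiable_def)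
  have "pd j g = (\<lambda>x. (c * (1 / s)) * cv (pd j K) s f x)" for j
    unfolding g by (rule ext) (simp add: pd_cmult[OF D] pd_cv[OF K f s])
  moreover have "g differentiable (at x)" for x unfolding g using D by (auto intro!: derivative_intros)
  ultimately show "(\<forall>x. g differentiable (at x)) \<and> (\<forall>j. \<exists>K c. test UNIV K \<and> pd j g = (\<lambda>x. c * cv K s f x))"
    using test_pd[OF K] by blast
qed

text \<open>The integral of \<open>f\<close> translated by \<open>a\<close> against the indicator of
  a large ball is constant for small \<open>a\<close>. Its derivative at 0 is the integral of
  \<open>pd j f\<close> over that ball, and \<open>pd j f\<close> vanishes outside.\<close>

lemma integral_pd_zero:
  assumes f: "test U f" shows "integral\<^sup>L lborel (pd j f) = 0"
proof -
  have f': "test UNIV f" using test_mono[OF f] by simp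
  obtain R where R: "\<And>x. norm x > R \<Longrightarrow> f x = 0" using test_Cc[OF f] by (auto simp: Cc_def)
  define w :: sfield where "w = indicator (cball 0 (R + 1))"
  have wL: "w \<in> L2" by (simp add: w_def indicator_cball_L2)
  have fm: "f \<in> borel_measurable borel" using f by measurable
  have c: "integral\<^sup>L lborel (\<lambda>z. f (a + z) * w z) = integral\<^sup>L lborel f" if a: "a \<in> ball 0 1" for a
  proof -
    have "f (a + z) * w z = f (a + 1 *\<^sub>R z)" for z
    proof (cases "z \<in> cball 0 (R + 1)")
      case False
      then have "norm (a + z) > R" using a norm_diff_ineq[of z a] by (simp add: add.commute)
      then show ?thesis using R by simp
    qed (simp add: w_def)
    then have "(\<lambda>z. f (a + z) * w z) = (\<lambda>z. f (a + 1 *\<^sub>R z))" by blast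
    then show ?thesis using integral_affine[OF fm, of 1 a] by (simp only:) simp
  qed
  have "((\<lambda>a. integral\<^sup>L lborel (\<lambda>z. f (a + z) * w z)) has_derivative (\<lambda>h. 0)) (at 0)"
    by (rule has_derivative_transform_within_open[OF has_derivative_const open_ball[of 0 1]]) (use c in auto)
  from has_derivative_unique[OF this translate_integral_has_derivative[OF f' wL]]
  have "(\<Sum>k\<in>UNIV. (axis j 1 :: real^3) $ k * integral\<^sup>L lborel (\<lambda>z. pd k f (0 + z) * w z)) = 0"
    by metis
  then have "integral\<^sup>L lborel (\<lambda>z. pd j f z * w z) = 0" by simp
  moreover have "pd j f z * w z = pd j f z" for z
    using pd_zero_outside[of "cball 0 R" f z j] R by (cases "z \<in> cball 0 R") (auto simp: w_def)
  ultimately show ?thesis by simp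
qed

lemma integration_by_parts:
  assumes u: "test U u" and v: "smooth v"
  shows "integral\<^sup>L lborel (\<lambda>x. u x * pd j v x) = - integral\<^sup>L lborel (\<lambda>x. pd j u x * v x)"
proof -
  have "integral\<^sup>L lborel (pd j (\<lambda>x. u x * v x)) = 0"
    by (rule integral_pd_zero[OF test_mult_smooth(1)[OF u v]])
  moreover have "integral\<^sup>L lborel (pd j (\<lambda>x. u x * v x))
      = integral\<^sup>L lborel (\<lambda>x. pd j u x * v x) + integral\<^sup>L lborel (\<lambda>x. u x * pd j v x)"
    unfolding pd_mult_smooth[OF test_smooth[OF u] v]
    by (intro Bochner_Integration.integral_add test_integrable[of U] test_mult_smooth test_pd u v smooth_pd)
  ultimately show ?thesis by simp
qed

text \<open>Moving a derivative from the kernel to the argument gains one factor \<open>s\<close>: a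
  kernel that is a derivative suppresses whatever varies slowly at its own scale.\<close>

lemma cv_pd_kernel:
  assumes K: "test UNIV K" and u: "smooth u"
  shows "cv (pd j K) s u = (\<lambda>x. s * cv K s (pd j u) x)"
proof
  fix x
  have "integral\<^sup>L lborel (\<lambda>z. K z * pd j (\<lambda>z. u (x + (- s) *\<^sub>R z)) z) = - integral\<^sup>L lborel (\<lambda>z. pd j K z * u (x + (- s) *\<^sub>R z))"
    by (rule integration_by_parts[OF K smooth_affine[OF u]])
  then show "cv (pd j K) s u x = s * cv K s (pd j u) x"
    unfolding pd_affine[OF u] by (simp add: cv_def mult.left_commute)
qed

lemma pd_cv_smooth:
  assumes "test UNIV K" "u \<in> L2" "smooth u" "s \<noteq> 0"
  shows "pd j (cv K s u) = cv K s (pd j u)"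
  using assms by (simp add: pd_cv cv_pd_kernel)

subsection \<open>Approximate identities\<close>

text \<open>Uniform continuity bounds the error pointwise, and for small scales the error is
  supported in a fixed ball, whose indicator \<open>J\<close> converts the pointwise bound into an
  L2 bound.\<close>

lemma cv_Cc_tendsto:
  assumes K: "test UNIV K" "integral\<^sup>L lborel K = 1" and c: "Cc c" and e: "e > 0"
  obtains d where "d > 0" "\<And>s. 0 < s \<Longrightarrow> s < d \<Longrightarrow> L2norm (\<lambda>x. cv K s c x - c x) \<le> e"
proof -
  have cL: "c \<in> L2" by (rule Cc_L2[OF c])
  obtain R where R: "\<And>x. norm x > R \<Longrightarrow> c x = 0" using c by (auto simp: Cc_def)
  obtain S where S: "\<And>x. norm x > S \<Longrightarrow> K x = 0" using test_Cc[OF K(1)] by (auto simp: Cc_def)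
  define J :: sfield where "J = indicator (cball 0 (R + 1))"
  have JL: "J \<in> L2" by (simp add: J_def indicator_cball_L2)
  define C where "C = L1norm K * L2norm J + 1"
  have C: "C > 0" by (simp add: C_def add_nonneg_pos)
  have eC: "e / C > 0" using e C by simp
  obtain d where d: "d > 0" "\<And>x y. dist x y < d \<Longrightarrow> \<bar>c x - c y\<bar> < e / C"
    using Cc_uniformly_continuous[OF c eC] by blast
  define S' where "S' = \<bar>S\<bar> + 1"
  have S': "S' > 0" "\<And>x. norm x \<ge> S' \<Longrightarrow> K x = 0" using S by (auto simp: S'_def)
  have Kint: "integrable lborel (\<lambda>z. \<bar>K z\<bar>)" using test_integrable[OF K(1)] by simp
  have "L2norm (\<lambda>x. cv K s c x - c x) \<le> e" if s: "0 < s" "s < min d 1 / S'" for s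
  proof -
    have sS: "s * S' < min d 1" using s S'(1) by (simp add: pos_less_divide_eq)
    have small: "norm (s *\<^sub>R z) < min d 1" if "norm z < S'" for z
    proof -
      have "s * norm z \<le> s * S'" using that s by (intro mult_left_mono) auto
      then have "s * norm z < min d 1" using sS by linarith
      then show ?thesis using s by simp
    qed
    have pt: "\<bar>cv K s c x - c x\<bar> \<le> \<bar>(L1norm K * (e / C)) * J x\<bar>" for x
    proof (cases "x \<in> cball 0 (R + 1)")
      case False
      have "cv K s c x = 0"
      proof (rule ccontr)
        assume "cv K s c x \<noteq> 0"
        then obtain z where z: "K z \<noteq> 0" "c (x - s *\<^sub>R z) \<noteq> 0" using cv_support[of K s c x] by auto
        then have "norm z < S'" using S'(2)[of z] by linarith
        then have "norm (s *\<^sub>R z) < 1" using small[of z] by simp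
        moreover have "norm (x - s *\<^sub>R z) \<le> R" using z(2) R[of "x - s *\<^sub>R z"] by linarith
        moreover have "norm x \<le> norm (x - s *\<^sub>R z) + norm (s *\<^sub>R z)" using norm_triangle_ineq[of "x - s *\<^sub>R z" "s *\<^sub>R z"] by simp
        ultimately show False using False by simp
      qed
      moreover have "c x = 0" using False R by (simp add: not_le)
      ultimately show ?thesis by simp
    next
      case True
      have i1: "integrable lborel (\<lambda>z. K z * c (x - s *\<^sub>R z))" using cv_integrable[OF K(1) cL] s by simp
      have i2: "integrable lborel (\<lambda>z. K z * c x)" using test_integrable[OF K(1)] by simp
      have "cv K s c x - c x = integral\<^sup>L lborel (\<lambda>z. K z * c (x - s *\<^sub>R z) - K z * c x)"
        using i1 i2 K(2) by (simp add: cv_def)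
      also have "\<bar>\<dots>\<bar> \<le> integral\<^sup>L lborel (\<lambda>z. \<bar>K z * c (x - s *\<^sub>R z) - K z * c x\<bar>)"
        using integral_norm_bound[of lborel "\<lambda>z. K z * c (x - s *\<^sub>R z) - K z * c x"] by simp
      also have "\<dots> \<le> integral\<^sup>L lborel (\<lambda>z. \<bar>K z\<bar> * (e / C))"
      proof (rule integral_mono)
        show "\<bar>K z * c (x - s *\<^sub>R z) - K z * c x\<bar> \<le> \<bar>K z\<bar> * (e / C)" for z
        proof (cases "norm z < S'")
          case True
          then have "\<bar>c (x - s *\<^sub>R z) - c x\<bar> < e / C" using d(2)[of "x - s *\<^sub>R z" x] small[OF True] by (simp add: dist_norm)
          then show ?thesis
            unfolding right_diff_distrib[symmetric] abs_mult by (intro mult_left_mono) auto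
        next
          case False
          then show ?thesis using S'(2)[of z] by simp
        qed
      qed (use i1 i2 Kint in auto)
      also have "\<dots> = L1norm K * (e / C)" by (simp add: L1norm_def)
      finally have "\<bar>cv K s c x - c x\<bar> \<le> \<bar>L1norm K * (e / C)\<bar>" by linarith
      then show ?thesis using True by (simp add: J_def)
    qed
    have "L2norm (\<lambda>x. cv K s c x - c x) \<le> L2norm (\<lambda>x. (L1norm K * (e / C)) * J x)"
    proof (rule L2norm_mono[OF L2_cmult[OF JL] _ pt])
      show "(\<lambda>x. cv K s c x - c x) \<in> borel_measurable borel"
        by (intro borel_measurable_diff cv_measurable test_measurable[OF K(1)] L2_measurable[OF cL])
    qed
    also have "\<dots> = \<bar>L1norm K * (e / C)\<bar> * L2norm J" by (rule L2norm_cmult)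
    also have "\<dots> = L1norm K * (e / C) * L2norm J" using e C by simp
    also have "\<dots> = e * ((L1norm K * L2norm J) / C)" by simp
    also have "\<dots> \<le> e * 1" using e C by (intro mult_left_mono) (auto simp: C_def)
    finally show ?thesis by simp
  qed
  then show thesis using that[of "min d 1 / S'"] d(1) S'(1) by simp
qed

lemma cv_tendsto:
  assumes K: "test UNIV K" "integral\<^sup>L lborel K = 1" and f: "f \<in> L2"
  shows "(\<lambda>n. L2norm (\<lambda>x. cv K ((1/2) ^ n) f x - f x)) \<longlonglongrightarrow> 0"
proof (rule LIMSEQ_I)
  fix e :: real assume e: "e > 0"
  define C where "C = L1norm K + 1"
  have C: "C > 0" by (simp add: C_def add_nonneg_pos)
  have "e / (3 * C) > 0" using e C by simp
  then obtain c where c: "Cc c" "c \<in> L2" "L2norm (\<lambda>x. f x - c x) < e / (3 * C)"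
    using L2_Cc_approx[OF f] unfolding Cc_approx_def by blast
  obtain d where d: "d > 0" "\<And>s. 0 < s \<Longrightarrow> s < d \<Longrightarrow> L2norm (\<lambda>x. cv K s c x - c x) \<le> e / 3"
    using cv_Cc_tendsto[OF K c(1), of "e / 3"] e by (metis divide_pos_pos zero_less_numeral)
  obtain N where N: "(1/2) ^ N < d" using real_arch_pow_inv[OF d(1), of "1/2"] by auto
  have "L2norm (\<lambda>x. cv K ((1/2) ^ n) f x - f x) < e" if n: "n \<ge> N" for n
  proof -
    define s :: real where "s = (1/2) ^ n"
    have "s \<le> (1/2) ^ N" unfolding s_def using n by (rule power_decreasing) auto
    then have "s < d" using N by linarith
    moreover have "0 < s" by (simp add: s_def)
    ultimately have s: "0 < s" "s < d" by auto
    have fc: "(\<lambda>x. f x - c x) \<in> L2" using f c(2) by auto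
    have cL: "cv K s f \<in> L2" "cv K s c \<in> L2" using cv_Young K f c(2) s by auto
    have "L2norm (\<lambda>x. cv K s f x - f x) \<le> L2norm (\<lambda>x. cv K s f x - cv K s c x) + L2norm (\<lambda>x. cv K s c x - f x)"
      by (rule L2norm_triangle3[OF cL f])
    also have "\<dots> \<le> L2norm (\<lambda>x. cv K s f x - cv K s c x) + (L2norm (\<lambda>x. cv K s c x - c x) + L2norm (\<lambda>x. f x - c x))"
      using L2norm_triangle3[OF cL(2) c(2) f] by (simp add: L2norm_minus[of f])
    also have "L2norm (\<lambda>x. cv K s f x - cv K s c x) \<le> L1norm K * L2norm (\<lambda>x. f x - c x)"
      using cv_Young(2)[OF K(1) fc, of s] s cv_diff[OF K(1) f c(2), of s] by simp
    also have "L1norm K * L2norm (\<lambda>x. f x - c x) + (L2norm (\<lambda>x. cv K s c x - c x) + L2norm (\<lambda>x. f x - c x))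
       = C * L2norm (\<lambda>x. f x - c x) + L2norm (\<lambda>x. cv K s c x - c x)" by (simp add: C_def algebra_simps)
    also have "\<dots> \<le> e / 3 + e / 3"
      using d(2)[OF s] c(3) C by (intro add_mono) (auto simp: field_simps)
    also have "\<dots> < e" using e by simp
    finally show ?thesis by (simp add: s_def)
  qed
  then show "\<exists>no. \<forall>n\<ge>no. norm (L2norm (\<lambda>x. cv K ((1/2) ^ n) f x - f x) - 0) < e" by auto
qed


section \<open>Cotlar-Stein type estimates and square functions for dyadic families of
  convolutions\<close>

section \<open>Almost orthogonality\<close>

text \<open>Taking the derivative off \<open>K\<close> gains \<open>s\<close>, putting it on
  \<open>L\<close> costs \<open>1 / t\<close>. The estimate is useful when the differentiated kernel
  sits at the finer scale.\<close>

lemma cv_almost_orthogonal: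
  assumes "test UNIV K" "test UNIV L" "h \<in> L2" "s \<noteq> 0" "t \<noteq> 0"
  shows "L2norm (cv (pd a K) s (cv L t h)) \<le> \<bar>s / t\<bar> * (L1norm K * L1norm (pd a L)) * L2norm h"
proof -
  have L': "test UNIV (pd a L)" using assms by (intro test_pd)
  have "cv (pd a K) s (cv L t h) = (\<lambda>x. (s / t) * cv K s (cv (pd a L) t h) x)"
    unfolding cv_pd_kernel[OF assms(1) smooth_cv[OF assms(2,3,5)]] pd_cv[OF assms(2,3,5)] cv_cmult by simp
  then have "L2norm (cv (pd a K) s (cv L t h)) = \<bar>s / t\<bar> * L2norm (cv K s (cv (pd a L) t h))"
    by (simp only: L2norm_cmult)
  also have "\<dots> \<le> \<bar>s / t\<bar> * (L1norm K * (L1norm (pd a L) * L2norm h))"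
    by (intro mult_left_mono order_trans[OF cv_Young(2)] cv_Young L' assms) auto
  finally show ?thesis by (simp add: mult.assoc)
qed

lemma sum_half_powers_le:
  assumes "finite B" shows "(\<Sum>m\<in>B. (1/2 :: real) ^ m) \<le> 2"
  using sum_le_suminf[OF summable_geometric[of "1/2 :: real"] assms] suminf_geometric[of "1/2 :: real"]
  by simp

text \<open>In truncated subtraction one of the two differences is 0, so the exponent is the
  distance of \<open>j\<close> and \<open>k\<close>. Each side of \<open>j\<close> contributes a
  partial geometric sum of at most 2.\<close>

lemma sum_half_distance_le:
  assumes "finite I" shows "(\<Sum>k\<in>I. (1/2 :: real) ^ ((j - k) + (k - j))) \<le> 4"
proof -
  have "(\<Sum>k\<in>I. (1/2 :: real) ^ ((j - k) + (k - j)))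
      = (\<Sum>k\<in>{k\<in>I. k \<le> j}. (1/2) ^ (j - k)) + (\<Sum>k\<in>{k\<in>I. \<not> k \<le> j}. (1/2) ^ (k - j))"
    unfolding sum.inter_filter[OF assms] sum.distrib[symmetric]
    by (rule sum.cong) auto
  also have "(\<Sum>k\<in>{k\<in>I. k \<le> j}. (1/2 :: real) ^ (j - k)) = (\<Sum>m\<in>(\<lambda>k. j - k) ` {k\<in>I. k \<le> j}. (1/2) ^ m)"
    by (subst sum.reindex) (auto simp: inj_on_def)
  also have "(\<Sum>k\<in>{k\<in>I. \<not> k \<le> j}. (1/2 :: real) ^ (k - j)) = (\<Sum>m\<in>(\<lambda>k. k - j) ` {k\<in>I. \<not> k \<le> j}. (1/2) ^ m)"
    by (subst sum.reindex) (auto simp: inj_on_def)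
  finally show ?thesis
    using sum_half_powers_le[of "(\<lambda>k. j - k) ` {k\<in>I. k \<le> j}"] sum_half_powers_le[of "(\<lambda>k. k - j) ` {k\<in>I. \<not> k \<le> j}"] assms
    by simp
qed

text \<open>Schur test: the inequality of arithmetic and geometric means separates the two
  variables, and the row sums of the symmetric matrix are at most 4.\<close>

lemma Schur_half:
  fixes x :: "nat \<Rightarrow> real"
  assumes "finite I"
  shows "(\<Sum>j\<in>I. \<Sum>k\<in>I. (1/2) ^ ((j - k) + (k - j)) * (x j * x k)) \<le> 4 * (\<Sum>j\<in>I. (x j)\<^sup>2)"
proof -
  have "(\<Sum>j\<in>I. \<Sum>k\<in>I. (1/2) ^ ((j - k) + (k - j)) * (x j * x k))
     \<le> (\<Sum>j\<in>I. \<Sum>k\<in>I. (1/2) ^ ((j - k) + (k - j)) * ((x j)\<^sup>2 / 2) + (1/2) ^ ((k - j) + (j - k)) * ((x k)\<^sup>2 / 2))"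
  proof (intro sum_mono)
    fix j k
    have "x j * x k \<le> (x j)\<^sup>2 / 2 + (x k)\<^sup>2 / 2"
      using sum_squares_bound[of "x j" "x k"] by simp
    then have "(1/2) ^ ((j - k) + (k - j)) * (x j * x k) \<le> (1/2) ^ ((j - k) + (k - j)) * ((x j)\<^sup>2 / 2 + (x k)\<^sup>2 / 2)"
      by (rule mult_left_mono) simp
    then show "(1/2) ^ ((j - k) + (k - j)) * (x j * x k)
      \<le> (1/2) ^ ((j - k) + (k - j)) * ((x j)\<^sup>2 / 2) + (1/2) ^ ((k - j) + (j - k)) * ((x k)\<^sup>2 / 2)"
      by (simp add: distrib_left add.commute)
  qed
  also have "\<dots> = (\<Sum>j\<in>I. \<Sum>k\<in>I. (1/2) ^ ((j - k) + (k - j)) * ((x j)\<^sup>2 / 2))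
     + (\<Sum>k\<in>I. \<Sum>j\<in>I. (1/2) ^ ((k - j) + (j - k)) * ((x k)\<^sup>2 / 2))"
    unfolding sum.distrib by (subst sum.swap[of "\<lambda>j k. (1/2) ^ ((k - j) + (j - k)) * ((x k)\<^sup>2 / 2)"]) (rule refl)
  also have "\<dots> = (\<Sum>j\<in>I. (\<Sum>k\<in>I. (1/2) ^ ((j - k) + (k - j))) * (x j)\<^sup>2)"
    by (simp add: sum_distrib_right[symmetric] sum.distrib[symmetric] flip: sum_divide_distrib)
  also have "\<dots> \<le> (\<Sum>j\<in>I. 4 * (x j)\<^sup>2)"
    by (intro sum_mono mult_right_mono sum_half_distance_le assms) auto
  finally show ?thesis by (simp add: sum_distrib_left)
qed

lemma ip_sum_self:
  assumes "\<And>i. i \<in> I \<Longrightarrow> F i \<in> L2"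
  shows "(L2norm (\<lambda>x. \<Sum>i\<in>I. F i x))\<^sup>2 = (\<Sum>j\<in>I. \<Sum>k\<in>I. ip (F j) (F k))"
proof -
  have "(L2norm (\<lambda>x. \<Sum>i\<in>I. F i x))\<^sup>2 = (\<Sum>j\<in>I. ip (F j) (\<lambda>x. \<Sum>k\<in>I. F k x))"
    unfolding L2norm_power2 by (intro ip_sum L2_sum assms)
  also have "\<dots> = (\<Sum>j\<in>I. \<Sum>k\<in>I. ip (F k) (F j))"
    by (intro sum.cong refl) (simp add: ip_sym[of "F _" "\<lambda>x. \<Sum>k\<in>I. F k x"] ip_sum assms)
  finally show ?thesis by (simp add: ip_sym)
qed

text \<open>The 4 is the row sum of the Schur test, the product is the constant of
  \<open>cv_almost_orthogonal\<close> for the pair \<open>K\<close>, \<open>pd a K\<close>.\<close>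

definition orth_const :: "3 \<Rightarrow> sfield \<Rightarrow> real" where
  "orth_const a K = 4 * (L1norm K * L1norm (pd a (pd a K)))"

lemma orth_const_nonneg [simp]: "0 \<le> orth_const a K" by (simp add: orth_const_def)

text \<open>Expanding the square leaves inner products of pieces at scales \<open>j\<close> and
  \<open>k\<close>, which decay like 2^{-|j - k|}; the Schur test sums them. The sign
  \<open>\<sigma>\<close> covers the adjoint operators, whose scales are negative.\<close>

lemma dual_square_function:
  assumes K: "test UNIV K" and h: "\<And>k. k \<in> I \<Longrightarrow> h k \<in> L2" and I: "finite I" and \<sigma>: "\<bar>\<sigma>\<bar> = 1"
  shows "(L2norm (\<lambda>x. \<Sum>k\<in>I. cv (pd a K) (\<sigma> * (1/2) ^ k) (h k) x))\<^sup>2 \<le> orth_const a K * (\<Sum>k\<in>I. (L2norm (h k))\<^sup>2)"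
proof -
  define s where "s k = \<sigma> * (1/2) ^ k" for k :: nat
  have s: "s k \<noteq> 0" for k using \<sigma> by (auto simp: s_def)
  define c where "c = L1norm K * L1norm (pd a (pd a K))"
  have c0: "c \<ge> 0" by (simp add: c_def)
  have K': "test UNIV (pd a K)" by (rule test_pd[OF K])
  \<comment> \<open>The derivative is always taken off the kernel at the finer scale; when that is
    the inner one, commutation brings it outside first.\<close>
  have orth: "L2norm (cv (pd a K) (- s j) (cv (pd a K) (s k) f)) \<le> (1/2) ^ ((j - k) + (k - j)) * c * L2norm f"
    if f: "f \<in> L2" for j k f
  proof (cases "k \<le> j")
    case True
    have "\<bar>- s j / s k\<bar> = (1/2) ^ ((j - k) + (k - j))"
      using True \<sigma> by (simp add: s_def abs_mult power_diff)
    then show ?thesis using cv_almost_orthogonal[OF K K' f, of "- s j" "s k" a] s by (simp add: c_def)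
  next
    case False
    have "\<bar>s k / - s j\<bar> = (1/2) ^ ((j - k) + (k - j))"
      using False \<sigma> by (simp add: s_def abs_mult power_diff)
    then show ?thesis using cv_almost_orthogonal[OF K K' f, of "s k" "- s j" a] s
      cv_commute[OF K' K' f, of "- s j" "s k"] by (simp add: c_def)
  qed
  define F where "F k = cv (pd a K) (s k) (h k)" for k
  have FL: "k \<in> I \<Longrightarrow> F k \<in> L2" for k unfolding F_def by (rule cv_Young(1)[OF K' h s])
  have "(L2norm (\<lambda>x. \<Sum>k\<in>I. F k x))\<^sup>2 = (\<Sum>j\<in>I. \<Sum>k\<in>I. ip (F j) (F k))" by (rule ip_sum_self[OF FL])
  also have "\<dots> \<le> (\<Sum>j\<in>I. \<Sum>k\<in>I. c * ((1/2) ^ ((j - k) + (k - j)) * (L2norm (h j) * L2norm (h k))))"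
  proof (intro sum_mono)
    fix j k assume jk: "j \<in> I" "k \<in> I"
    have "ip (F j) (F k) = ip (h j) (cv (pd a K) (- s j) (F k))"
      unfolding F_def[of j] by (rule cv_adjoint[OF K' h[OF jk(1)] FL[OF jk(2)] s])
    also have "\<dots> \<le> L2norm (h j) * L2norm (cv (pd a K) (- s j) (F k))"
      using L2_Cauchy_Schwarz[OF h[OF jk(1)] cv_Young(1)[OF K' FL[OF jk(2)], of "- s j"]] s by simp
    also have "\<dots> \<le> L2norm (h j) * ((1/2) ^ ((j - k) + (k - j)) * c * L2norm (h k))"
      unfolding F_def by (intro mult_left_mono orth h jk) auto
    finally show "ip (F j) (F k) \<le> c * ((1/2) ^ ((j - k) + (k - j)) * (L2norm (h j) * L2norm (h k)))"
      by (simp add: ac_simps)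
  qed
  also have "\<dots> = c * (\<Sum>j\<in>I. \<Sum>k\<in>I. (1/2) ^ ((j - k) + (k - j)) * (L2norm (h j) * L2norm (h k)))"
    by (simp add: sum_distrib_left)
  also have "\<dots> \<le> c * (4 * (\<Sum>j\<in>I. (L2norm (h j))\<^sup>2))"
    by (intro mult_left_mono Schur_half I c0)
  finally show ?thesis by (simp add: F_def s_def c_def orth_const_def)
qed

text \<open>Closes the duality arguments, in which a sum of squares ends up bounded by a multiple of
  its own square root.\<close>

lemma le_sqrt_mult_imp:
  fixes X :: real
  assumes "0 \<le> X" "X \<le> b * sqrt X" "0 \<le> b" shows "X \<le> b\<^sup>2"
proof (cases "X = 0")
  case False
  then have "sqrt X > 0" using assms by simp
  moreover have "sqrt X * sqrt X \<le> b * sqrt X" using assms by simp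
  ultimately have "sqrt X \<le> b" by (metis mult_le_cancel_right_pos)
  then have "(sqrt X)\<^sup>2 \<le> b\<^sup>2" by (intro power_mono) (use assms in auto)
  then show ?thesis using assms by simp
qed (use assms in auto)

text \<open>Duality: the sum of squares is the inner product of \<open>f\<close> with the sum of the
  adjoints applied to the pieces, and \<open>dual_square_function\<close> with sign -1 bounds that
  sum by the square root of the quantity to be estimated.\<close>

lemma square_function:
  assumes K: "test UNIV K" and f: "f \<in> L2" and I: "finite I"
  shows "(\<Sum>k\<in>I. (L2norm (cv (pd a K) ((1/2) ^ k) f))\<^sup>2) \<le> orth_const a K * (L2norm f)\<^sup>2"
proof -
  have K': "test UNIV (pd a K)" by (rule test_pd[OF K])
  define F where "F k = cv (pd a K) ((1/2) ^ k) f" for k :: nat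
  have FL: "F k \<in> L2" for k unfolding F_def by (rule cv_Young(1)[OF K' f]) simp
  define X where "X = (\<Sum>k\<in>I. (L2norm (F k))\<^sup>2)"
  define G where "G k = cv (pd a K) (-1 * (1/2) ^ k) (F k)" for k :: nat
  have GL: "G k \<in> L2" for k unfolding G_def by (rule cv_Young(1)[OF K' FL]) simp
  have "X = (\<Sum>k\<in>I. ip (G k) f)"
    unfolding X_def
  proof (rule sum.cong[OF refl])
    fix k
    show "(L2norm (F k))\<^sup>2 = ip (G k) f"
      using cv_adjoint[OF K' f FL[of k], of "(1/2) ^ k"]
      by (simp add: L2norm_power2 F_def[of k, symmetric] G_def ip_sym[of _ f])
  qed
  also have "\<dots> = ip (\<lambda>x. \<Sum>k\<in>I. G k x) f" by (rule ip_sum[symmetric, OF GL f])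
  also have "\<dots> \<le> L2norm (\<lambda>x. \<Sum>k\<in>I. G k x) * L2norm f"
    using L2_Cauchy_Schwarz[OF L2_sum[OF GL] f] by (rule order_trans[OF abs_ge_self])
  also have "L2norm (\<lambda>x. \<Sum>k\<in>I. G k x) \<le> sqrt (orth_const a K * X)"
    unfolding X_def G_def by (rule real_le_rsqrt[OF dual_square_function[OF K FL I]]) simp
  finally have "X \<le> (sqrt (orth_const a K) * L2norm f) * sqrt X"
    by (simp add: real_sqrt_mult mult_right_mono ac_simps)
  moreover have "X \<ge> 0" unfolding X_def by (simp add: sum_nonneg)
  ultimately have "X \<le> (sqrt (orth_const a K) * L2norm f)\<^sup>2" by (intro le_sqrt_mult_imp) auto
  then show ?thesis by (simp add: X_def F_def power_mult_distrib)
qed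

text \<open>Without a derivative on the kernel there is no cancellation, but the weights 2^{-k} are
  square summable and Cauchy-Schwarz in \<open>k\<close> suffices.\<close>

lemma weighted_sum_bound:
  assumes K: "test UNIV K" and h: "\<And>k. k \<in> I \<Longrightarrow> h k \<in> L2" and I: "finite I" and \<sigma>: "\<bar>\<sigma>\<bar> = 1"
  shows "(L2norm (\<lambda>x. \<Sum>k\<in>I. (1/2) ^ k * cv K (\<sigma> * (1/2) ^ k) (h k) x))\<^sup>2 \<le> 2 * (L1norm K)\<^sup>2 * (\<Sum>k\<in>I. (L2norm (h k))\<^sup>2)"
proof -
  have s: "\<sigma> * (1/2) ^ k \<noteq> 0" for k using \<sigma> by auto
  have "L2norm (\<lambda>x. \<Sum>k\<in>I. (1/2) ^ k * cv K (\<sigma> * (1/2) ^ k) (h k) x)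
      \<le> (\<Sum>k\<in>I. L2norm (\<lambda>x. (1/2) ^ k * cv K (\<sigma> * (1/2) ^ k) (h k) x))"
    by (intro L2norm_sum L2_cmult cv_Young K h s)
  also have "\<dots> \<le> (\<Sum>k\<in>I. (1/2) ^ k * (L1norm K * L2norm (h k)))"
    unfolding L2norm_cmult by (intro sum_mono mult_mono cv_Young K h s) auto
  also have "\<dots> = L1norm K * (\<Sum>k\<in>I. (1/2) ^ k * L2norm (h k))"
    by (simp add: sum_distrib_left ac_simps)
  finally have "(L2norm (\<lambda>x. \<Sum>k\<in>I. (1/2) ^ k * cv K (\<sigma> * (1/2) ^ k) (h k) x))\<^sup>2
      \<le> (L1norm K * (\<Sum>k\<in>I. (1/2) ^ k * L2norm (h k)))\<^sup>2" by (rule power_mono) simp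
  also have "\<dots> \<le> (L1norm K)\<^sup>2 * ((\<Sum>k\<in>I. ((1/2) ^ k)\<^sup>2) * (\<Sum>k\<in>I. (L2norm (h k))\<^sup>2))"
    unfolding power_mult_distrib by (intro mult_left_mono Cauchy_Schwarz_ineq_sum) auto
  also have "\<dots> \<le> (L1norm K)\<^sup>2 * (2 * (\<Sum>k\<in>I. (L2norm (h k))\<^sup>2))"
  proof (intro mult_left_mono mult_right_mono)
    have "(\<Sum>k\<in>I. ((1/2 :: real) ^ k)\<^sup>2) \<le> (\<Sum>k\<in>I. (1/2) ^ k)"
      by (intro sum_mono) (simp add: power2_eq_square power_le_one mult_left_le_one_le)
    then show "(\<Sum>k\<in>I. ((1/2 :: real) ^ k)\<^sup>2) \<le> 2" using sum_half_powers_le[OF I] by linarith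
  qed (auto simp: sum_nonneg)
  finally show ?thesis by (simp add: ac_simps)
qed

section \<open>Dyadic series as bounded Cauchy sequences of test functions in H^1\<close>

section \<open>Bounded Cauchy sequences\<close>

definition bounded_Cauchy :: "real \<Rightarrow> (nat \<Rightarrow> sfield) \<Rightarrow> bool" where
  "bounded_Cauchy B F \<longleftrightarrow> (\<forall>n. F n \<in> L2 \<and> L2norm (F n) \<le> B) \<and> L2_Cauchy F"

lemma bounded_Cauchy_mono: "bounded_Cauchy B F \<Longrightarrow> B \<le> B' \<Longrightarrow> bounded_Cauchy B' F"
  unfolding bounded_Cauchy_def by (meson order_trans)

lemma bounded_Cauchy_const: "f \<in> L2 \<Longrightarrow> L2norm f \<le> B \<Longrightarrow> bounded_Cauchy B (\<lambda>n. f)"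
  by (simp add: bounded_Cauchy_def L2_Cauchy_def)

lemma bounded_Cauchy_add:
  assumes "bounded_Cauchy A F" "bounded_Cauchy B G" shows "bounded_Cauchy (A + B) (\<lambda>n x. F n x + G n x)"
proof -
  have L: "F n \<in> L2" "G n \<in> L2" "L2norm (F n) \<le> A" "L2norm (G n) \<le> B" for n
    using assms by (auto simp: bounded_Cauchy_def)
  have "L2_Cauchy (\<lambda>n x. F n x + G n x)"
    unfolding L2_Cauchy_def
  proof (intro allI impI)
    fix e :: real assume "e > 0"
    then have "e / 2 > 0" by simp
    then obtain M N where M: "\<And>m n. m \<ge> M \<Longrightarrow> n \<ge> M \<Longrightarrow> L2norm (\<lambda>x. F m x - F n x) \<le> e / 2"
      and N: "\<And>m n. m \<ge> N \<Longrightarrow> n \<ge> N \<Longrightarrow> L2norm (\<lambda>x. G m x - G n x) \<le> e / 2"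
      using assms unfolding bounded_Cauchy_def L2_Cauchy_def by meson
    have "L2norm (\<lambda>x. F m x + G m x - (F n x + G n x)) \<le> e" if "m \<ge> max M N" "n \<ge> max M N" for m n
    proof -
      have "L2norm (\<lambda>x. (F m x - F n x) + (G m x - G n x)) \<le> e / 2 + e / 2"
        by (rule order_trans[OF L2norm_triangle]) (use L M[of m n] N[of m n] that in auto)
      then show ?thesis by (simp add: algebra_simps)
    qed
    then show "\<exists>M. \<forall>m\<ge>M. \<forall>n\<ge>M. L2norm (\<lambda>x. F m x + G m x - (F n x + G n x)) \<le> e" by blast
  qed
  moreover have "L2norm (\<lambda>x. F n x + G n x) \<le> A + B" for n
    by (rule order_trans[OF L2norm_triangle]) (use L in \<open>auto intro: add_mono\<close>)
  ultimately show ?thesis using L by (auto simp: bounded_Cauchy_def)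
qed

lemma bounded_Cauchy_cmult:
  assumes "bounded_Cauchy A F" shows "bounded_Cauchy (\<bar>c\<bar> * A) (\<lambda>n x. c * F n x)"
proof -
  have L: "F n \<in> L2" "L2norm (F n) \<le> A" for n using assms by (auto simp: bounded_Cauchy_def)
  have "L2_Cauchy (\<lambda>n x. c * F n x)"
    unfolding L2_Cauchy_def
  proof (intro allI impI)
    fix e :: real assume e: "e > 0"
    then have "e / (\<bar>c\<bar> + 1) > 0" by simp
    then obtain M where M: "\<And>m n. m \<ge> M \<Longrightarrow> n \<ge> M \<Longrightarrow> L2norm (\<lambda>x. F m x - F n x) \<le> e / (\<bar>c\<bar> + 1)"
      using assms unfolding bounded_Cauchy_def L2_Cauchy_def by meson
    have "L2norm (\<lambda>x. c * F m x - c * F n x) \<le> e" if "m \<ge> M" "n \<ge> M" for m n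
    proof -
      have "L2norm (\<lambda>x. c * F m x - c * F n x) = \<bar>c\<bar> * L2norm (\<lambda>x. F m x - F n x)"
        using L2norm_cmult[of c "\<lambda>x. F m x - F n x"] by (simp add: algebra_simps)
      also have "\<dots> \<le> (\<bar>c\<bar> + 1) * (e / (\<bar>c\<bar> + 1))" using M[OF that] by (intro mult_mono) auto
      finally show ?thesis by simp
    qed
    then show "\<exists>M. \<forall>m\<ge>M. \<forall>n\<ge>M. L2norm (\<lambda>x. c * F m x - c * F n x) \<le> e" by blast
  qed
  then show ?thesis using L by (auto simp: bounded_Cauchy_def L2norm_cmult mult_left_mono)
qed

text \<open>An estimate on arbitrary blocks by a summable majorant yields the uniform bound (blocks
  starting at 0) and the Cauchy property (late blocks) together.\<close>

lemma bounded_Cauchy_series: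
  assumes G: "\<And>k. G k \<in> L2" and a: "\<And>k. 0 \<le> a k" "\<And>N. (\<Sum>k<N. a k) \<le> A"
    and le: "\<And>m n. (L2norm (\<lambda>x. \<Sum>k=m..<n. G k x))\<^sup>2 \<le> C * (\<Sum>k=m..<n. a k)"
    and C: "0 \<le> C" and B: "0 \<le> B" "C * A \<le> B\<^sup>2"
  shows "bounded_Cauchy B (\<lambda>N x. \<Sum>k<N. G k x)"
proof -
  have GL: "(\<lambda>x. \<Sum>k\<in>I. G k x) \<in> L2" for I by (rule L2_sum[OF G])
  have "L2norm (\<lambda>x. \<Sum>k<N. G k x) \<le> B" for N
  proof (rule power2_le_imp_le[OF _ B(1)])
    have "(L2norm (\<lambda>x. \<Sum>k<N. G k x))\<^sup>2 \<le> C * (\<Sum>k<N. a k)" using le[of 0 N] by (simp add: atLeast0LessThan)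
    also have "\<dots> \<le> C * A" by (intro mult_left_mono a C)
    finally show "(L2norm (\<lambda>x. \<Sum>k<N. G k x))\<^sup>2 \<le> B\<^sup>2" using B(2) by linarith
  qed
  moreover have "L2_Cauchy (\<lambda>N x. \<Sum>k<N. G k x)"
    unfolding L2_Cauchy_def
  proof (intro allI impI)
    fix e :: real assume e: "e > 0"
    have "summable a"
      by (rule bounded_imp_summable[of _ A]) (use a in \<open>auto simp only: lessThan_Suc_atMost[symmetric]\<close>)
    moreover have "e\<^sup>2 / (C + 1) > 0" using e C by simp
    ultimately obtain M where M: "\<And>m n. m \<ge> M \<Longrightarrow> norm (sum a {m..<n}) < e\<^sup>2 / (C + 1)"
      unfolding summable_Cauchy by meson
    have le_e: "L2norm (\<lambda>x. \<Sum>k=m..<n. G k x) \<le> e" if "m \<ge> M" for m n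
    proof (rule power2_le_imp_le)
      have "(L2norm (\<lambda>x. \<Sum>k=m..<n. G k x))\<^sup>2 \<le> C * (\<Sum>k=m..<n. a k)" by (rule le)
      also have "\<dots> \<le> (C + 1) * (e\<^sup>2 / (C + 1))" using M[OF that, of n] a C by (intro mult_mono) (auto simp: sum_nonneg)
      also have "\<dots> = e\<^sup>2" using C by simp
      finally show "(L2norm (\<lambda>x. \<Sum>k=m..<n. G k x))\<^sup>2 \<le> e\<^sup>2" .
    qed (use e in simp)
    have diff: "(\<lambda>x. (\<Sum>k<n. G k x) - (\<Sum>k<m. G k x)) = (\<lambda>x. \<Sum>k=m..<n. G k x)" if "m \<le> n" for m n
      using that by (auto simp: sum_diff_nat_ivl[of 0 m n] atLeast0LessThan[symmetric] fun_eq_iff)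
    have "L2norm (\<lambda>x. (\<Sum>k<m. G k x) - (\<Sum>k<n. G k x)) \<le> e" if "m \<ge> M" "n \<ge> M" for m n
    proof (cases "m \<le> n")
      case True
      then show ?thesis using diff[OF True] le_e[OF that(1), of n] by (simp add: L2norm_minus[of "\<lambda>x. \<Sum>k<m. G k x"])
    next
      case False
      then show ?thesis using diff[of n m] le_e[OF that(2), of m] by simp
    qed
    then show "\<exists>M. \<forall>m\<ge>M. \<forall>n\<ge>M. L2norm (\<lambda>x. (\<Sum>k<m. G k x) - (\<Sum>k<n. G k x)) \<le> e" by blast
  qed
  ultimately show ?thesis using GL by (simp add: bounded_Cauchy_def)
qed

text \<open>Sequences of test functions in \<open>U\<close>, bounded and Cauchy in H^1. Supports,
  symmetry and linearity are settled for such sequences by exact pointwise identities, and limits in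
  \<open>H10\<close> are taken only at the very end.\<close>

definition h1seq :: "(real^3) set \<Rightarrow> real \<Rightarrow> (nat \<Rightarrow> sfield) \<Rightarrow> bool" where
  "h1seq U B F \<longleftrightarrow> (\<forall>n. test U (F n)) \<and> bounded_Cauchy B F \<and> (\<forall>c. bounded_Cauchy B (\<lambda>n. pd c (F n)))"

lemma h1seq_mono: "h1seq U B F \<Longrightarrow> B \<le> B' \<Longrightarrow> h1seq U B' F"
  unfolding h1seq_def using bounded_Cauchy_mono by blast

lemma h1seq_add:
  assumes "h1seq U A F" "h1seq U B G" shows "h1seq U (A + B) (\<lambda>n x. F n x + G n x)"
proof -
  have "pd c (\<lambda>x. F n x + G n x) = (\<lambda>x. pd c (F n) x + pd c (G n) x)" for c n
    using assms by (intro pd_add_smooth test_smooth[of U]) (auto simp: h1seq_def)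
  then show ?thesis using assms by (auto simp: h1seq_def intro: test_add bounded_Cauchy_add)
qed

lemma h1seq_cmult:
  assumes "h1seq U A F" shows "h1seq U (\<bar>c\<bar> * A) (\<lambda>n x. c * F n x)"
proof -
  have "pd d (\<lambda>x. c * F n x) = (\<lambda>x. c * pd d (F n) x)" for d n
    using assms by (intro pd_cmult_smooth test_smooth[of U]) (auto simp: h1seq_def)
  then show ?thesis using assms by (auto simp: h1seq_def intro: test_cmult bounded_Cauchy_cmult)
qed

lemma h1seq_zero: "h1seq U 0 (\<lambda>n x. 0)"
  by (auto simp: h1seq_def intro: bounded_Cauchy_const)

lemma h1seq_sum: "(\<And>i. i \<in> I \<Longrightarrow> h1seq U (A i) (F i)) \<Longrightarrow> h1seq U (\<Sum>i\<in>I. A i) (\<lambda>n x. \<Sum>i\<in>I. F i n x)"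
  by (induction I rule: infinite_finite_induct) (auto simp: h1seq_zero intro: h1seq_add)

lemma h1seq_diff:
  assumes "h1seq U A F" "h1seq U B G" shows "h1seq U (A + B) (\<lambda>n x. F n x - G n x)"
  using h1seq_add[OF assms(1) h1seq_cmult[OF assms(2), of "-1"]] by simp

text \<open>The first summand controls the series itself, the second its three partial
  derivatives.\<close>

definition series_const :: "sfield \<Rightarrow> real" where
  "series_const K = sqrt 2 * L1norm K + (\<Sum>c\<in>UNIV. sqrt (orth_const c K))"

lemma series_const_ge:
  "sqrt 2 * L1norm K \<le> series_const K" "sqrt (orth_const c K) \<le> series_const K" "0 \<le> series_const K"
proof -
  have "sqrt (orth_const c K) \<le> (\<Sum>c\<in>UNIV. sqrt (orth_const c K))"
    by (rule member_le_sum) auto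
  moreover have "0 \<le> (\<Sum>c\<in>UNIV. sqrt (orth_const c K))" by (auto intro: sum_nonneg)
  ultimately show "sqrt 2 * L1norm K \<le> series_const K" "sqrt (orth_const c K) \<le> series_const K" "0 \<le> series_const K"
    by (auto simp: series_const_def add_increasing add_increasing2)
qed

lemma pd_scaled_cv:
  assumes "test UNIV K" "f \<in> L2" "s \<noteq> 0"
  shows "pd c (\<lambda>x. s * cv K s f x) = cv (pd c K) s f"
  unfolding pd_cmult_smooth[OF smooth_cv[OF assms]] pd_cv[OF assms] using assms by simp

text \<open>The weight 2^{-k} compensates exactly for the factor 2^k produced by differentiating the
  kernel. The derivative series is therefore unweighted and falls under
  \<open>dual_square_function\<close>, the series itself under
  \<open>weighted_sum_bound\<close>.\<close>

lemma h1seq_series: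
  assumes K: "test UNIV K" and h: "\<And>k. h k \<in> L2" and B: "0 \<le> B" "\<And>N. (\<Sum>k<N. (L2norm (h k))\<^sup>2) \<le> B\<^sup>2"
    and U: "\<And>k. test U (cv K ((1/2) ^ k) (h k))"
  shows "h1seq U (series_const K * B) (\<lambda>N x. \<Sum>k<N. (1/2) ^ k * cv K ((1/2) ^ k) (h k) x)"
  unfolding h1seq_def
proof (intro conjI allI)
  have KL: "cv K ((1/2) ^ k) (h k) \<in> L2" for k by (rule cv_Young(1)[OF K h]) simp
  show "test U (\<lambda>x. \<Sum>k<n. (1/2) ^ k * cv K ((1/2) ^ k) (h k) x)" for n
    by (intro test_sum test_cmult U)
  show "bounded_Cauchy (series_const K * B) (\<lambda>N x. \<Sum>k<N. (1/2) ^ k * cv K ((1/2) ^ k) (h k) x)"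
  proof (rule bounded_Cauchy_series[where a = "\<lambda>k. (L2norm (h k))\<^sup>2" and A = "B\<^sup>2" and C = "2 * (L1norm K)\<^sup>2"])
    show "(L2norm (\<lambda>x. \<Sum>k = m..<n. (1/2) ^ k * cv K ((1/2) ^ k) (h k) x))\<^sup>2 \<le> 2 * (L1norm K)\<^sup>2 * (\<Sum>k = m..<n. (L2norm (h k))\<^sup>2)" for m n
      using weighted_sum_bound[OF K h, of "{m..<n}" 1] by simp
    have "(sqrt 2 * L1norm K * B)\<^sup>2 \<le> (series_const K * B)\<^sup>2"
      by (intro power_mono mult_right_mono series_const_ge B) (auto intro: B mult_nonneg_nonneg)
    then show "2 * (L1norm K)\<^sup>2 * B\<^sup>2 \<le> (series_const K * B)\<^sup>2" by (simp add: power_mult_distrib)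
  qed (use KL B series_const_ge in auto)
  show "bounded_Cauchy (series_const K * B) (\<lambda>n. pd c (\<lambda>x. \<Sum>k<n. (1/2) ^ k * cv K ((1/2) ^ k) (h k) x))" for c
  proof -
    have K': "test UNIV (pd c K)" by (rule test_pd[OF K])
    have K'L: "cv (pd c K) ((1/2) ^ k) (h k) \<in> L2" for k by (rule cv_Young(1)[OF K' h]) simp
    have "bounded_Cauchy (series_const K * B) (\<lambda>N x. \<Sum>k<N. cv (pd c K) ((1/2) ^ k) (h k) x)"
    proof (rule bounded_Cauchy_series[where a = "\<lambda>k. (L2norm (h k))\<^sup>2" and A = "B\<^sup>2" and C = "orth_const c K"])
      show "(L2norm (\<lambda>x. \<Sum>k = m..<n. cv (pd c K) ((1/2) ^ k) (h k) x))\<^sup>2 \<le> orth_const c K * (\<Sum>k = m..<n. (L2norm (h k))\<^sup>2)" for m n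
        using dual_square_function[OF K h, of "{m..<n}" 1 c] by simp
      have "(sqrt (orth_const c K) * B)\<^sup>2 \<le> (series_const K * B)\<^sup>2"
        by (intro power_mono mult_right_mono series_const_ge B) (auto intro: B mult_nonneg_nonneg)
      then show "orth_const c K * B\<^sup>2 \<le> (series_const K * B)\<^sup>2" by (simp add: power_mult_distrib)
    qed (use K'L B series_const_ge in auto)
    moreover have "pd c (\<lambda>x. \<Sum>k<n. (1/2) ^ k * cv K ((1/2) ^ k) (h k) x) = (\<lambda>x. \<Sum>k<n. cv (pd c K) ((1/2) ^ k) (h k) x)" for n
    proof -
      have "smooth (\<lambda>x. (1/2) ^ k * cv K ((1/2) ^ k) (h k) x)" for k
        by (intro smooth_cmult smooth_cv K h) simp
      then have "pd c (\<lambda>x. \<Sum>k<n. (1/2) ^ k * cv K ((1/2) ^ k) (h k) x) = (\<lambda>x. \<Sum>k<n. pd c (\<lambda>x. (1/2) ^ k * cv K ((1/2) ^ k) (h k) x) x)"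
        by (rule pd_sum_smooth)
      also have "\<dots> = (\<lambda>x. \<Sum>k<n. cv (pd c K) ((1/2) ^ k) (h k) x)"
        by (intro ext sum.cong refl) (simp only: pd_scaled_cv[OF K h, of "(1/2) ^ _"] power_not_zero divide_eq_0_iff zero_neq_one zero_neq_numeral simp_thms one_neq_zero)
      finally show ?thesis .
    qed
    ultimately show ?thesis by simp
  qed
qed


section \<open>Recovering the full linearised Riemann tensor from inc in dimension three\<close>

section \<open>The linearised curvature\<close>

lemma levi_values:
  "levi 1 2 3 = 1" "levi 2 3 1 = 1" "levi 3 1 2 = 1"
  "levi 1 3 2 = -1" "levi 3 2 1 = -1" "levi 2 1 3 = -1"
  "levi i i k = 0" "levi i k i = 0" "levi k i i = 0"
proof -
  show "levi 1 2 3 = 1" "levi 2 3 1 = 1" "levi 3 1 2 = 1"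
    "levi 1 3 2 = -1" "levi 3 2 1 = -1" "levi 2 1 3 = -1"
    by (simp_all add: levi_def cross3_def axis_def)
  have "\<forall>i k. levi i i k = 0 \<and> levi i k i = 0 \<and> levi k i i = 0"
    by (simp add: forall_3 levi_def cross3_def axis_def)
  then show "levi i i k = 0" "levi i k i = 0" "levi k i i = 0" by auto
qed

text \<open>The epsilon-delta identity: contracting two Levi-Civita symbols over one index
  antisymmetrises.\<close>

lemma levi_contract:
  "(\<Sum>c\<in>UNIV. levi a k c * (\<Sum>p\<in>UNIV. \<Sum>q\<in>UNIV. levi c p q * F p q)) = F a k - F k a"
proof -
  have "\<forall>a k. (\<Sum>c\<in>UNIV. levi a k c * (\<Sum>p\<in>UNIV. \<Sum>q\<in>UNIV. levi c p q * F p q)) = F a k - F k a"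
    by (simp add: forall_3 sum_3 levi_values)
  then show ?thesis by blast
qed

text \<open>The classical pointwise counterpart of \<open>incD\<close>, meant for smooth
  fields.\<close>

definition incp :: "mfield \<Rightarrow> 3 \<Rightarrow> 3 \<Rightarrow> sfield" where
  "incp G c d x = (\<Sum>p\<in>UNIV. \<Sum>q\<in>UNIV. \<Sum>l\<in>UNIV. \<Sum>m\<in>UNIV.
      levi c p q * levi d l m * pd p (pd l (G m q)) x)"

text \<open>In three dimensions each antisymmetric index pair of the linearised Riemann tensor is
  dual to a single index, and inc is the tensor so encoded. Contracting with one symbol per pair
  decodes it.\<close>

lemma curvature_from_inc:
  assumes G: "\<And>i j. smooth (G i j)"
  shows "(\<Sum>c\<in>UNIV. \<Sum>d\<in>UNIV. levi a k c * levi b l d * incp G c d x) =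
    pd a (pd b (G l k)) x - pd a (pd l (G b k)) x - pd k (pd b (G l a)) x + pd k (pd l (G b a)) x"
proof -
  define T where "T p l m q = pd p (pd l (G m q)) x" for p l m q
  have swap: "(\<Sum>d\<in>UNIV. A d * (\<Sum>p\<in>UNIV. \<Sum>q\<in>UNIV. B p q * C d p q))
      = (\<Sum>p\<in>UNIV. \<Sum>q\<in>UNIV. B p q * (\<Sum>d\<in>UNIV. A d * C d p q))"
    for A :: "3 \<Rightarrow> real" and B :: "3 \<Rightarrow> 3 \<Rightarrow> real" and C
    by (simp add: sum_3 algebra_simps)
  have inc: "incp G c d x = (\<Sum>p\<in>UNIV. \<Sum>q\<in>UNIV. levi c p q * (\<Sum>l'\<in>UNIV. \<Sum>m\<in>UNIV. levi d l' m * T p l' m q))" for c d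
    by (simp only: incp_def T_def sum_distrib_left mult.assoc)
  have "(\<Sum>c\<in>UNIV. \<Sum>d\<in>UNIV. levi a k c * levi b l d * incp G c d x)
     = (\<Sum>c\<in>UNIV. levi a k c * (\<Sum>d\<in>UNIV. levi b l d * incp G c d x))"
    by (simp only: sum_distrib_left mult.assoc)
  also have "\<dots> = (\<Sum>c\<in>UNIV. levi a k c * (\<Sum>p\<in>UNIV. \<Sum>q\<in>UNIV. levi c p q * (T p b l q - T p l b q)))"
  proof (rule sum.cong[OF refl])
    fix c
    have "(\<Sum>d\<in>UNIV. levi b l d * incp G c d x) = (\<Sum>p\<in>UNIV. \<Sum>q\<in>UNIV. levi c p q *
       (\<Sum>d\<in>UNIV. levi b l d * (\<Sum>l'\<in>UNIV. \<Sum>m\<in>UNIV. levi d l' m * T p l' m q)))"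
      unfolding inc by (rule swap)
    then show "levi a k c * (\<Sum>d\<in>UNIV. levi b l d * incp G c d x)
      = levi a k c * (\<Sum>p\<in>UNIV. \<Sum>q\<in>UNIV. levi c p q * (T p b l q - T p l b q))"
      by (simp only: levi_contract)
  qed
  also have "\<dots> = T a b l k - T a l b k - (T k b l a - T k l b a)" by (simp only: levi_contract)
  finally show ?thesis by (simp add: T_def)
qed

section \<open>The decomposition of fields supported in \<open>D\<close>, with its H^1
  estimates\<close>

section \<open>Local decomposition\<close>

lemma H1norm_test_le: "H1norm_test \<phi> \<le> L2norm \<phi> + (\<Sum>j\<in>UNIV. L2norm (pd j \<phi>))"
  unfolding H1norm_test_def
proof (rule real_le_lsqrt)
  show "(L2norm \<phi>)\<^sup>2 + (\<Sum>j\<in>UNIV. (L2norm (pd j \<phi>))\<^sup>2) \<le> (L2norm \<phi> + (\<Sum>j\<in>UNIV. L2norm (pd j \<phi>)))\<^sup>2"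
    by (simp add: sum_3 power2_eq_square algebra_simps add_nonneg_nonneg)
qed (intro add_nonneg_nonneg sum_nonneg L2norm_nonneg)

lemma H1norm_test_nonneg [simp]: "0 \<le> H1norm_test \<phi>"
  by (simp add: H1norm_test_def sum_nonneg)

lemma incD_sum:
  assumes g: "\<And>i j. g i j \<in> L2" and \<psi>: "\<And>n. n \<in> I \<Longrightarrow> test UNIV (\<psi> n)"
  shows "incD g c d (\<lambda>x. \<Sum>n\<in>I. \<psi> n x) = (\<Sum>n\<in>I. incD g c d (\<psi> n))"
proof -
  have pd1: "pd l (\<lambda>x. \<Sum>n\<in>I. \<psi> n x) = (\<lambda>x. \<Sum>n\<in>I. pd l (\<psi> n) x)" for l
    by (rule pd_sum_smooth) (rule test_smooth[OF \<psi>])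
  have pd2: "pd p (pd l (\<lambda>x. \<Sum>n\<in>I. \<psi> n x)) = (\<lambda>x. \<Sum>n\<in>I. pd p (pd l (\<psi> n)) x)" for p l
    unfolding pd1 by (rule pd_sum_smooth) (rule smooth_pd[OF test_smooth[OF \<psi>]])
  have "integral\<^sup>L lborel (\<lambda>x. g m q x * (\<Sum>n\<in>I. pd p (pd l (\<psi> n)) x))
      = (\<Sum>n\<in>I. integral\<^sup>L lborel (\<lambda>x. g m q x * pd p (pd l (\<psi> n)) x))" for m q p l
    unfolding sum_distrib_left
    by (rule Bochner_Integration.integral_sum)
      (intro L2_mult_integrable g test_L2[of UNIV] test_pd \<psi>)
  then have "incD g c d (\<lambda>x. \<Sum>n\<in>I. \<psi> n x) = (\<Sum>p\<in>UNIV. \<Sum>q\<in>UNIV. \<Sum>l\<in>UNIV. \<Sum>m\<in>UNIV. \<Sum>n\<in>I.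
      levi c p q * levi d l m * integral\<^sup>L lborel (\<lambda>x. g m q x * pd p (pd l (\<psi> n)) x))"
    unfolding incD_def pd2 by (simp add: sum_distrib_left)
  also have "\<dots> = (\<Sum>n\<in>I. incD g c d (\<psi> n))"
    unfolding incD_def
    by (simp only: sum.swap[where A = "UNIV :: 3 set" and B = I])
  finally show ?thesis .
qed

lemma double_integration_by_parts:
  assumes u: "test U u" and v: "smooth v"
  shows "integral\<^sup>L lborel (\<lambda>x. u x * pd i (pd j v) x) = integral\<^sup>L lborel (\<lambda>x. pd i (pd j u) x * v x)"
  using integration_by_parts[OF u smooth_pd[OF v]] integration_by_parts[OF test_pd[OF u] v]
  by (simp add: pd_commute[OF test_smooth[OF u], of i j])

text \<open>\<open>refine\<close> expresses that the difference of consecutive averages is a double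
  divergence. \<open>Q\<close> contains also the support of the contracted kernel, since both
  averages are written at the coarser scale. Two convolutions follow one another, so a point of
  \<open>D\<close> is moved by \<open>s *\<^sub>R (z + z')\<close>, and the last assumption keeps it
  inside \<open>U\<close>.\<close>

locale local_kernels =
  fixes \<omega> :: sfield and \<theta> :: "3 \<Rightarrow> 3 \<Rightarrow> sfield" and Q D U :: "(real^3) set"
  assumes \<omega>: "test UNIV \<omega>" "integral\<^sup>L lborel \<omega> = 1"
    and \<theta>: "\<And>a b. test UNIV (\<theta> a b)" "\<And>a b. \<theta> a b = \<theta> b a"
    and refine: "\<And>x. 8 * \<omega> (2 *\<^sub>R x) - \<omega> x = (\<Sum>a\<in>UNIV. \<Sum>b\<in>UNIV. pd a (pd b (\<theta> a b)) x)"
    and Q: "compact Q" "\<And>x. \<omega> x \<noteq> 0 \<Longrightarrow> x \<in> Q" "\<And>x. \<omega> (2 *\<^sub>R x) \<noteq> 0 \<Longrightarrow> x \<in> Q"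
      "\<And>a b x. \<theta> a b x \<noteq> 0 \<Longrightarrow> x \<in> Q"
    and D: "compact D" "\<And>y z z' s. y \<in> D \<Longrightarrow> z \<in> Q \<Longrightarrow> z' \<in> Q \<Longrightarrow> 0 < s \<Longrightarrow> s \<le> 1 \<Longrightarrow> y + s *\<^sub>R (z + z') \<in> U"
begin

definition sc :: "nat \<Rightarrow> real" where "sc n = (1/2) ^ n"

lemma sc [simp]: "0 < sc n" "sc n \<le> 1" "sc n \<noteq> 0"
  by (auto simp: sc_def power_le_one)

text \<open>By \<open>cv_halve\<close>, the kernel of the sum of two consecutive averages at the
  coarser of their scales; \<open>u n\<close> is that sum.\<close>

definition \<beta> :: sfield where "\<beta> z = 8 * \<omega> (2 *\<^sub>R z) + \<omega> z"

definition av :: "nat \<Rightarrow> sfield \<Rightarrow> sfield" where "av n f = cv \<omega> (sc n) f"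

definition u :: "nat \<Rightarrow> sfield \<Rightarrow> sfield" where "u n f = cv \<beta> (sc n) f"

text \<open>The set reached from \<open>D\<close> by the first convolution at scale
  \<open>n\<close>.\<close>

definition E :: "nat \<Rightarrow> (real^3) set" where "E n = (\<lambda>(y, z). y + sc n *\<^sub>R z) ` (D \<times> Q)"

definition supp_D :: "sfield \<Rightarrow> bool" where "supp_D f \<longleftrightarrow> f \<in> L2 \<and> (\<forall>x. x \<notin> D \<longrightarrow> f x = 0)"

lemma E_compact: "compact (E n)"
  unfolding E_def case_prod_unfold
  by (intro compact_continuous_image compact_Times D Q continuous_intros)

lemma supp_D_L2: "supp_D f \<Longrightarrow> f \<in> L2" by (simp add: supp_D_def)

lemma \<omega>2: "test UNIV (\<lambda>z. 8 * \<omega> (2 *\<^sub>R z))"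
  using test_cmult[OF test_affine[OF \<omega>(1), of 2 0]] by simp

lemma \<beta>: "test UNIV \<beta>" "\<beta> x \<noteq> 0 \<Longrightarrow> x \<in> Q"
proof -
  show "test UNIV \<beta>" unfolding \<beta>_def[abs_def] by (rule test_add[OF \<omega>2 \<omega>(1)])
  assume "\<beta> x \<noteq> 0"
  then have "\<omega> x \<noteq> 0 \<or> \<omega> (2 *\<^sub>R x) \<noteq> 0" by (auto simp: \<beta>_def)
  then show "x \<in> Q" using Q(2,3) by blast
qed

lemma cv_zero_off_E:
  assumes K: "\<And>x. K x \<noteq> 0 \<Longrightarrow> x \<in> Q" and f: "supp_D f" and x: "x \<notin> E n"
  shows "cv K (sc n) f x = 0"
proof (rule ccontr)
  assume "cv K (sc n) f x \<noteq> 0"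
  then obtain z where "K z \<noteq> 0" "f (x - sc n *\<^sub>R z) \<noteq> 0" using cv_support by blast
  then have "z \<in> Q" "x - sc n *\<^sub>R z \<in> D" using K f by (auto simp: supp_D_def)
  then have "(\<lambda>(y, z). y + sc n *\<^sub>R z) (x - sc n *\<^sub>R z, z) \<in> E n" unfolding E_def by blast
  with x show False by simp
qed

lemma test_cv_U:
  assumes K: "test UNIV K" "\<And>x. K x \<noteq> 0 \<Longrightarrow> x \<in> Q" and f: "f \<in> L2" "\<And>x. x \<notin> E n \<Longrightarrow> f x = 0"
  shows "test U (cv K (sc n) f)"
  unfolding test_iff
proof (intro conjI exI[of _ "(\<lambda>(y, z, z'). y + sc n *\<^sub>R (z + z')) ` (D \<times> Q \<times> Q)"] allI impI)
  show "smooth (cv K (sc n) f)" by (rule smooth_cv[OF K(1) f(1)]) simp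
  show "compact ((\<lambda>(y, z, z'). y + sc n *\<^sub>R (z + z')) ` (D \<times> Q \<times> Q))"
    unfolding case_prod_unfold by (intro compact_continuous_image compact_Times D Q continuous_intros)
  show "(\<lambda>(y, z, z'). y + sc n *\<^sub>R (z + z')) ` (D \<times> Q \<times> Q) \<subseteq> U"
    using D(2)[of _ _ _ "sc n"] by auto
  fix x assume x: "x \<notin> (\<lambda>(y, z, z'). y + sc n *\<^sub>R (z + z')) ` (D \<times> Q \<times> Q)"
  show "cv K (sc n) f x = 0"
  proof (rule ccontr)
    assume "cv K (sc n) f x \<noteq> 0"
    then obtain z where z: "K z \<noteq> 0" "f (x - sc n *\<^sub>R z) \<noteq> 0" using cv_support by blast
    then have "x - sc n *\<^sub>R z \<in> E n" using f(2) by blast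
    then obtain y z' where "y \<in> D" "z' \<in> Q" "x - sc n *\<^sub>R z = y + sc n *\<^sub>R z'" by (auto simp: E_def)
    moreover have "z \<in> Q" using K(2) z by blast
    moreover have "x = y + sc n *\<^sub>R (z + z')" using calculation(3) by (simp add: algebra_simps)
    ultimately have "x \<in> (\<lambda>(y, z, z'). y + sc n *\<^sub>R (z + z')) ` (D \<times> Q \<times> Q)" by force
    with x show False by blast
  qed
qed

lemma test_cv_supp_D:
  assumes "test UNIV K" "\<And>x. K x \<noteq> 0 \<Longrightarrow> x \<in> Q" "supp_D f"
  shows "test UNIV (cv K (sc n) f)"
  unfolding test_iff
proof (intro conjI exI[of _ "E n"] allI impI)
  show "smooth (cv K (sc n) f)" by (rule smooth_cv[OF assms(1) supp_D_L2[OF assms(3)]]) simp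
qed (use E_compact cv_zero_off_E[OF assms(2,3)] in auto)

lemma u_test: "supp_D f \<Longrightarrow> test UNIV (u n f)"
  unfolding u_def by (rule test_cv_supp_D[OF \<beta>])

lemma u_zero: "supp_D f \<Longrightarrow> x \<notin> E n \<Longrightarrow> u n f x = 0"
  unfolding u_def by (rule cv_zero_off_E[OF \<beta>(2)])

lemma pd_u_zero: "supp_D f \<Longrightarrow> x \<notin> E n \<Longrightarrow> pd i (u n f) x = 0"
  by (rule pd_zero_outside[OF compact_imp_closed[OF E_compact] u_zero])

lemma pd2_u_zero: "supp_D f \<Longrightarrow> x \<notin> E n \<Longrightarrow> pd j (pd i (u n f)) x = 0"
  by (rule pd_zero_outside[OF compact_imp_closed[OF E_compact] pd_u_zero])

lemma scaled_pd_u: "supp_D f \<Longrightarrow> cv (pd a \<beta>) (sc n) f = (\<lambda>x. sc n * pd a (u n f) x)"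
  unfolding u_def by (simp add: pd_cv[OF \<beta>(1) supp_D_L2])

text \<open>The averages commute, so the difference of squares factors into difference times sum.
  The difference has the double divergence kernel, and its two derivatives pass to
  \<open>u n f\<close> with one factor \<open>sc n\<close> each.\<close>

lemma averages_telescope:
  assumes f: "supp_D f"
  shows "av (Suc n) (av (Suc n) f) x - av n (av n f) x =
    (\<Sum>a\<in>UNIV. \<Sum>b\<in>UNIV. (sc n)\<^sup>2 * cv (\<theta> a b) (sc n) (pd a (pd b (u n f))) x)"
proof -
  have fL: "f \<in> L2" using f by (rule supp_D_L2)
  have half: "av (Suc n) h = cv (\<lambda>z. 8 * \<omega> (2 *\<^sub>R z)) (sc n) h" if "h \<in> L2" for h
    using cv_halve[OF test_measurable[OF \<omega>(1)] L2_measurable[OF that], of "sc n"]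
    by (simp add: av_def sc_def)
  have aL: "av m h \<in> L2" if "h \<in> L2" for m h unfolding av_def by (rule cv_Young(1)[OF \<omega>(1) that]) simp
  have uu: "u n f = (\<lambda>x. av (Suc n) f x + av n f x)"
    unfolding u_def \<beta>_def[abs_def] half[OF fL] av_def[of n] by (rule cv_kernel_add[OF \<omega>2 \<omega>(1) fL]) simp
  have ut: "test UNIV (u n f)" by (rule u_test[OF f])
  have uL: "u n f \<in> L2" by (rule test_L2[OF ut])
  have ker: "(\<lambda>z. 8 * \<omega> (2 *\<^sub>R z) - \<omega> z) = (\<lambda>z. \<Sum>a\<in>UNIV. \<Sum>b\<in>UNIV. pd a (pd b (\<theta> a b)) z)"
    using refine by blast
  have com: "av (Suc n) (av n f) = av n (av (Suc n) f)"
    unfolding av_def by (rule cv_commute[OF \<omega>(1) \<omega>(1) fL]) simp_all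
  have lin: "av m (\<lambda>x. av (Suc n) f x + av n f x) = (\<lambda>x. av m (av (Suc n) f) x + av m (av n f) x)" for m
    unfolding av_def[of m] by (rule cv_add[OF \<omega>(1) aL[OF fL] aL[OF fL]]) simp
  have "av (Suc n) (av (Suc n) f) x - av n (av n f) x = av (Suc n) (u n f) x - av n (u n f) x"
    unfolding uu lin com by simp
  also have "\<dots> = cv (\<lambda>z. 8 * \<omega> (2 *\<^sub>R z) - \<omega> z) (sc n) (u n f) x"
    unfolding half[OF uL] unfolding av_def by (subst cv_kernel_diff[OF \<omega>2 \<omega>(1) uL]) simp_all
  also have "\<dots> = (\<Sum>a\<in>UNIV. \<Sum>b\<in>UNIV. cv (pd a (pd b (\<theta> a b))) (sc n) (u n f) x)"
  proof -
    have t: "test UNIV (pd a (pd b (\<theta> a b)))" for a b by (intro test_pd \<theta>)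
    show ?thesis unfolding ker
      by (subst cv_kernel_sum[OF test_sum[OF t] uL]) (simp_all add: cv_kernel_sum[OF t uL])
  qed
  also have "\<dots> = (\<Sum>a\<in>UNIV. \<Sum>b\<in>UNIV. (sc n)\<^sup>2 * cv (\<theta> a b) (sc n) (pd a (pd b (u n f))) x)"
  proof (intro sum.cong refl)
    fix a b
    have "cv (pd a (pd b (\<theta> a b))) (sc n) (u n f) = (\<lambda>x. sc n * cv (pd b (\<theta> a b)) (sc n) (pd a (u n f)) x)"
      by (rule cv_pd_kernel[OF test_pd[OF \<theta>(1)] test_smooth[OF ut]])
    also have "cv (pd b (\<theta> a b)) (sc n) (pd a (u n f)) = (\<lambda>x. sc n * cv (\<theta> a b) (sc n) (pd b (pd a (u n f))) x)"
      by (rule cv_pd_kernel[OF \<theta>(1) test_smooth[OF test_pd[OF ut]]])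
    finally show "cv (pd a (pd b (\<theta> a b))) (sc n) (u n f) x = (sc n)\<^sup>2 * cv (\<theta> a b) (sc n) (pd a (pd b (u n f))) x"
      by (simp add: power2_eq_square pd_commute[OF test_smooth[OF ut], of b a])
  qed
  finally show ?thesis .
qed

text \<open>By \<open>scaled_pd_u\<close> the inner function is \<open>sc n\<close> times
  \<open>pd c (u n f)\<close>. Keeping it as a convolution with \<open>pd c \<beta>\<close> displays
  the second cancelling kernel, which is what makes the pieces square summable.\<close>

definition V :: "3 \<Rightarrow> 3 \<Rightarrow> 3 \<Rightarrow> sfield \<Rightarrow> nat \<Rightarrow> sfield" where
  "V a b c f N x = (\<Sum>n<N. sc n * cv (\<theta> a b) (sc n) (cv (pd c \<beta>) (sc n) f) x)"

text \<open>Chosen so that its symmetrised gradient collects, under \<open>\<theta> a b\<close>, the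
  derivatives k,a of the entry b,l plus l,a of b,k minus k,l of a,b. These are the terms by which
  the a,b derivatives of the entry k,l differ from the curvature.\<close>

definition W :: "mfield \<Rightarrow> nat \<Rightarrow> vfield" where
  "W g N l x = (\<Sum>a\<in>UNIV. \<Sum>b\<in>UNIV. 2 * V a b a (g b l) N x - V a b l (g a b) N x)"

text \<open>The factor \<open>sc n\<close> offsets the one derivative by which inc of the field
  fails to be in L2; the \<open>H\<close> are the square summable pieces of inc.\<close>

definition H :: "mfield \<Rightarrow> 3 \<Rightarrow> 3 \<Rightarrow> nat \<Rightarrow> sfield" where
  "H g c d n x = sc n * incp (\<lambda>m q. u n (g m q)) c d x"

definition S :: "mfield \<Rightarrow> nat \<Rightarrow> mfield" where
  "S g N k l x = av 0 (av 0 (g k l)) x + (\<Sum>a\<in>UNIV. \<Sum>b\<in>UNIV. \<Sum>c\<in>UNIV. \<Sum>d\<in>UNIV.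
     levi a k c * levi b l d * (\<Sum>n<N. sc n * cv (\<theta> a b) (sc n) (H g c d n) x))"

definition supp_field :: "mfield \<Rightarrow> bool" where
  "supp_field g \<longleftrightarrow> (\<forall>i j. supp_D (g i j) \<and> g i j = g j i)"

lemma supp_fieldD: "supp_field g \<Longrightarrow> supp_D (g i j)" "supp_field g \<Longrightarrow> g i j = g j i"
  unfolding supp_field_def by blast+

lemma H_test: assumes "supp_field g" shows "test UNIV (H g c d n)"
proof -
  have "test UNIV (pd p (pd l (u n (g m q))))" for p l m q
    by (intro test_pd u_test supp_fieldD assms)
  then show ?thesis unfolding H_def[abs_def] incp_def
    by (intro test_cmult test_sum) auto
qed

lemma H_zero: "supp_field g \<Longrightarrow> x \<notin> E n \<Longrightarrow> H g c d n x = 0"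
  by (simp add: H_def incp_def pd2_u_zero supp_fieldD)

lemma term_smooth:
  assumes "supp_D f"
  shows "smooth (\<lambda>x. sc n * cv (\<theta> a b) (sc n) (cv (pd c \<beta>) (sc n) f) x)"
  by (intro smooth_cmult smooth_cv \<theta> cv_Young(1) test_pd \<beta> supp_D_L2 assms) simp_all

lemma V_smooth: "supp_D f \<Longrightarrow> smooth (V a b c f N)"
  unfolding V_def[abs_def] by (intro smooth_sum term_smooth)

lemma pd_V_Suc:
  assumes f: "supp_D f"
  shows "pd k (V a b c f (Suc n)) x = pd k (V a b c f n) x + (sc n)\<^sup>2 * cv (\<theta> a b) (sc n) (pd k (pd c (u n f))) x"
proof -
  have ut: "test UNIV (pd c (u n f))" by (intro test_pd u_test f)
  have VS: "V a b c f (Suc n) = (\<lambda>x. V a b c f n x + sc n * cv (\<theta> a b) (sc n) (cv (pd c \<beta>) (sc n) f) x)"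
    by (rule ext) (simp add: V_def)
  have "(\<lambda>x. sc n * cv (\<theta> a b) (sc n) (cv (pd c \<beta>) (sc n) f) x) = (\<lambda>x. (sc n)\<^sup>2 * cv (\<theta> a b) (sc n) (pd c (u n f)) x)"
    unfolding scaled_pd_u[OF f] cv_cmult by (simp add: power2_eq_square mult.assoc)
  moreover have "pd k (\<lambda>x. (sc n)\<^sup>2 * cv (\<theta> a b) (sc n) (pd c (u n f)) x) = (\<lambda>x. (sc n)\<^sup>2 * cv (\<theta> a b) (sc n) (pd k (pd c (u n f))) x)"
    by (subst pd_cmult_smooth) (simp_all add: smooth_cv pd_cv_smooth \<theta> test_L2[OF ut] test_smooth[OF ut])
  ultimately show ?thesis unfolding VS
    by (subst pd_add_smooth[OF V_smooth[OF f] term_smooth[OF f]]) simp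
qed

lemma pd_W:
  assumes g: "supp_field g"
  shows "pd k (W g N l) x = (\<Sum>a\<in>UNIV. \<Sum>b\<in>UNIV. 2 * pd k (V a b a (g b l) N) x - pd k (V a b l (g a b) N) x)"
proof -
  have s: "smooth (V a b c (g i j) N)" for a b c i j by (intro V_smooth supp_fieldD g)
  have "pd k (\<lambda>x. \<Sum>a\<in>UNIV. \<Sum>b\<in>UNIV. 2 * V a b a (g b l) N x - V a b l (g a b) N x)
    = (\<lambda>x. \<Sum>a\<in>UNIV. \<Sum>b\<in>UNIV. 2 * pd k (V a b a (g b l) N) x - pd k (V a b l (g a b) N) x)"
    by (subst pd_sum_smooth, intro smooth_sum smooth_diff smooth_cmult s,
      subst pd_sum_smooth, intro smooth_diff smooth_cmult s,
      simp add: pd_diff_smooth[OF smooth_cmult[OF s] s] pd_cmult_smooth[OF s])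
  then show ?thesis by (simp add: W_def[abs_def])
qed

text \<open>Telescoping adds the second derivatives a,b of the entry k,l of the averaged field at
  each scale. Subtracting the curvature combination, which is the increment of \<open>S\<close>,
  leaves exactly the symmetrised gradient of the increment of \<open>W\<close>. The identity is
  exact for every \<open>N\<close>.\<close>

theorem averages_decomposition:
  assumes g: "supp_field g"
  shows "av N (av N (g k l)) x = S g N k l x + (pd k (W g N l) x + pd l (W g N k) x) / 2"
proof (induction N)
  case 0
  have "W g 0 l = (\<lambda>x. 0)" for l by (rule ext) (simp add: W_def V_def)
  then show ?case by (simp add: S_def)
next
  case (Suc n)
  define v where "v i j = u n (g i j)" for i j
  have vt: "test UNIV (v i j)" for i j unfolding v_def by (intro u_test supp_fieldD g)
  have vs: "smooth (v i j)" for i j by (rule test_smooth[OF vt])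
  have vsym: "v i j = v j i" for i j unfolding v_def using supp_fieldD(2)[OF g, of i j] by simp
  define L where "L a b f = (sc n)\<^sup>2 * cv (\<theta> a b) (sc n) f x" for a b f
  have pdt: "test UNIV (pd i (pd j (v p q)))" for i j p q by (intro test_pd vt)
  have pdL: "pd i (pd j (v p q)) \<in> L2" for i j p q by (rule test_L2[OF pdt])
  have Lsym: "L a b f = L b a f" for a b f unfolding L_def using \<theta>(2)[of a b] by simp
  \<comment> \<open>The increment of \<open>S\<close> under \<open>\<theta> a b\<close>, unfolded
    into the four terms of the linearised Riemann tensor.\<close>
  have R: "(\<Sum>c\<in>UNIV. \<Sum>d\<in>UNIV. levi a k c * levi b l d * (sc n * cv (\<theta> a b) (sc n) (H g c d n) x))
     = L a b (pd a (pd b (v k l))) - L a b (pd l (pd a (v b k))) - L a b (pd k (pd b (v a l))) + L a b (pd k (pd l (v a b)))" for a b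
  proof -
    have it: "test UNIV (incp v c d)" for c d
      unfolding incp_def[abs_def] by (intro test_sum test_cmult pdt)
    have iL: "(\<lambda>x. levi a k c * levi b l d * incp v c d x) \<in> L2" for c d
      by (rule test_L2[OF test_cmult[OF it]])
    have "cv (\<theta> a b) (sc n) (H g c d n) x = sc n * cv (\<theta> a b) (sc n) (incp v c d) x" for c d
      unfolding H_def[abs_def] v_def[symmetric] cv_cmult ..
    then have "(\<Sum>c\<in>UNIV. \<Sum>d\<in>UNIV. levi a k c * levi b l d * (sc n * cv (\<theta> a b) (sc n) (H g c d n) x))
      = (\<Sum>c\<in>UNIV. \<Sum>d\<in>UNIV. (sc n)\<^sup>2 * cv (\<theta> a b) (sc n) (\<lambda>x. levi a k c * levi b l d * incp v c d x) x)"
      by (simp add: cv_cmult power2_eq_square ac_simps)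
    also have "\<dots> = L a b (\<lambda>x. \<Sum>c\<in>UNIV. \<Sum>d\<in>UNIV. levi a k c * levi b l d * incp v c d x)"
      unfolding L_def
      by (subst cv_sum[OF \<theta>(1) L2_sum[OF iL]]) (simp_all add: cv_sum[OF \<theta>(1) iL] sum_distrib_left)
    also have "(\<lambda>x. \<Sum>c\<in>UNIV. \<Sum>d\<in>UNIV. levi a k c * levi b l d * incp v c d x)
      = (\<lambda>x. ((pd a (pd b (v k l)) x - pd l (pd a (v b k)) x) - pd k (pd b (v a l)) x) + pd k (pd l (v a b)) x)"
      unfolding curvature_from_inc[OF vs]
      using vsym[of l k] vsym[of l a] vsym[of b a] pd_commute[OF vs, of a l b k] by simp
    also have "L a b \<dots> = L a b (pd a (pd b (v k l))) - L a b (pd l (pd a (v b k))) - L a b (pd k (pd b (v a l))) + L a b (pd k (pd l (v a b)))"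
      unfolding L_def
      unfolding cv_add[OF \<theta>(1) L2_diff[OF L2_diff[OF pdL pdL] pdL] pdL sc(3)]
         cv_diff[OF \<theta>(1) L2_diff[OF pdL pdL] pdL sc(3)] cv_diff[OF \<theta>(1) pdL pdL sc(3)]
      by (simp add: algebra_simps)
    finally show ?thesis .
  qed
  have SS: "S g (Suc n) k l x = S g n k l x + (\<Sum>a\<in>UNIV. \<Sum>b\<in>UNIV. \<Sum>c\<in>UNIV. \<Sum>d\<in>UNIV. levi a k c * levi b l d * (sc n * cv (\<theta> a b) (sc n) (H g c d n) x))"
    unfolding S_def sum.lessThan_Suc distrib_left sum.distrib by simp
  have WW: "pd i (W g (Suc n) j) x = pd i (W g n j) x + (\<Sum>a\<in>UNIV. \<Sum>b\<in>UNIV. 2 * L a b (pd i (pd a (v b j))) - L a b (pd i (pd j (v a b))))" for i j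
    unfolding pd_W[OF g] pd_V_Suc[OF supp_fieldD(1)[OF g]] L_def v_def
    by (simp add: sum.distrib[symmetric] algebra_simps)
  \<comment> \<open>Symmetry of \<open>\<theta>\<close> exchanges \<open>a\<close> and
    \<open>b\<close>, which brings one of the two mixed curvature terms to the form produced by
    \<open>W\<close>.\<close>
  have sw: "(\<Sum>a\<in>UNIV. \<Sum>b\<in>UNIV. L a b (pd k (pd b (v a l)))) = (\<Sum>a\<in>UNIV. \<Sum>b\<in>UNIV. L a b (pd k (pd a (v b l))))"
    by (rule trans[OF sum.swap]) (intro sum.cong refl Lsym)
  have "av (Suc n) (av (Suc n) (g k l)) x = av n (av n (g k l)) x + (\<Sum>a\<in>UNIV. \<Sum>b\<in>UNIV. L a b (pd a (pd b (v k l))))"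
    using averages_telescope[OF supp_fieldD(1)[OF g], of n k l x] by (simp add: L_def v_def)
  also have "(\<Sum>a\<in>UNIV. \<Sum>b\<in>UNIV. L a b (pd a (pd b (v k l)))) =
      (\<Sum>a\<in>UNIV. \<Sum>b\<in>UNIV. L a b (pd a (pd b (v k l))) - L a b (pd l (pd a (v b k))) - L a b (pd k (pd b (v a l))) + L a b (pd k (pd l (v a b))))
      + ((\<Sum>a\<in>UNIV. \<Sum>b\<in>UNIV. 2 * L a b (pd k (pd a (v b l))) - L a b (pd k (pd l (v a b))))
         + (\<Sum>a\<in>UNIV. \<Sum>b\<in>UNIV. 2 * L a b (pd l (pd a (v b k))) - L a b (pd l (pd k (v a b))))) / 2"
    using sw by (simp add: sum.distrib sum_subtractf sum_distrib_left[symmetric] pd_commute[OF vs, of l k]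
      add_divide_distrib diff_divide_distrib)
  finally show ?case unfolding Suc.IH SS WW R by (simp add: field_simps)
qed

text \<open>The formula for \<open>S\<close> does not show its symmetry in \<open>k\<close> and
  \<open>l\<close>; it is read off from the decomposition, where the other two terms are
  symmetric.\<close>

lemma S_sym: assumes g: "supp_field g" shows "S g N k l = S g N l k"
proof
  fix x
  show "S g N k l x = S g N l k x"
    using averages_decomposition[OF g, of N k l x] averages_decomposition[OF g, of N l k x]
    unfolding supp_fieldD(2)[OF g, of l k] by (metis add.commute add_right_cancel)
qed

text \<open>The error of the squared average is the average of the error of the simple one plus that
  error itself.\<close>

lemma averages_tendsto:
  assumes f: "f \<in> L2" shows "(\<lambda>N. L2norm (\<lambda>x. av N (av N f) x - f x)) \<longlonglongrightarrow> 0"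
proof -
  have aL: "av N h \<in> L2" "L2norm (av N h) \<le> L1norm \<omega> * L2norm h" if "h \<in> L2" for N h
    unfolding av_def by (rule cv_Young[OF \<omega>(1) that]; simp)+
  have lim: "(\<lambda>N. L2norm (\<lambda>x. av N f x - f x)) \<longlonglongrightarrow> 0"
    using cv_tendsto[OF \<omega> f] by (simp add: av_def sc_def)
  have le: "L2norm (\<lambda>x. av N (av N f) x - f x) \<le> (L1norm \<omega> + 1) * L2norm (\<lambda>x. av N f x - f x)" for N
  proof -
    have "(\<lambda>x. av N (av N f) x - av N f x) = av N (\<lambda>x. av N f x - f x)"
      unfolding av_def[of N "av N f"] av_def[of N "\<lambda>x. av N f x - f x"]
      by (subst cv_diff[OF \<omega>(1) aL(1)[OF f] f]) (simp_all add: av_def)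
    then have "L2norm (\<lambda>x. av N (av N f) x - av N f x) \<le> L1norm \<omega> * L2norm (\<lambda>x. av N f x - f x)"
      using aL(2)[OF L2_diff[OF aL(1)[OF f] f]] by simp
    then show ?thesis
      using L2norm_triangle3[OF aL(1)[OF aL(1)[OF f]] aL(1)[OF f] f, of N N N] by (simp add: algebra_simps)
  qed
  show ?thesis
    by (rule tendsto_sandwich[OF _ _ tendsto_const tendsto_mult_right_zero[OF lim, of "L1norm \<omega> + 1"]])
      (use le in auto)
qed

subsection \<open>Estimates\<close>

text \<open>The inner kernel \<open>pd c \<beta>\<close> is handled by
  \<open>square_function\<close>, giving square summable pieces; the outer kernel then sums them by
  \<open>h1seq_series\<close>.\<close>

lemma V_h1seq:
  assumes f: "supp_D f" and M: "L2norm f \<le> M"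
  shows "h1seq U (series_const (\<theta> a b) * sqrt (orth_const c \<beta>) * M) (V a b c f)"
proof -
  have fL: "f \<in> L2" by (rule supp_D_L2[OF f])
  have M0: "0 \<le> M" using M L2norm_nonneg[of f] by linarith
  have z: "cv (pd c \<beta>) (sc n) f x = 0" if "x \<notin> E n" for n x
    using pd_u_zero[OF f that] by (simp add: scaled_pd_u[OF f])
  have "h1seq U (series_const (\<theta> a b) * (sqrt (orth_const c \<beta>) * M)) (\<lambda>N x. \<Sum>n<N. (1/2) ^ n * cv (\<theta> a b) ((1/2) ^ n) (cv (pd c \<beta>) ((1/2) ^ n) f) x)"
  proof (rule h1seq_series[OF \<theta>(1)])
    show "cv (pd c \<beta>) ((1/2) ^ k) f \<in> L2" for k by (rule cv_Young(1)[OF test_pd[OF \<beta>(1)] fL]) simp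
    show "0 \<le> sqrt (orth_const c \<beta>) * M" using M0 by simp
    show "(\<Sum>k<N. (L2norm (cv (pd c \<beta>) ((1/2) ^ k) f))\<^sup>2) \<le> (sqrt (orth_const c \<beta>) * M)\<^sup>2" for N
    proof -
      have "(\<Sum>k<N. (L2norm (cv (pd c \<beta>) ((1/2) ^ k) f))\<^sup>2) \<le> orth_const c \<beta> * (L2norm f)\<^sup>2"
        by (rule square_function[OF \<beta>(1) fL]) simp
      also have "\<dots> \<le> orth_const c \<beta> * M\<^sup>2" by (intro mult_left_mono power_mono M) auto
      finally show ?thesis by (simp add: power_mult_distrib)
    qed
    show "test U (cv (\<theta> a b) ((1/2) ^ k) (cv (pd c \<beta>) ((1/2) ^ k) f))" for k
      unfolding sc_def[symmetric]
      by (rule test_cv_U[OF \<theta>(1) Q(4) cv_Young(1)[OF test_pd[OF \<beta>(1)] fL] z]) simp_all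
  qed
  then show ?thesis unfolding V_def[abs_def] sc_def[symmetric] by (simp add: mult.assoc)
qed

text \<open>The sum is \<open>inc g\<close> tested against \<open>\<Sum>n. 2\<^sup>-\<^sup>n cv \<beta> (- 2\<^sup>-\<^sup>n) (H n)\<close>, whose
  \<open>H\<^sup>1\<close> norm the dual square function estimate bounds by the square root of the same sum.\<close>

lemma inc_square_sum:
  assumes g: "supp_field g" and M0: "0 \<le> M"
    and M: "\<And>\<phi>. test UNIV \<phi> \<Longrightarrow> \<bar>incD g c d \<phi>\<bar> \<le> M * H1norm_test \<phi>"
  shows "(\<Sum>n<N. (L2norm (H g c d n))\<^sup>2) \<le> (series_const \<beta> * M)\<^sup>2"
proof -
  have gL: "g i j \<in> L2" for i j by (intro supp_D_L2 supp_fieldD g)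
  have Ht: "test UNIV (H g c d n)" for n by (rule H_test[OF g])
  have HL: "H g c d n \<in> L2" for n by (rule test_L2[OF Ht])
  define \<psi> where "\<psi> n x = sc n * cv \<beta> (- sc n) (H g c d n) x" for n x
  \<comment> \<open>With the reflected scale the support may leave \<open>U\<close>; pairing with
    \<open>incD\<close> only asks for a test function on the whole space.\<close>
  have cvt: "test UNIV (cv \<beta> (- sc n) f)" if f: "test UNIV f" for n f
  proof -
    obtain K where K: "compact K" "\<And>x. x \<notin> K \<Longrightarrow> f x = 0" using f by (meson test_support)
    have "cv \<beta> (- sc n) f x = 0" if x: "x \<notin> (\<lambda>(y, z). y + (- sc n) *\<^sub>R z) ` (K \<times> Q)" for x
    proof (rule ccontr)
      assume "cv \<beta> (- sc n) f x \<noteq> 0"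
      then obtain z where z: "\<beta> z \<noteq> 0" "f (x - (- sc n) *\<^sub>R z) \<noteq> 0" using cv_support by blast
      then have "x - (- sc n) *\<^sub>R z \<in> K" "z \<in> Q" using K(2) \<beta>(2) by blast+
      then have "(\<lambda>(y, z). y + (- sc n) *\<^sub>R z) (x - (- sc n) *\<^sub>R z, z) \<in> (\<lambda>(y, z). y + (- sc n) *\<^sub>R z) ` (K \<times> Q)" by blast
      with x show False by simp
    qed
    moreover have "compact ((\<lambda>(y, z). y + (- sc n) *\<^sub>R z) ` (K \<times> Q))"
      unfolding case_prod_unfold by (intro compact_continuous_image compact_Times K Q continuous_intros)
    moreover have "smooth (cv \<beta> (- sc n) f)" by (rule smooth_cv[OF \<beta>(1) test_L2[OF f]]) simp
    ultimately show ?thesis unfolding test_iff by blast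
  qed
  have \<psi>t: "test UNIV (\<psi> n)" for n unfolding \<psi>_def[abs_def] by (intro test_cmult cvt Ht)
  \<comment> \<open>One of the two factors \<open>H\<close> is expanded into derivatives of
    \<open>u n\<close>. Integrating by parts twice and passing to the adjoint of
    \<open>\<beta>\<close> moves everything but \<open>g\<close> to the other factor, which becomes
    \<open>\<psi> n\<close>.\<close>
  have key: "(L2norm (H g c d n))\<^sup>2 = incD g c d (\<psi> n)" for n
  proof -
    have one: "integral\<^sup>L lborel (\<lambda>x. pd p (pd l (u n (g m q))) x * H g c d n x)
      = integral\<^sup>L lborel (\<lambda>x. g m q x * pd p (pd l (cv \<beta> (- sc n) (H g c d n))) x)" for p l m q
    proof -
      have "integral\<^sup>L lborel (\<lambda>x. pd p (pd l (u n (g m q))) x * H g c d n x) = ip (u n (g m q)) (pd p (pd l (H g c d n)))"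
        using double_integration_by_parts[OF u_test[OF supp_fieldD(1)[OF g]] test_smooth[OF Ht]] by (simp add: ip_def)
      also have "\<dots> = ip (g m q) (cv \<beta> (- sc n) (pd p (pd l (H g c d n))))"
        unfolding u_def by (rule cv_adjoint[OF \<beta>(1) gL test_L2[OF test_pd[OF test_pd[OF Ht]]]]) simp
      also have "cv \<beta> (- sc n) (pd p (pd l (H g c d n))) = pd p (pd l (cv \<beta> (- sc n) (H g c d n)))"
        by (simp add: pd_cv_smooth \<beta>(1) test_L2[OF test_pd[OF Ht]] HL test_smooth[OF Ht] test_smooth[OF test_pd[OF Ht]])
      finally show ?thesis by (simp add: ip_def)
    qed
    have pint: "integrable lborel (\<lambda>x. pd p (pd l (u n (g m q))) x * H g c d n x)" for p l m q
      by (intro L2_mult_integrable HL test_L2[of UNIV] test_pd u_test supp_fieldD g)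
    have exp: "H g c d n x * z = (\<Sum>p\<in>UNIV. \<Sum>q\<in>UNIV. \<Sum>l\<in>UNIV. \<Sum>m\<in>UNIV.
       sc n * levi c p q * levi d l m * (pd p (pd l (u n (g m q))) x * z))" for x z
      by (simp only: H_def incp_def sum_distrib_left sum_distrib_right mult.assoc)
    have "(L2norm (H g c d n))\<^sup>2 = integral\<^sup>L lborel (\<lambda>x. H g c d n x * H g c d n x)"
      by (simp add: L2norm_power2 ip_def)
    also have "\<dots> = integral\<^sup>L lborel (\<lambda>x. \<Sum>p\<in>UNIV. \<Sum>q\<in>UNIV. \<Sum>l\<in>UNIV. \<Sum>m\<in>UNIV.
       sc n * levi c p q * levi d l m * (pd p (pd l (u n (g m q))) x * H g c d n x))"
      by (simp only: exp)
    also have "\<dots> = (\<Sum>p\<in>UNIV. \<Sum>q\<in>UNIV. \<Sum>l\<in>UNIV. \<Sum>m\<in>UNIV.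
       sc n * levi c p q * levi d l m * integral\<^sup>L lborel (\<lambda>x. pd p (pd l (u n (g m q))) x * H g c d n x))"
      by (simp add: Bochner_Integration.integral_sum integrable_sum pint)
    also have "\<dots> = incD g c d (\<psi> n)"
    proof -
      have ss: "smooth (cv \<beta> (- sc n) (H g c d n))" by (rule test_smooth[OF cvt[OF Ht]])
      have "pd p (pd l (\<psi> n)) = (\<lambda>x. sc n * pd p (pd l (cv \<beta> (- sc n) (H g c d n))) x)" for p l
        unfolding \<psi>_def[abs_def] by (simp add: pd_cmult_smooth ss smooth_pd)
      then show ?thesis unfolding incD_def one
        by (simp add: mult.left_commute[of "g _ _ _" "sc n"]) (simp add: ac_simps)
    qed
    finally show ?thesis .
  qed
  define X where "X = (\<Sum>n<N. (L2norm (H g c d n))\<^sup>2)"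
  have X0: "X \<ge> 0" unfolding X_def by (simp add: sum_nonneg)
  define \<Psi> where "\<Psi> x = (\<Sum>n<N. \<psi> n x)" for x
  have \<Psi>t: "test UNIV \<Psi>" unfolding \<Psi>_def[abs_def] by (rule test_sum[OF \<psi>t])
  have "X = incD g c d \<Psi>"
    unfolding X_def key \<Psi>_def[abs_def] by (rule incD_sum[symmetric, OF gL \<psi>t])
  then have "X \<le> M * H1norm_test \<Psi>"
    using M[OF \<Psi>t] by linarith
  moreover have "H1norm_test \<Psi> \<le> series_const \<beta> * sqrt X"
  proof -
    have "(L2norm \<Psi>)\<^sup>2 \<le> 2 * (L1norm \<beta>)\<^sup>2 * X"
      using weighted_sum_bound[OF \<beta>(1) HL, of "{..<N}" "-1"] by (simp add: \<Psi>_def[abs_def] \<psi>_def sc_def X_def)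
    from real_le_rsqrt[OF this] have 1: "L2norm \<Psi> \<le> sqrt 2 * L1norm \<beta> * sqrt X"
      by (simp add: real_sqrt_mult)
    have 2: "L2norm (pd j \<Psi>) \<le> sqrt (orth_const j \<beta>) * sqrt X" for j
    proof -
      have "pd j (\<psi> n) = (\<lambda>x. - 1 * cv (pd j \<beta>) (- sc n) (H g c d n) x)" for n
        unfolding \<psi>_def[abs_def] using test_smooth[OF cvt[OF Ht]]
        by (simp add: pd_cmult_smooth pd_cv[OF \<beta>(1) HL])
      then have "pd j \<Psi> = (\<lambda>x. -1 * (\<Sum>n<N. cv (pd j \<beta>) (- sc n) (H g c d n) x))"
        unfolding \<Psi>_def[abs_def] by (subst pd_sum_smooth[OF test_smooth[OF \<psi>t]]) (simp add: sum_negf)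
      then have "L2norm (pd j \<Psi>) = L2norm (\<lambda>x. \<Sum>n<N. cv (pd j \<beta>) (- sc n) (H g c d n) x)"
        by (simp only: L2norm_cmult abs_minus_cancel abs_one mult_1)
      moreover have "(L2norm (\<lambda>x. \<Sum>n<N. cv (pd j \<beta>) (- sc n) (H g c d n) x))\<^sup>2 \<le> orth_const j \<beta> * X"
        using dual_square_function[OF \<beta>(1) HL, of "{..<N}" "-1" j] by (simp add: sc_def X_def)
      ultimately show ?thesis using real_le_rsqrt by (metis real_sqrt_mult)
    qed
    have "H1norm_test \<Psi> \<le> sqrt 2 * L1norm \<beta> * sqrt X + (\<Sum>j\<in>UNIV. sqrt (orth_const j \<beta>) * sqrt X)"
      by (rule order_trans[OF H1norm_test_le]) (intro add_mono 1 sum_mono 2)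
    then show ?thesis by (simp add: series_const_def distrib_right sum_distrib_right)
  qed
  ultimately have "X \<le> M * (series_const \<beta> * sqrt X)" by (meson M0 mult_left_mono order_trans)
  then have "X \<le> (series_const \<beta> * M) * sqrt X" by (simp add: ac_simps)
  then show ?thesis using le_sqrt_mult_imp[OF X0] series_const_ge(3)[of \<beta>] M0 by (simp add: X_def)
qed

text \<open>The first summand bounds the squared average at scale 1 in H^1, the second the curvature
  series.\<close>

definition S_const :: "3 \<Rightarrow> 3 \<Rightarrow> real" where
  "S_const k l = (L1norm \<omega> + (\<Sum>c\<in>UNIV. L1norm (pd c \<omega>))) * L1norm \<omega> +
     (\<Sum>a\<in>UNIV. \<Sum>b\<in>UNIV. \<Sum>c\<in>UNIV. \<Sum>d\<in>UNIV. \<bar>levi a k c * levi b l d\<bar> * (series_const (\<theta> a b) * series_const \<beta>))"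

definition W_const :: "3 \<Rightarrow> real" where
  "W_const l = (\<Sum>a\<in>UNIV. \<Sum>b\<in>UNIV. 2 * (series_const (\<theta> a b) * sqrt (orth_const a \<beta>))
     + series_const (\<theta> a b) * sqrt (orth_const l \<beta>))"

lemma W_h1seq:
  assumes g: "supp_field g" and M: "\<And>i j. L2norm (g i j) \<le> M"
  shows "h1seq U (W_const l * M) (\<lambda>N. W g N l)"
proof -
  have V: "h1seq U (series_const (\<theta> a b) * sqrt (orth_const c \<beta>) * M) (V a b c (g i j))" for a b c i j
    by (rule V_h1seq[OF supp_fieldD(1)[OF g] M])
  have "h1seq U (\<Sum>a\<in>UNIV. \<Sum>b\<in>UNIV. \<bar>2\<bar> * (series_const (\<theta> a b) * sqrt (orth_const a \<beta>) * M) + series_const (\<theta> a b) * sqrt (orth_const l \<beta>) * M)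
     (\<lambda>N x. \<Sum>a\<in>UNIV. \<Sum>b\<in>UNIV. 2 * V a b a (g b l) N x - V a b l (g a b) N x)"
    by (intro h1seq_sum h1seq_diff h1seq_cmult V)
  moreover have "(\<Sum>a\<in>UNIV. \<Sum>b\<in>UNIV. \<bar>2\<bar> * (series_const (\<theta> a b) * sqrt (orth_const a \<beta>) * M) + series_const (\<theta> a b) * sqrt (orth_const l \<beta>) * M) = W_const l * M"
    by (simp add: W_const_def sum_distrib_right distrib_right mult.assoc)
  ultimately show ?thesis by (simp add: W_def[abs_def])
qed

lemma S_h1seq:
  assumes g: "supp_field g" and M: "\<And>i j. L2norm (g i j) \<le> M"
    and I: "\<And>c d \<phi>. test UNIV \<phi> \<Longrightarrow> \<bar>incD g c d \<phi>\<bar> \<le> M * H1norm_test \<phi>"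
  shows "h1seq U (S_const k l * M) (\<lambda>N. S g N k l)"
proof -
  have M0: "0 \<le> M" using M[of 1 1] L2norm_nonneg[of "g 1 1"] by linarith
  have fD: "supp_D (g k l)" by (rule supp_fieldD(1)[OF g])
  have fL: "g k l \<in> L2" by (rule supp_D_L2[OF fD])
  have aL: "av 0 (g k l) \<in> L2" "L2norm (av 0 (g k l)) \<le> L1norm \<omega> * M"
    unfolding av_def by (rule cv_Young(1)[OF \<omega>(1) fL], simp)
      (rule order_trans[OF cv_Young(2)[OF \<omega>(1) fL] mult_left_mono[OF M]], simp_all)
  define C0 where "C0 = L1norm \<omega> + (\<Sum>c\<in>UNIV. L1norm (pd c \<omega>))"
  have C0: "L1norm \<omega> \<le> C0" "L1norm (pd c \<omega>) \<le> C0" for c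
  proof -
    have "L1norm (pd c \<omega>) \<le> (\<Sum>c\<in>UNIV. L1norm (pd c \<omega>))" by (rule member_le_sum) auto
    then show "L1norm \<omega> \<le> C0" "L1norm (pd c \<omega>) \<le> C0"
      using L1norm_nonneg[of \<omega>] L1norm_nonneg[of "pd c \<omega>"] unfolding C0_def by linarith+
  qed
  have bnd: "cv K 1 (av 0 (g k l)) \<in> L2 \<and> L2norm (cv K 1 (av 0 (g k l))) \<le> C0 * L1norm \<omega> * M" if K: "test UNIV K" "L1norm K \<le> C0" for K
  proof -
    have "L2norm (cv K 1 (av 0 (g k l))) \<le> L1norm K * L2norm (av 0 (g k l))" by (rule cv_Young(2)[OF K(1) aL(1)]) simp
    also have "\<dots> \<le> C0 * (L1norm \<omega> * M)" by (intro mult_mono K aL) (auto intro: order_trans[OF L1norm_nonneg K(2)])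
    finally show ?thesis using cv_Young(1)[OF K(1) aL(1)] by (simp add: mult.assoc)
  qed
  \<comment> \<open>A constant sequence at scale 1, where differentiation costs nothing: the
    derivative falls on the outer kernel \<open>\<omega>\<close>.\<close>
  have 1: "h1seq U (C0 * L1norm \<omega> * M) (\<lambda>N. av 0 (av 0 (g k l)))"
    unfolding h1seq_def
  proof (intro conjI allI)
    have z: "av 0 (g k l) x = 0" if "x \<notin> E 0" for x
      unfolding av_def by (rule cv_zero_off_E[OF Q(2) fD that])
    show "test U (av 0 (av 0 (g k l)))"
      unfolding av_def[of 0 "av 0 (g k l)"] by (rule test_cv_U[OF \<omega>(1) Q(2) aL(1) z])
    have sc0: "sc 0 = 1" by (simp add: sc_def)
    show "bounded_Cauchy (C0 * L1norm \<omega> * M) (\<lambda>N. av 0 (av 0 (g k l)))"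
      unfolding av_def[of 0 "av 0 (g k l)"] sc0 using bnd[OF \<omega>(1) C0(1)] by (intro bounded_Cauchy_const) auto
    show "bounded_Cauchy (C0 * L1norm \<omega> * M) (\<lambda>N. pd c (av 0 (av 0 (g k l))))" for c
      unfolding av_def[of 0 "av 0 (g k l)"] sc0 using bnd[OF test_pd[OF \<omega>(1)] C0(2), of c]
      by (intro bounded_Cauchy_const) (simp_all add: pd_cv[OF \<omega>(1) aL(1)])
  qed
  have 2: "h1seq U (series_const (\<theta> a b) * (series_const \<beta> * M)) (\<lambda>N x. \<Sum>n<N. sc n * cv (\<theta> a b) (sc n) (H g c d n) x)" for a b c d
    unfolding sc_def
  proof (rule h1seq_series[OF \<theta>(1)])
    show "H g c d k \<in> L2" for k by (rule test_L2[OF H_test[OF g]])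
    show "(\<Sum>k<N. (L2norm (H g c d k))\<^sup>2) \<le> (series_const \<beta> * M)\<^sup>2" for N
      by (rule inc_square_sum[OF g M0 I])
    show "test U (cv (\<theta> a b) ((1/2) ^ n) (H g c d n))" for n
      unfolding sc_def[symmetric]
      by (rule test_cv_U[OF \<theta>(1) _ test_L2[OF H_test[OF g]]]) (auto intro: Q(4) H_zero[OF g])
    show "0 \<le> series_const \<beta> * M" using M0 series_const_ge(3) by simp
  qed
  have "h1seq U (C0 * L1norm \<omega> * M + (\<Sum>a\<in>UNIV. \<Sum>b\<in>UNIV. \<Sum>c\<in>UNIV. \<Sum>d\<in>UNIV. \<bar>levi a k c * levi b l d\<bar> * (series_const (\<theta> a b) * (series_const \<beta> * M))))
    (\<lambda>N x. av 0 (av 0 (g k l)) x + (\<Sum>a\<in>UNIV. \<Sum>b\<in>UNIV. \<Sum>c\<in>UNIV. \<Sum>d\<in>UNIV.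
     levi a k c * levi b l d * (\<Sum>n<N. sc n * cv (\<theta> a b) (sc n) (H g c d n) x)))"
    by (intro h1seq_add h1seq_sum h1seq_cmult 1 2)
  moreover have "C0 * L1norm \<omega> * M + (\<Sum>a\<in>UNIV. \<Sum>b\<in>UNIV. \<Sum>c\<in>UNIV. \<Sum>d\<in>UNIV. \<bar>levi a k c * levi b l d\<bar> * (series_const (\<theta> a b) * (series_const \<beta> * M))) = S_const k l * M"
    by (simp add: S_const_def C0_def sum_distrib_right distrib_right mult.assoc)
  ultimately show ?thesis by (simp add: S_def[abs_def])
qed

subsection \<open>Linearity\<close>

lemma cv_linear:
  assumes "test UNIV K" "f \<in> L2" "h \<in> L2" "s \<noteq> 0"
  shows "cv K s (\<lambda>x. p * f x + r * h x) = (\<lambda>x. p * cv K s f x + r * cv K s h x)"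
  using assms by (simp add: cv_add[OF assms(1) L2_cmult L2_cmult] cv_cmult)

lemma V_linear:
  assumes "supp_D f" "supp_D h"
  shows "V a b c (\<lambda>x. p * f x + r * h x) N x = p * V a b c f N x + r * V a b c h N x"
proof -
  have L: "cv (pd c \<beta>) (sc n) f \<in> L2" "cv (pd c \<beta>) (sc n) h \<in> L2" for n
    by (intro cv_Young(1) test_pd \<beta> supp_D_L2 assms; simp)+
  show ?thesis
    by (simp add: V_def cv_linear[OF test_pd[OF \<beta>(1)] supp_D_L2[OF assms(1)] supp_D_L2[OF assms(2)]]
      cv_linear[OF \<theta>(1) L] sum.distrib sum_distrib_left algebra_simps)
qed

lemma W_linear:
  assumes "supp_field g" "supp_field h"
  shows "W (\<lambda>i j x. p * g i j x + r * h i j x) N l x = p * W g N l x + r * W h N l x"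
  unfolding W_def V_linear[OF supp_fieldD(1)[OF assms(1)] supp_fieldD(1)[OF assms(2)]]
  by (simp add: sum_distrib_left sum.distrib[symmetric] algebra_simps)

lemma H_linear:
  assumes "supp_field g" "supp_field h"
  shows "H (\<lambda>i j x. p * g i j x + r * h i j x) c d n = (\<lambda>x. p * H g c d n x + r * H h c d n x)"
proof -
  have us: "smooth (u n (g i j))" "smooth (u n (h i j))" for i j
    by (intro test_smooth[of UNIV] u_test supp_fieldD assms)+
  have "u n (\<lambda>x. p * g i j x + r * h i j x) = (\<lambda>x. p * u n (g i j) x + r * u n (h i j) x)" for i j
    unfolding u_def by (intro cv_linear \<beta> supp_D_L2 supp_fieldD assms) simp
  then have "pd a (pd b (u n (\<lambda>x. p * g i j x + r * h i j x))) = (\<lambda>x. p * pd a (pd b (u n (g i j))) x + r * pd a (pd b (u n (h i j))) x)" for a b i j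
    using us by (simp add: pd_add_smooth pd_cmult_smooth smooth_cmult smooth_pd)
  then show ?thesis
    by (simp add: H_def[abs_def] incp_def sum_distrib_left sum.distrib[symmetric] algebra_simps)
qed

lemma S_linear:
  assumes "supp_field g" "supp_field h"
  shows "S (\<lambda>i j x. p * g i j x + r * h i j x) N k l x = p * S g N k l x + r * S h N k l x"
proof -
  have L: "g k l \<in> L2" "h k l \<in> L2" by (intro supp_D_L2 supp_fieldD assms)+
  have aL: "av 0 (g k l) \<in> L2" "av 0 (h k l) \<in> L2" unfolding av_def by (intro cv_Young(1) \<omega> L; simp)+
  have 1: "av 0 (av 0 (\<lambda>x. p * g k l x + r * h k l x)) x = p * av 0 (av 0 (g k l)) x + r * av 0 (av 0 (h k l)) x"
    using cv_linear[OF \<omega>(1) L, of "sc 0" p r] cv_linear[OF \<omega>(1) aL, of "sc 0" p r] by (simp add: av_def)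
  have 2: "cv (\<theta> a b) (sc n) (H (\<lambda>i j x. p * g i j x + r * h i j x) c d n) x
     = p * cv (\<theta> a b) (sc n) (H g c d n) x + r * cv (\<theta> a b) (sc n) (H h c d n) x" for a b c d n
    unfolding H_linear[OF assms]
    by (subst cv_linear[OF \<theta>(1) test_L2[OF H_test] test_L2[OF H_test]]) (use assms in simp_all)
  show ?thesis unfolding S_def 1 2
    by (simp add: sum_distrib_left sum.distrib[symmetric] distrib_left ac_simps)
qed

end


section \<open>Kernels in a cone whose dyadic difference is a double divergence\<close>

section \<open>Construction of the kernels\<close>

lemma smooth_step:
  obtains s q where "smooth1 s" "smooth1 q" "\<And>x. (s has_real_derivative q x) (at x)" "\<And>x. 0 \<le> q x"
    "\<And>x. x \<le> 1/2 \<Longrightarrow> q x = 0" "\<And>x. 1 \<le> x \<Longrightarrow> q x = 0" "0 < q (3/4)"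
    "\<And>x. x \<le> 1/2 \<Longrightarrow> s x = 0" "\<And>x. 1 \<le> x \<Longrightarrow> s x = 1"
proof -
  define e where "e x = (if x \<le> 0 then 0 else exp (- (1 / x)))" for x :: real
  have e: "smooth1 e" unfolding e_def[abs_def] by (rule smooth1_flat_exp)
  define q0 where "q0 x = e (-1/2 + 1 * x) * e (1 + (-1) * x)" for x
  have q0: "smooth1 q0" unfolding q0_def[abs_def] by (intro smooth1_mult smooth1_affine e)
  have q0_nn: "0 \<le> q0 x" for x by (simp add: q0_def e_def)
  have q0_pos: "0 < q0 x" if "1/2 < x" "x < 1" for x using that by (simp add: q0_def e_def)
  have q0_zero: "q0 x = 0" if "x \<le> 1/2 \<or> 1 \<le> x" for x using that by (auto simp: q0_def e_def)
  \<comment> \<open>The antiderivative is produced on a compact interval only, taken larger than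
    [0,2] so that \<open>G\<close> is differentiable throughout (0,2).\<close>
  have "continuous_on {-1..3} q0" using smooth1_isCont[OF q0] by (intro continuous_at_imp_continuous_on) auto
  then obtain G where G0: "\<And>x. x \<in> {-1..3} \<Longrightarrow> (G has_vector_derivative q0 x) (at x within {-1..3})"
    by (rule antiderivative_continuous) auto
  have G: "(G has_real_derivative q0 x) (at x)" if "-1 < x" "x < 3" for x
    using G0[of x] that at_within_interior[of x "{-1..3::real}"]
    by (simp add: has_real_derivative_iff_has_vector_derivative)
  have Gc: "continuous_on {a..b} G" if "-1 < a" "b < 3" for a b
    using DERIV_isCont[OF G] that by (intro continuous_at_imp_continuous_on ballI) auto
  have Gl: "G x = G (1/2)" if "-1 < x" "x \<le> 1/2" for x
  proof (cases "x = 1/2")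
    case False
    then have "G (1/2) = G x"
      using that by (intro DERIV_isconst_end Gc) (auto intro!: G[THEN DERIV_cong] simp: q0_zero)
    then show ?thesis by simp
  next
    case True
    then show ?thesis by (simp only: True)
  qed
  have Gr: "G x = G 1" if "1 \<le> x" "x < 3" for x
  proof (cases "x = 1")
    case False
    then show ?thesis
      using that by (intro DERIV_isconst_end Gc) (auto intro!: G[THEN DERIV_cong] simp: q0_zero)
  qed simp
  define I where "I = G 1 - G (1/2)"
  have "G (1/2) < G 1"
  proof (rule DERIV_pos_imp_increasing_open[where f = G])
    show "\<exists>y. (G has_real_derivative y) (at x) \<and> 0 < y" if "1/2 < x" "x < 1" for x
      using G[of x] q0_pos[OF that] that by auto
    show "continuous_on {1/2..1} G" by (rule Gc) auto
  qed simp
  then have I: "I > 0" by (simp add: I_def)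
  \<comment> \<open>Outside (0,2) the normalised antiderivative is replaced by its constant values;
    it is already constant on (0,1/2] and [1,2), so the pieces overlap and glue smoothly.\<close>
  define s where "s x = (if x \<le> 0 then 0 else if x \<ge> 2 then 1 else (G x - G (1/2)) / I)" for x
  define q where "q x = (1 / I) * q0 x" for x
  have s0: "s x = 0" if "x \<le> 1/2" for x using that Gl[of x] by (cases "x \<le> 0") (simp_all add: s_def)
  have s1: "s x = 1" if "1 \<le> x" for x using that Gr[of x] I by (cases "x \<ge> 2") (simp_all add: s_def I_def)
  have D: "(s has_real_derivative q x) (at x)" for x
  proof -
    consider "x < 1/2" | "0 < x" "x < 2" | "1 < x" by linarith
    then show ?thesis
    proof cases
      case 1
      have "((\<lambda>x. 0) has_real_derivative q x) (at x)" using 1 by (simp add: q_def q0_zero)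
      then show ?thesis
        by (rule has_field_derivative_transform_within_open[where S = "{..<1/2}"])
          (use 1 s0 in auto)
    next
      case 2
      have "((\<lambda>x. (G x - G (1/2)) / I) has_real_derivative q x) (at x)"
        using 2 I by (auto intro!: derivative_eq_intros G simp: q_def)
      then show ?thesis
        by (rule has_field_derivative_transform_within_open[where S = "{0<..<2}"]) (use 2 in \<open>auto simp: s_def\<close>)
    next
      case 3
      have "((\<lambda>x. 1) has_real_derivative q x) (at x)" using 3 by (simp add: q_def q0_zero)
      then show ?thesis
        by (rule has_field_derivative_transform_within_open[where S = "{1<..}"])
          (use 3 s1 in auto)
    qed
  qed
  have q: "smooth1 q" unfolding q_def[abs_def] by (rule smooth1_cmult[OF q0])
  show thesis
  proof (rule that[of s q])
    show "smooth1 s" by (rule smooth1_derivI[OF q D])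
  qed (use q D s0 s1 q0_nn q0_zero q0_pos[of "3/4"] I in \<open>auto simp: q_def\<close>)
qed

lemma ridge_has_derivative:
  fixes w :: "real^3"
  assumes "\<And>t. (f has_real_derivative f' t) (at t)"
  shows "((\<lambda>x. f (w \<bullet> x)) has_derivative (\<lambda>h. (w \<bullet> h) * f' (w \<bullet> x))) (at x)"
proof -
  have "((\<lambda>x. w \<bullet> x) has_derivative (\<lambda>h. w \<bullet> h)) (at x)" by (auto intro!: derivative_eq_intros)
  from has_derivative_compose[OF this assms[unfolded has_field_derivative_def]]
  show ?thesis by (simp add: mult.commute)
qed

lemma smooth_ridge:
  fixes w :: "real^3"
  assumes "smooth1 f" shows "smooth (\<lambda>x. f (w \<bullet> x))"
proof (rule smooth_coinduct[where X = "\<lambda>g. \<exists>f. smooth1 f \<and> g = (\<lambda>x. f (w \<bullet> x))"])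
  show "\<exists>f'. smooth1 f' \<and> (\<lambda>x. f (w \<bullet> x)) = (\<lambda>x. f' (w \<bullet> x))" using assms by blast
next
  fix g assume "\<exists>f. smooth1 f \<and> g = (\<lambda>x. f (w \<bullet> x))"
  then obtain f where f: "smooth1 f" and g: "g = (\<lambda>x. f (w \<bullet> x))" by blast
  obtain f' where f': "smooth1 f'" "\<And>x. (f has_real_derivative f' x) (at x)" using smooth1_deriv[OF f] by blast
  note d = ridge_has_derivative[OF f'(2)]
  have "pd i g = (\<lambda>x. (w \<bullet> axis i 1) * f' (w \<bullet> x))" for i
    unfolding g by (rule ext) (rule pd_eqI[OF d])
  then show "(\<forall>x. g differentiable (at x)) \<and> (\<forall>i. \<exists>f. smooth1 f \<and> pd i g = (\<lambda>x. f (w \<bullet> x)))"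
    using d smooth1_cmult[OF f'(1)] unfolding g by (fastforce simp: differentiable_def)
qed

lemma pd_ridge:
  fixes w :: "real^3"
  assumes "\<And>x. (f has_real_derivative f' x) (at x)"
  shows "pd i (\<lambda>x. f (w \<bullet> x)) = (\<lambda>x. w $ i * f' (w \<bullet> x))"
  by (rule ext, subst pd_eqI[OF ridge_has_derivative[OF assms]]) (simp add: inner_axis)

definition dird :: "real^3 \<Rightarrow> sfield \<Rightarrow> sfield" where
  "dird v f x = (\<Sum>a\<in>UNIV. v $ a * pd a f x)"

text \<open>A tensor product in the skew coordinates given by \<open>w\<close>. When
  \<open>v\<close> is the dual basis, differentiating along \<open>v i\<close> acts on the factor
  \<open>i\<close> alone, so one-variable identities carry over.\<close>

definition ridge3 :: "(3 \<Rightarrow> real^3) \<Rightarrow> (real \<Rightarrow> real) \<Rightarrow> (real \<Rightarrow> real) \<Rightarrow> (real \<Rightarrow> real) \<Rightarrow> sfield" where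
  "ridge3 w f g h x = f (w 1 \<bullet> x) * (g (w 2 \<bullet> x) * h (w 3 \<bullet> x))"

lemma smooth_ridge3: "smooth1 f \<Longrightarrow> smooth1 g \<Longrightarrow> smooth1 h \<Longrightarrow> smooth (ridge3 w f g h)"
  unfolding ridge3_def[abs_def] by (intro smooth_mult smooth_ridge)

lemma dird_ridge3:
  fixes w v :: "3 \<Rightarrow> real^3"
  assumes dual: "\<And>i j. w i \<bullet> v j = (if i = j then 1 else 0)"
    and f: "smooth1 f" "\<And>x. (f has_real_derivative f' x) (at x)"
    and g: "smooth1 g" "\<And>x. (g has_real_derivative g' x) (at x)"
    and h: "smooth1 h" "\<And>x. (h has_real_derivative h' x) (at x)"
  shows "dird (v 1) (ridge3 w f g h) = ridge3 w f' g h"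
    and "dird (v 2) (ridge3 w f g h) = ridge3 w f g' h"
    and "dird (v 3) (ridge3 w f g h) = ridge3 w f g h'"
proof -
  have gen: "dird (v i) (ridge3 w f g h) x = (w 1 \<bullet> v i) * ridge3 w f' g h x + (w 2 \<bullet> v i) * ridge3 w f g' h x + (w 3 \<bullet> v i) * ridge3 w f g h' x" for i x
  proof -
    have "pd a (ridge3 w f g h) x = w 1 $ a * ridge3 w f' g h x + w 2 $ a * ridge3 w f g' h x + w 3 $ a * ridge3 w f g h' x" for a
      unfolding ridge3_def[abs_def]
        pd_mult_smooth[OF smooth_ridge[OF f(1)] smooth_mult[OF smooth_ridge[OF g(1)] smooth_ridge[OF h(1)]]]
        pd_mult_smooth[OF smooth_ridge[OF g(1)] smooth_ridge[OF h(1)]]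
        pd_ridge[OF f(2)] pd_ridge[OF g(2)] pd_ridge[OF h(2)]
      by (simp add: algebra_simps)
    then show ?thesis by (simp add: dird_def inner_vec_def sum_3 algebra_simps)
  qed
  show "dird (v 1) (ridge3 w f g h) = ridge3 w f' g h" "dird (v 2) (ridge3 w f g h) = ridge3 w f g' h"
    "dird (v 3) (ridge3 w f g h) = ridge3 w f g h'"
    using gen by (auto simp: dual fun_eq_iff)
qed

lemma integral_dird_zero:
  assumes "test U f" shows "integral\<^sup>L lborel (dird v f) = 0"
proof -
  have "integral\<^sup>L lborel (dird v f) = (\<Sum>a\<in>UNIV. v $ a * integral\<^sup>L lborel (pd a f))"
    unfolding dird_def[abs_def]
    by (subst Bochner_Integration.integral_sum) (simp_all add: test_integrable[OF test_pd[OF assms]])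
  then show ?thesis by (simp add: integral_pd_zero[OF assms])
qed

lemma integral_pos_continuous:
  fixes f :: sfield
  assumes "integrable lborel f" "continuous_on UNIV f" "\<And>x. 0 \<le> f x" "0 < f x0"
  shows "0 < integral\<^sup>L lborel f"
proof (rule ccontr)
  assume "\<not> ?thesis"
  moreover have "0 \<le> integral\<^sup>L lborel f" using assms(3) by simp
  ultimately have "integral\<^sup>L lborel f = 0" by simp
  then have "AE x in lborel. f x = 0"
    using integral_nonneg_eq_0_iff_AE[OF assms(1)] assms(3) by simp
  moreover have op: "open {x. f x \<noteq> 0}" using open_Collect_neq[OF assms(2) continuous_on_const] .
  ultimately have n: "{x. f x \<noteq> 0} \<in> null_sets lborel" using AE_iff_null[of lborel "\<lambda>x. f x = 0"] by simp
  have "x0 \<in> {x. f x \<noteq> 0}" using assms(4) by simp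
  then have "{x. f x \<noteq> 0} \<noteq> {}" by blast
  moreover have "negligible {x. f x \<noteq> 0}"
    using n by (simp add: negligible_iff_null_sets null_sets_completionI)
  ultimately show False using open_not_negligible[OF op] by blast
qed

text \<open>The contracted kernel minus the original is a difference of two triple products.
  Exchanging one factor at a time writes it as three products, each containing one factor
  \<open>b''\<close> and hence a second derivative along one \<open>v i\<close>. The bound 1/4 is
  where the contracted profile and \<open>b\<close> begin, since \<open>p\<close> lives on
  [1/2,1].\<close>

lemma kernels_exist:
  fixes w v :: "3 \<Rightarrow> real^3"
  assumes dual: "\<And>i j. w i \<bullet> v j = (if i = j then 1 else 0)"
    and bdd: "bounded {x. \<forall>i. 1/4 \<le> w i \<bullet> x \<and> w i \<bullet> x \<le> 1}"
  obtains \<omega> :: sfield and \<theta> :: "3 \<Rightarrow> 3 \<Rightarrow> sfield" where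
    "test UNIV \<omega>" "integral\<^sup>L lborel \<omega> = 1" "\<And>a b. test UNIV (\<theta> a b)" "\<And>a b. \<theta> a b = \<theta> b a"
    "\<And>x. 8 * \<omega> (2 *\<^sub>R x) - \<omega> x = (\<Sum>a\<in>UNIV. \<Sum>b\<in>UNIV. pd a (pd b (\<theta> a b)) x)"
    "\<And>x. \<omega> x \<noteq> 0 \<Longrightarrow> \<forall>i. 1/4 \<le> w i \<bullet> x \<and> w i \<bullet> x \<le> 1"
    "\<And>x. \<omega> (2 *\<^sub>R x) \<noteq> 0 \<Longrightarrow> \<forall>i. 1/4 \<le> w i \<bullet> x \<and> w i \<bullet> x \<le> 1"
    "\<And>a b x. \<theta> a b x \<noteq> 0 \<Longrightarrow> \<forall>i. 1/4 \<le> w i \<bullet> x \<and> w i \<bullet> x \<le> 1"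
proof -
  define Q where "Q = {x. \<forall>i. 1/4 \<le> w i \<bullet> x \<and> w i \<bullet> x \<le> 1}"
  have Qc: "compact Q"
  proof -
    have "closed Q" unfolding Q_def
      by (intro closed_Collect_all closed_Collect_conj closed_Collect_le continuous_intros)
    then show ?thesis using bdd by (simp add: compact_eq_bounded_closed Q_def)
  qed
  obtain s q where s: "smooth1 s" and q: "smooth1 q" and sq: "\<And>x. (s has_real_derivative q x) (at x)" and q0: "\<And>x. 0 \<le> q x"
    and qz: "\<And>x. x \<le> 1/2 \<Longrightarrow> q x = 0" "\<And>x. 1 \<le> x \<Longrightarrow> q x = 0" and qp: "0 < q (3/4)"
    and sz: "\<And>x. x \<le> 1/2 \<Longrightarrow> s x = 0" "\<And>x. 1 \<le> x \<Longrightarrow> s x = 1"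
    using smooth_step by blast
  obtain q' where q': "smooth1 q'" "\<And>x. (q has_real_derivative q' x) (at x)" using smooth1_deriv[OF q] by blast
  have q'z: "q' x = 0" if "x < 1/2 \<or> 1 < x" for x
  proof -
    consider "x < 1/2" | "1 < x" using \<open>x < 1/2 \<or> 1 < x\<close> by blast
    then have "(q has_real_derivative 0) (at x)"
    proof cases
      case 1
      then show ?thesis
        by (intro has_field_derivative_transform_within_open[OF DERIV_const[where k = 0], where S = "{..<1/2}"])
          (use qz in auto)
    next
      case 2
      then show ?thesis
        by (intro has_field_derivative_transform_within_open[OF DERIV_const[where k = 0], where S = "{1<..}"])
          (use qz in auto)
    qed
    then show ?thesis using q'(2) DERIV_unique by blast
  qed
  \<comment> \<open>With \<open>A x = x * s x\<close> we have \<open>p = A''\<close> and \<open>b x = A (2 * x) / 2 - A x\<close>, hence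
    \<open>b'' x = 2 * p (2 * x) - p x\<close>; \<open>b\<close> has compact support because \<open>A x = x\<close> for \<open>x \<ge> 1\<close>.
    Since \<open>p = q + r'\<close>, the products of \<open>p\<close> and of \<open>q\<close> have the same integral.\<close>
  define p where "p x = 2 * q x + x * q' x" for x
  define r where "r x = x * q x" for x
  define r' where "r' x = q x + x * q' x" for x
  define p2 where "p2 x = 2 * p (2 * x)" for x
  define b where "b x = x * s (2 * x) + (-1) * (x * s x)" for x
  define b' where "b' x = (s (2 * x) + 2 * (x * q (2 * x))) + (-1) * (s x + x * q x)" for x
  define b'' where "b'' x = p2 x + (-1) * p x" for x
  have aff2: "smooth1 (\<lambda>x. f (2 * x))" if "smooth1 f" for f using smooth1_affine[OF that, of 0 2] by simp
  have p: "smooth1 p" unfolding p_def[abs_def] by (intro smooth1_add smooth1_cmult smooth1_mult q q' smooth1_ident)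
  have r: "smooth1 r" unfolding r_def[abs_def] by (intro smooth1_mult q smooth1_ident)
  have p2: "smooth1 p2" unfolding p2_def[abs_def] by (intro smooth1_cmult aff2 p)
  have b: "smooth1 b" unfolding b_def[abs_def] by (intro smooth1_add smooth1_cmult smooth1_mult aff2 s smooth1_ident)
  have b': "smooth1 b'" unfolding b'_def[abs_def] by (intro smooth1_add smooth1_cmult smooth1_mult aff2 s q smooth1_ident)
  have rD: "(r has_real_derivative r' x) (at x)" for x
    unfolding r_def[abs_def] r'_def using q'(2)[of x] by (auto intro!: derivative_eq_intros)
  have chain2: "((\<lambda>x. f (2 * x)) has_real_derivative 2 * f' (2 * x)) (at x)"
    if "\<And>x. (f has_real_derivative f' x) (at x)" for f f' :: "real \<Rightarrow> real" and x
  proof -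
    have "((\<lambda>x. 2 * x) has_real_derivative 2) (at x)" by (auto intro!: derivative_eq_intros)
    from DERIV_chain2[OF that this] show ?thesis by (simp add: mult.commute)
  qed
  have bD: "(b has_real_derivative b' x) (at x)" for x
    unfolding b_def[abs_def] b'_def using sq[of x] chain2[OF sq, of x]
    by (auto intro!: derivative_eq_intros simp: algebra_simps)
  have b'D: "(b' has_real_derivative b'' x) (at x)" for x
    unfolding b'_def[abs_def] b''_def p2_def p_def using sq[of x] chain2[OF sq, of x] q'(2)[of x] chain2[OF q'(2), of x]
    by (auto intro!: derivative_eq_intros simp: algebra_simps)
  have b'': "smooth1 b''" by (rule smooth1_DERIV[OF b' b'D])
  have r': "smooth1 r'" by (rule smooth1_DERIV[OF r rD])
  have supp: "q x \<noteq> 0 \<Longrightarrow> 1/4 \<le> x \<and> x \<le> 1" "p x \<noteq> 0 \<Longrightarrow> 1/2 \<le> x \<and> x \<le> 1" "r x \<noteq> 0 \<Longrightarrow> 1/4 \<le> x \<and> x \<le> 1"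
    "p2 x \<noteq> 0 \<Longrightarrow> 1/4 \<le> x \<and> x \<le> 1" "b x \<noteq> 0 \<Longrightarrow> 1/4 \<le> x \<and> x \<le> 1" for x
  proof -
    show pp: "p x \<noteq> 0 \<Longrightarrow> 1/2 \<le> x \<and> x \<le> 1" for x
      using q'z[of x] qz[of x] by (auto simp: p_def not_le intro: ccontr)
    show "q x \<noteq> 0 \<Longrightarrow> 1/4 \<le> x \<and> x \<le> 1" "r x \<noteq> 0 \<Longrightarrow> 1/4 \<le> x \<and> x \<le> 1"
      using qz[of x] by (auto simp: r_def intro: ccontr)
    show "p2 x \<noteq> 0 \<Longrightarrow> 1/4 \<le> x \<and> x \<le> 1" using pp[of "2 * x"] by (auto simp: p2_def)
    show "b x \<noteq> 0 \<Longrightarrow> 1/4 \<le> x \<and> x \<le> 1" using sz(1)[of x] sz(1)[of "2 * x"] sz(2)[of x] sz(2)[of "2 * x"]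
      by (rule_tac ccontr) (auto simp: b_def not_le)
  qed
  have supp': "p x \<noteq> 0 \<Longrightarrow> 1/4 \<le> x \<and> x \<le> 1" for x using supp(2)[of x] by auto
  have inQ: "x \<in> Q" if nz: "ridge3 w f g h x \<noteq> 0"
    and "\<And>x. f x \<noteq> 0 \<Longrightarrow> 1/4 \<le> x \<and> x \<le> 1" "\<And>x. g x \<noteq> 0 \<Longrightarrow> 1/4 \<le> x \<and> x \<le> 1" "\<And>x. h x \<noteq> 0 \<Longrightarrow> 1/4 \<le> x \<and> x \<le> 1"
    for f g h x
  proof -
    have "f (w 1 \<bullet> x) \<noteq> 0" "g (w 2 \<bullet> x) \<noteq> 0" "h (w 3 \<bullet> x) \<noteq> 0" using nz by (auto simp: ridge3_def)
    then show ?thesis using that(2-4) unfolding Q_def forall_3 by blast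
  qed
  have tst: "test UNIV (ridge3 w f g h)" if "smooth1 f" "smooth1 g" "smooth1 h"
    and "\<And>x. f x \<noteq> 0 \<Longrightarrow> 1/4 \<le> x \<and> x \<le> 1" "\<And>x. g x \<noteq> 0 \<Longrightarrow> 1/4 \<le> x \<and> x \<le> 1" "\<And>x. h x \<noteq> 0 \<Longrightarrow> 1/4 \<le> x \<and> x \<le> 1"
    for f g h
    unfolding test_iff
  proof (intro conjI exI[of _ Q] allI impI)
    show "ridge3 w f g h x = 0" if "x \<notin> Q" for x using inQ[OF _ \<open>\<And>x. f x \<noteq> 0 \<Longrightarrow> 1/4 \<le> x \<and> x \<le> 1\<close> \<open>\<And>x. g x \<noteq> 0 \<Longrightarrow> 1/4 \<le> x \<and> x \<le> 1\<close> \<open>\<And>x. h x \<noteq> 0 \<Longrightarrow> 1/4 \<le> x \<and> x \<le> 1\<close>] that by blast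
  qed (use Qc smooth_ridge3 that in auto)
  define I where "I = integral\<^sup>L lborel (ridge3 w q q q)"
  have tq: "test UNIV (ridge3 w q q q)" by (intro tst q supp)
  have I: "I > 0" unfolding I_def
  proof (rule integral_pos_continuous[OF test_integrable[OF tq] smooth_continuous[OF test_smooth[OF tq]]])
    show "0 \<le> ridge3 w q q q x" for x by (simp add: ridge3_def q0)
    \<comment> \<open>By duality this is the point whose skew coordinates are all 3/4, where
      \<open>q\<close> is positive.\<close>
    have 34: "w i \<bullet> (\<Sum>j\<in>UNIV. (3/4) *\<^sub>R v j) = 3/4" for i
      by (simp add: inner_sum_right dual if_distrib cong: if_cong)
    show "0 < ridge3 w q q q (\<Sum>j\<in>UNIV. (3/4) *\<^sub>R v j)"
      unfolding ridge3_def 34 using qp by (intro mult_pos_pos)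
  qed
  have Ip: "integral\<^sup>L lborel (ridge3 w p p p) = I"
  proof -
    have t1: "test UNIV (ridge3 w r p p)" "test UNIV (ridge3 w q r p)" "test UNIV (ridge3 w q q r)"
      by (intro tst q r p supp supp'; assumption)+
    obtain p' where p': "\<And>x. (p has_real_derivative p' x) (at x)" using smooth1_deriv[OF p] by blast
    have d: "dird (v 1) (ridge3 w r p p) = ridge3 w r' p p" "dird (v 2) (ridge3 w q r p) = ridge3 w q r' p"
      "dird (v 3) (ridge3 w q q r) = ridge3 w q q r'"
      by (rule dird_ridge3(1)[OF dual r rD p p' p p'] dird_ridge3(2)[OF dual q q'(2) r rD p p']
          dird_ridge3(3)[OF dual q q'(2) q q'(2) r rD])+
    have int: "integrable lborel (dird a f)" if "test UNIV f" for a f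
      unfolding dird_def[abs_def] by (intro Bochner_Integration.integrable_sum integrable_mult_right test_integrable[OF test_pd[OF that]])
    \<comment> \<open>The factors \<open>p\<close> are exchanged for \<open>q\<close> one after the
      other; every exchange leaves a directional derivative, which integrates to zero.\<close>
    have "ridge3 w p p p = (\<lambda>x. ridge3 w q q q x + (dird (v 1) (ridge3 w r p p) x + (dird (v 2) (ridge3 w q r p) x + dird (v 3) (ridge3 w q q r) x)))"
      unfolding d by (rule ext) (simp add: ridge3_def p_def r'_def algebra_simps)
    then have "integral\<^sup>L lborel (ridge3 w p p p) = I + (integral\<^sup>L lborel (dird (v 1) (ridge3 w r p p)) + (integral\<^sup>L lborel (dird (v 2) (ridge3 w q r p)) + integral\<^sup>L lborel (dird (v 3) (ridge3 w q q r))))"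
      by (simp add: I_def int[OF t1(1)] int[OF t1(2)] int[OF t1(3)] test_integrable[OF tq])
    then show ?thesis using integral_dird_zero[OF t1(1)] integral_dird_zero[OF t1(2)] integral_dird_zero[OF t1(3)] by simp
  qed
  define \<omega> where "\<omega> x = (1 / I) * ridge3 w p p p x" for x
  \<comment> \<open>Index 1 still has two contracted factors, index 2 one, index 3 none: the order
    in which \<open>p2\<close> is exchanged for \<open>p\<close>.\<close>
  define \<tau> where "\<tau> i x = (1 / I) * (if i = (1::3) then ridge3 w b p2 p2 x else if i = 2 then ridge3 w p b p2 x else ridge3 w p p b x)" for i x
  \<comment> \<open>The second derivative along \<open>v i\<close> has the coefficient matrix
    \<open>v i\<close> tensor \<open>v i\<close>, which makes the resulting matrix of kernels
    symmetric.\<close>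
  define \<theta> where "\<theta> c d x = (\<Sum>i\<in>UNIV. (v i $ c * v i $ d) * \<tau> i x)" for c d x
  have \<tau>t: "test UNIV (\<tau> i)" for i
  proof -
    have "test UNIV (ridge3 w b p2 p2)" "test UNIV (ridge3 w p b p2)" "test UNIV (ridge3 w p p b)"
      by (intro tst p p2 b supp supp'; assumption)+
    from this[THEN test_cmult, of "1 / I"] show ?thesis
      unfolding \<tau>_def[abs_def] by (cases "i = 1"; cases "i = 2") simp_all
  qed
  have \<tau>Q: "x \<in> Q" if nz: "\<tau> i x \<noteq> 0" for i x
  proof -
    consider "ridge3 w b p2 p2 x \<noteq> 0" | "ridge3 w p b p2 x \<noteq> 0" | "ridge3 w p p b x \<noteq> 0"
      using nz unfolding \<tau>_def by (cases "i = 1"; cases "i = 2") simp_all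
    then show ?thesis
      by cases (erule inQ; fact supp supp')+
  qed
  have \<omega>t: "test UNIV \<omega>" unfolding \<omega>_def[abs_def] by (intro test_cmult tst p supp'; assumption)
  show thesis
  proof (rule that[of \<omega> \<theta>])
    show "test UNIV \<omega>" by (rule \<omega>t)
    show "integral\<^sup>L lborel \<omega> = 1" using Ip I by (simp add: \<omega>_def[abs_def])
    show "test UNIV (\<theta> c d)" for c d unfolding \<theta>_def[abs_def] by (intro test_sum test_cmult \<tau>t)
    show "\<theta> c d = \<theta> d c" for c d by (simp add: \<theta>_def[abs_def] mult.commute[of "v _ $ c"])
    show "8 * \<omega> (2 *\<^sub>R x) - \<omega> x = (\<Sum>c\<in>UNIV. \<Sum>d\<in>UNIV. pd c (pd d (\<theta> c d)) x)" for x
    proof -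
      have \<tau>s: "smooth (\<tau> i)" for i by (rule test_smooth[OF \<tau>t])
      have pd\<theta>: "pd c (pd d (\<theta> c d)) x = (\<Sum>i\<in>UNIV. (v i $ c * v i $ d) * pd c (pd d (\<tau> i)) x)" for c d
      proof -
        have "pd d (\<theta> c d) = (\<lambda>x. \<Sum>i\<in>UNIV. (v i $ c * v i $ d) * pd d (\<tau> i) x)"
          unfolding \<theta>_def[abs_def] by (subst pd_sum_smooth) (simp_all add: smooth_cmult \<tau>s pd_cmult_smooth)
        then show ?thesis
          by (simp add: pd_sum_smooth smooth_cmult smooth_pd \<tau>s pd_cmult_smooth)
      qed
      have dd: "dird (v i) (dird (v i) (\<tau> i)) x = (\<Sum>c\<in>UNIV. \<Sum>d\<in>UNIV. (v i $ c * v i $ d) * pd c (pd d (\<tau> i)) x)" for i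
        unfolding dird_def[abs_def]
        by (simp add: pd_sum_smooth smooth_cmult smooth_pd \<tau>s pd_cmult_smooth sum_distrib_left mult.assoc)
      have "(\<Sum>c\<in>UNIV. \<Sum>d\<in>UNIV. pd c (pd d (\<theta> c d)) x) = (\<Sum>i\<in>UNIV. dird (v i) (dird (v i) (\<tau> i)) x)"
        unfolding pd\<theta> dd by (simp add: sum_3)
      also have "\<dots> = (1 / I) * (ridge3 w b'' p2 p2 x + ridge3 w p b'' p2 x + ridge3 w p p b'' x)"
      proof -
        have dc: "dird a (\<lambda>x. c * f x) = (\<lambda>x. c * dird a f x)" if "smooth f" for a c f
          by (simp add: dird_def[abs_def] pd_cmult_smooth[OF that] sum_distrib_left mult.left_commute)
        obtain p' where p': "\<And>x. (p has_real_derivative p' x) (at x)" using smooth1_deriv[OF p] by blast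
        obtain p2' where p2': "\<And>x. (p2 has_real_derivative p2' x) (at x)" using smooth1_deriv[OF p2] by blast
        have t: "\<tau> 1 = (\<lambda>x. (1 / I) * ridge3 w b p2 p2 x)" "\<tau> 2 = (\<lambda>x. (1 / I) * ridge3 w p b p2 x)" "\<tau> 3 = (\<lambda>x. (1 / I) * ridge3 w p p b x)"
          by (simp_all add: \<tau>_def[abs_def])
        have "dird (v 1) (dird (v 1) (\<tau> 1)) = (\<lambda>x. (1 / I) * ridge3 w b'' p2 p2 x)"
          unfolding t dc[OF smooth_ridge3[OF b p2 p2]] dird_ridge3(1)[OF dual b bD p2 p2' p2 p2']
            dc[OF smooth_ridge3[OF b' p2 p2]] dird_ridge3(1)[OF dual b' b'D p2 p2' p2 p2'] ..
        moreover have "dird (v 2) (dird (v 2) (\<tau> 2)) = (\<lambda>x. (1 / I) * ridge3 w p b'' p2 x)"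
          unfolding t dc[OF smooth_ridge3[OF p b p2]] dird_ridge3(2)[OF dual p p' b bD p2 p2']
            dc[OF smooth_ridge3[OF p b' p2]] dird_ridge3(2)[OF dual p p' b' b'D p2 p2'] ..
        moreover have "dird (v 3) (dird (v 3) (\<tau> 3)) = (\<lambda>x. (1 / I) * ridge3 w p p b'' x)"
          unfolding t dc[OF smooth_ridge3[OF p p b]] dird_ridge3(3)[OF dual p p' p p' b bD]
            dc[OF smooth_ridge3[OF p p b']] dird_ridge3(3)[OF dual p p' p p' b' b'D] ..
        ultimately show ?thesis by (simp add: sum_3 distrib_left)
      qed
      also have "\<dots> = 8 * \<omega> (2 *\<^sub>R x) - \<omega> x"
        by (simp add: \<omega>_def ridge3_def b''_def p2_def algebra_simps)
      finally show ?thesis by simp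
    qed
    have \<omega>Q: "x \<in> Q" if "\<omega> x \<noteq> 0" for x
    proof -
      have "ridge3 w p p p x \<noteq> 0" using that by (simp add: \<omega>_def)
      then show ?thesis by (rule inQ) (fact supp')+
    qed
    show "\<forall>i. 1/4 \<le> w i \<bullet> x \<and> w i \<bullet> x \<le> 1" if "\<omega> x \<noteq> 0" for x using \<omega>Q[OF that] by (simp add: Q_def)
    show "\<forall>i. 1/4 \<le> w i \<bullet> x \<and> w i \<bullet> x \<le> 1" if "\<omega> (2 *\<^sub>R x) \<noteq> 0" for x
    proof -
      \<comment> \<open>The lower bound 1/2 for the support of \<open>p\<close> is used here:
        halving it gives exactly 1/4.\<close>
      have "p (2 * (w 1 \<bullet> x)) \<noteq> 0" "p (2 * (w 2 \<bullet> x)) \<noteq> 0" "p (2 * (w 3 \<bullet> x)) \<noteq> 0"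
        using that by (auto simp: \<omega>_def ridge3_def)
      from this[THEN supp(2)] show ?thesis by (simp add: forall_3)
    qed
    show "\<forall>i. 1/4 \<le> w i \<bullet> x \<and> w i \<bullet> x \<le> 1" if nz: "\<theta> c d x \<noteq> 0" for c d x
    proof -
      obtain i where "\<tau> i x \<noteq> 0"
        using nz unfolding \<theta>_def by (cases "\<forall>i. \<tau> i x = 0") auto
      then have "x \<in> Q" by (rule \<tau>Q)
      then show ?thesis by (simp add: Q_def)
    qed
  qed
qed

section \<open>Short translations of the closure into the domain, in coordinates \<open>w\<close>
  with dual basis \<open>v\<close>\<close>

section \<open>The uniform cone property\<close>

lemma inner_axis_scaled: "((1 / c) *\<^sub>R axis i 1 :: real^3) \<bullet> (c *\<^sub>R axis j 1) = (if i = j then 1 else 0)" if "c \<noteq> 0"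
  using that by (simp add: inner_axis_axis)

lemma norm_le_sum3: "norm (x :: real^3) \<le> \<bar>x $ 1\<bar> + \<bar>x $ 2\<bar> + \<bar>x $ 3\<bar>"
  using norm_le_l1_cart[of x] by (simp add: sum_3)

text \<open>Any short translation works near an interior point; the parallelepiped format is that of
  the boundary case, so both feed into the same kernels. The bound 2 leaves room for two shifts with
  coordinates at most 1.\<close>

lemma cone_interior:
  assumes "open \<Omega>" "x \<in> \<Omega>"
  shows "\<exists>(w :: 3 \<Rightarrow> real^3) v r. 0 < r \<and> (\<forall>i j. w i \<bullet> v j = (if i = j then 1 else 0)) \<and>
    bounded {u. \<forall>i. 0 < w i \<bullet> u \<and> w i \<bullet> u \<le> 2} \<and>
    (\<forall>y\<in>closure \<Omega> \<inter> ball x r. \<forall>u. (\<forall>i. 0 < w i \<bullet> u \<and> w i \<bullet> u \<le> 2) \<longrightarrow> y + u \<in> \<Omega>)"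
proof -
  obtain e where e: "e > 0" "ball x e \<subseteq> \<Omega>" using assms by (meson open_contains_ball)
  \<comment> \<open>The three coordinates of \<open>u\<close> are at most \<open>2 * c\<close>, so
    its norm is at most \<open>6 * c\<close>, which is below \<open>7 * c = e / 2\<close>.\<close>
  define c where "c = e / 14"
  have c: "c > 0" using e by (simp add: c_def)
  define w v where "w i = (1 / c) *\<^sub>R (axis i 1 :: real^3)" and "v i = c *\<^sub>R (axis i 1 :: real^3)" for i :: 3
  have small: "norm u < e / 2" if "\<forall>i. 0 < w i \<bullet> u \<and> w i \<bullet> u \<le> 2" for u
  proof -
    have comp: "u $ i = c * (w i \<bullet> u)" for i using c by (simp add: w_def inner_axis inner_commute[of _ u])
    have "0 < u $ i" "u $ i \<le> 2 * c" for i unfolding comp using that c by simp_all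
    from this[of 1] this[of 2] this[of 3] have "\<bar>u $ 1\<bar> + \<bar>u $ 2\<bar> + \<bar>u $ 3\<bar> \<le> 6 * c" by linarith
    then show ?thesis using norm_le_sum3[of u] e(1) by (simp add: c_def)
  qed
  have dual: "\<forall>i j. w i \<bullet> v j = (if i = j then 1 else 0)"
    unfolding w_def v_def using c by (intro allI inner_axis_scaled) simp
  have bdd: "bounded {u. \<forall>i. 0 < w i \<bullet> u \<and> w i \<bullet> u \<le> 2}"
    using small by (intro boundedI[of _ "e / 2"]) (auto intro: less_imp_le)
  have cone: "\<forall>y\<in>closure \<Omega> \<inter> ball x (e / 2). \<forall>u. (\<forall>i. 0 < w i \<bullet> u \<and> w i \<bullet> u \<le> 2) \<longrightarrow> y + u \<in> \<Omega>"
  proof (intro ballI allI impI)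
    fix y u assume y: "y \<in> closure \<Omega> \<inter> ball x (e / 2)" and u: "\<forall>i. 0 < w i \<bullet> u \<and> w i \<bullet> u \<le> 2"
    have "dist x (y + u) \<le> dist x y + norm u"
      using dist_triangle[of x "y + u" y] by (simp add: dist_norm)
    then have "dist x (y + u) < e" using y small[OF u] by simp
    then show "y + u \<in> \<Omega>" using e(2) by auto
  qed
  have "0 < e / 2" using e by simp
  with dual bdd cone show ?thesis by blast
qed

text \<open>Below a Lipschitz graph a cone steeper than the Lipschitz constant points into the
  domain. It is written as the positive octant of skew coordinates.\<close>

lemma cone_boundary:
  assumes "lipschitz_boundary \<Omega>" "x \<in> frontier \<Omega>"
  shows "\<exists>(w :: 3 \<Rightarrow> real^3) v r. 0 < r \<and> (\<forall>i j. w i \<bullet> v j = (if i = j then 1 else 0)) \<and>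
    bounded {u. \<forall>i. 0 < w i \<bullet> u \<and> w i \<bullet> u \<le> 2} \<and>
    (\<forall>y\<in>closure \<Omega> \<inter> ball x r. \<forall>u. (\<forall>i. 0 < w i \<bullet> u \<and> w i \<bullet> u \<le> 2) \<longrightarrow> y + u \<in> \<Omega>)"
proof -
  from assms obtain e and R :: "real^3 \<Rightarrow> real^3" and L :: real and h :: "real \<times> real \<Rightarrow> real"
    where e: "e > 0" and R: "orthogonal_transformation R" and Lh: "L-lipschitz_on UNIV h"
    and graph: "\<And>y. y \<in> ball x e \<Longrightarrow> y \<in> \<Omega> \<longleftrightarrow> (R (y - x)) $ 3 < h ((R (y - x)) $ 1, (R (y - x)) $ 2)"
    unfolding lipschitz_boundary_def by meson
  have Rl: "linear R" using R by (simp add: orthogonal_transformation_def)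
  have Rn: "norm (R u) = norm u" for u using orthogonal_transformation_norm[OF R] .
  have Rc: "continuous_on S R" for S using Rl by (rule linear_continuous_on_compose[OF continuous_on_id, unfolded o_def, simplified])
  have L0: "L \<ge> 0" using Lh by (rule lipschitz_on_nonneg)
  \<comment> \<open>The orthonormal frame in which the boundary is a graph.\<close>
  define f where "f i = inv R (axis i 1)" for i :: 3
  have Rf: "R (f i) = axis i 1" for i
    unfolding f_def using orthogonal_transformation_surj[OF R] by (rule surj_f_inv_f)
  have comp: "f i \<bullet> u = R u $ i" for i u
  proof -
    have "f i \<bullet> u = R (f i) \<bullet> R u" using R by (simp add: orthogonal_transformation_def)
    then show ?thesis by (simp add: Rf inner_axis')
  qed
  have ff: "f i \<bullet> f j = (if i = j then 1 else 0)" for i j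
    unfolding comp Rf by (simp add: axis_def eq_commute)
  \<comment> \<open>Any slope from \<open>L\<close> upwards would work; adding 1 makes
    \<open>M\<close> positive also when \<open>L\<close> is 0.\<close>
  define M where "M = L + 1"
  \<comment> \<open>Coordinates up to 2 give \<open>norm u\<close> at most
    \<open>6 * c + 4 * M * c\<close>, which is less than
    \<open>2 * (7 + 4 * M) * c = e / 2\<close>.\<close>
  define c where "c = (e / 4) / (7 + 4 * M)"
  have M: "M > 0" using L0 by (simp add: M_def)
  have c: "c > 0" using e M by (simp add: c_def)
  \<comment> \<open>Positivity of the third coordinate says that the descent of \<open>u\<close>
    exceeds \<open>M\<close> times the sum of its two horizontal components, which are positive by
    the other coordinates.\<close>
  define w where "w i = (if i = 3 then (- 1 / c) *\<^sub>R (f 3 + M *\<^sub>R f 1 + M *\<^sub>R f 2) else (1 / c) *\<^sub>R f i)" for i :: 3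
  define v where "v i = (if i = 3 then - c *\<^sub>R f 3 else c *\<^sub>R (f i - M *\<^sub>R f 3))" for i :: 3
  have dual: "\<forall>i j. w i \<bullet> v j = (if i = j then 1 else 0)"
    using c by (simp add: forall_3 w_def v_def inner_diff_right inner_add_left inner_diff_left inner_add_right ff)
  have coords: "R u $ 1 = c * (w 1 \<bullet> u)" "R u $ 2 = c * (w 2 \<bullet> u)"
    "R u $ 3 = - c * (w 3 \<bullet> u) - M * (c * (w 1 \<bullet> u) + c * (w 2 \<bullet> u))" for u
    using c by (simp_all add: w_def inner_add_left comp algebra_simps)
  have small: "norm u < e / 2" if "\<forall>i. 0 < w i \<bullet> u \<and> w i \<bullet> u \<le> 2" for u
  proof -
    have t: "0 < c * (w i \<bullet> u)" "c * (w i \<bullet> u) \<le> 2 * c" for i using that c by simp_all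
    have "M * (c * (w 1 \<bullet> u) + c * (w 2 \<bullet> u)) \<le> M * (4 * c)" "0 \<le> M * (c * (w 1 \<bullet> u) + c * (w 2 \<bullet> u))"
    proof -
      have "0 \<le> c * (w 1 \<bullet> u) + c * (w 2 \<bullet> u)" "c * (w 1 \<bullet> u) + c * (w 2 \<bullet> u) \<le> 4 * c"
        using t(1)[of 1] t(1)[of 2] t(2)[of 1] t(2)[of 2] by linarith+
      then show "M * (c * (w 1 \<bullet> u) + c * (w 2 \<bullet> u)) \<le> M * (4 * c)" "0 \<le> M * (c * (w 1 \<bullet> u) + c * (w 2 \<bullet> u))"
        using M by (simp_all add: mult_left_mono)
    qed
    then have "\<bar>R u $ 1\<bar> + \<bar>R u $ 2\<bar> + \<bar>R u $ 3\<bar> \<le> 6 * c + M * (4 * c)"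
      using t[of 1] t[of 2] t[of 3] unfolding coords by linarith
    also have "\<dots> < 2 * (c * (7 + 4 * M))" using c M by (simp add: algebra_simps add_pos_pos)
    also have "\<dots> = e / 2"
    proof -
      have "7 + 4 * M \<noteq> 0" using M by linarith
      then have "c * (7 + 4 * M) = e / 4" by (rule iffD1[OF nonzero_eq_divide_eq c_def])
      then show ?thesis by simp
    qed
    finally show ?thesis using norm_le_sum3[of "R u"] Rn[of u] by simp
  qed
  \<comment> \<open>Points of the closure satisfy the graph inequality only weakly; the cone
    restores strictness.\<close>
  have below: "(R (y - x)) $ 3 \<le> h ((R (y - x)) $ 1, (R (y - x)) $ 2)" if y: "y \<in> closure \<Omega> \<inter> ball x e" for y
  proof -
    have yc: "y \<in> closure (ball x e \<inter> \<Omega>)" using open_Int_closure_subset[OF open_ball] y by blast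
    have cont: "continuous_on (closure (ball x e \<inter> \<Omega>)) (\<lambda>y. (R (y - x)) $ 3 - h ((R (y - x)) $ 1, (R (y - x)) $ 2))"
    proof -
      have 1: "continuous_on S (\<lambda>y. R (y - x))" for S
        by (rule continuous_on_compose2[OF Rc[of UNIV]]) (auto intro!: continuous_intros)
      have 2: "continuous_on S (\<lambda>y. h ((R (y - x)) $ 1, (R (y - x)) $ 2))" for S
        by (rule continuous_on_compose2[OF lipschitz_on_continuous_on[OF Lh]]) (auto intro!: continuous_intros 1)
      show ?thesis by (intro continuous_intros 1 2)
    qed
    have "(R (y - x)) $ 3 - h ((R (y - x)) $ 1, (R (y - x)) $ 2) \<le> 0"
      by (rule continuous_le_on_closure[OF cont yc]) (use graph in force)
    then show ?thesis by simp
  qed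
  have bdd: "bounded {u. \<forall>i. 0 < w i \<bullet> u \<and> w i \<bullet> u \<le> 2}"
    using small by (intro boundedI[of _ "e / 2"]) (auto intro: less_imp_le)
  have cone: "\<forall>y\<in>closure \<Omega> \<inter> ball x (e / 2). \<forall>u. (\<forall>i. 0 < w i \<bullet> u \<and> w i \<bullet> u \<le> 2) \<longrightarrow> y + u \<in> \<Omega>"
  proof (intro ballI allI impI)
    fix y u assume y: "y \<in> closure \<Omega> \<inter> ball x (e / 2)" and u: "\<forall>i. 0 < w i \<bullet> u \<and> w i \<bullet> u \<le> 2"
    have t: "0 < c * (w i \<bullet> u)" for i using u c by simp
    have "dist x (y + u) \<le> dist x y + norm u"
      using dist_triangle[of x "y + u" y] by (simp add: dist_norm)
    then have yu: "y + u \<in> ball x e" using y small[OF u] by simp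
    have Radd: "R (y + u - x) = R (y - x) + R u"
      using linear_add[OF Rl, of "y - x" u] by (simp add: algebra_simps)
    let ?a = "((R (y - x)) $ 1, (R (y - x)) $ 2)"
    let ?b = "((R (y + u - x)) $ 1, (R (y + u - x)) $ 2)"
    have "dist ?a ?b \<le> \<bar>R u $ 1\<bar> + \<bar>R u $ 2\<bar>"
      unfolding Radd by (simp add: dist_Pair_Pair dist_real_def sqrt_sum_squares_le_sum_abs)
    then have "L * dist ?a ?b \<le> L * (\<bar>R u $ 1\<bar> + \<bar>R u $ 2\<bar>)" using L0 by (rule mult_left_mono)
    moreover have "h ?a \<le> h ?b + L * dist ?a ?b"
      using lipschitz_onD[OF Lh, of ?a ?b] by (simp add: dist_real_def)
    moreover have "\<bar>R u $ 1\<bar> + \<bar>R u $ 2\<bar> = c * (w 1 \<bullet> u) + c * (w 2 \<bullet> u)"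
      unfolding coords using t[of 1] t[of 2] by linarith
    moreover have "R u $ 3 < - L * (c * (w 1 \<bullet> u) + c * (w 2 \<bullet> u))"
      unfolding coords M_def using t[of 1] t[of 2] t[of 3] by (simp add: algebra_simps)
    moreover have "(R (y - x)) $ 3 \<le> h ?a" using below[of y] y e by auto
    ultimately have "(R (y + u - x)) $ 3 < h ?b" unfolding Radd by simp
    then show "y + u \<in> \<Omega>" using graph[OF yu] by blast
  qed
  have "0 < e / 2" using e by simp
  with dual bdd cone show ?thesis by blast
qed

section \<open>A finite cover of the closure with a smooth partition of unity\<close>

section \<open>Localisation\<close>

lemma smooth_plateau:
  assumes r: "r > 0"
  obtains \<psi> \<delta> where "test UNIV \<psi>" "\<delta> > 0" "\<And>y. y \<in> ball x \<delta> \<Longrightarrow> \<psi> y = 1" "\<And>y. \<psi> y \<noteq> 0 \<Longrightarrow> y \<in> cball x r"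
proof -
  obtain s q where s: "smooth1 s" "\<And>x. x \<le> 1/2 \<Longrightarrow> s x = 0" "\<And>x. 1 \<le> x \<Longrightarrow> s x = 1"
    using smooth_step by metis
  \<comment> \<open>The support is a cube of half side \<open>2 * \<delta>\<close>, whose points
    have l1 distance at most \<open>6 * \<delta> = r\<close> from the centre.\<close>
  define \<delta> where "\<delta> = r / 6"
  have \<delta>: "\<delta> > 0" using r by (simp add: \<delta>_def)
  \<comment> \<open>A descending step times an ascending one: 1 within \<open>\<delta>\<close> of
    the centre coordinate, 0 beyond \<open>2 * \<delta>\<close>.\<close>
  define f where "f i t = s ((2 + x $ i / \<delta>) + (- 1 / \<delta>) * t) * s ((2 - x $ i / \<delta>) + (1 / \<delta>) * t)" for i t
  have f: "smooth1 (f i)" for i unfolding f_def[abs_def] by (intro smooth1_mult smooth1_affine s)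
  have arg: "(2 + x $ i / \<delta>) + (- 1 / \<delta>) * t = 2 - (t - x $ i) / \<delta>" "(2 - x $ i / \<delta>) + (1 / \<delta>) * t = 2 + (t - x $ i) / \<delta>" for i t
    by (simp_all add: diff_divide_distrib)
  have f1: "f i t = 1" if "\<bar>t - x $ i\<bar> \<le> \<delta>" for i t
  proof -
    have "\<bar>(t - x $ i) / \<delta>\<bar> \<le> 1" using that \<delta> by simp
    then have "1 \<le> 2 - (t - x $ i) / \<delta>" "1 \<le> 2 + (t - x $ i) / \<delta>" by linarith+
    then show ?thesis unfolding f_def arg by (simp add: s)
  qed
  have f0: "\<bar>t - x $ i\<bar> \<le> 2 * \<delta>" if "f i t \<noteq> 0" for i t
  proof (rule ccontr)
    assume "\<not> ?thesis"
    then have "2 < \<bar>(t - x $ i) / \<delta>\<bar>" using \<delta> by (simp add: field_simps)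
    then have "2 - (t - x $ i) / \<delta> \<le> 1/2 \<or> 2 + (t - x $ i) / \<delta> \<le> 1/2" by linarith
    then have "f i t = 0" unfolding f_def arg using s(2) by auto
    with that show False by simp
  qed
  define \<psi> where "\<psi> = ridge3 (\<lambda>i. axis i 1) (f 1) (f 2) (f 3)"
  have \<psi>: "\<psi> y = f 1 (y $ 1) * (f 2 (y $ 2) * f 3 (y $ 3))" for y by (simp add: \<psi>_def ridge3_def inner_axis')
  have supp: "y \<in> cball x r" if "\<psi> y \<noteq> 0" for y
  proof -
    have "\<bar>y $ i - x $ i\<bar> \<le> 2 * \<delta>" for i
      using that f0[of 1 "y $ 1"] f0[of 2 "y $ 2"] f0[of 3 "y $ 3"] exhaust_3[of i] by (auto simp: \<psi>)
    from this[of 1] this[of 2] this[of 3] have "norm (y - x) \<le> 6 * \<delta>"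
      using norm_le_sum3[of "y - x"] by simp
    then show ?thesis by (simp add: dist_norm norm_minus_commute \<delta>_def)
  qed
  show thesis
  proof (rule that[of \<psi> \<delta>])
    show "test UNIV \<psi>" unfolding test_iff
      using supp by (intro conjI exI[of _ "cball x r"]) (auto simp: \<psi>_def intro!: smooth_ridge3 f)
    show "\<psi> y = 1" if "y \<in> ball x \<delta>" for y
    proof -
      have "\<bar>y $ i - x $ i\<bar> \<le> \<delta>" for i
        using component_le_norm_cart[of "y - x" i] that by (simp add: dist_norm norm_minus_commute)
      then show ?thesis by (simp add: \<psi> f1)
    qed
  qed (use \<delta> supp in auto)
qed

lemma local_kernels_exist:
  assumes \<Omega>: "open \<Omega>" "bounded \<Omega>" "lipschitz_boundary \<Omega>" and x: "x \<in> closure \<Omega>"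
  obtains \<omega> \<theta> Q D \<psi> \<delta> where "local_kernels \<omega> \<theta> Q D \<Omega>" "test UNIV \<psi>" "\<delta> > 0"
    "\<And>y. y \<in> ball x \<delta> \<Longrightarrow> \<psi> y = 1" "\<And>y. y \<in> \<Omega> \<Longrightarrow> \<psi> y \<noteq> 0 \<Longrightarrow> y \<in> D"
proof -
  have "x \<in> \<Omega> \<or> x \<in> frontier \<Omega>" using x \<Omega>(1) by (auto simp: frontier_def interior_open)
  then have "\<exists>(w :: 3 \<Rightarrow> real^3) v r. 0 < r \<and> (\<forall>i j. w i \<bullet> v j = (if i = j then 1 else 0)) \<and>
    bounded {u. \<forall>i. 0 < w i \<bullet> u \<and> w i \<bullet> u \<le> 2} \<and>
    (\<forall>y\<in>closure \<Omega> \<inter> ball x r. \<forall>u. (\<forall>i. 0 < w i \<bullet> u \<and> w i \<bullet> u \<le> 2) \<longrightarrow> y + u \<in> \<Omega>)"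
    using cone_interior[OF \<Omega>(1)] cone_boundary[OF \<Omega>(3)] by blast
  then obtain w v :: "3 \<Rightarrow> real^3" and r where r: "0 < r" and dual: "\<And>i j. w i \<bullet> v j = (if i = j then 1 else 0)"
    and bdd: "bounded {u. \<forall>i. 0 < w i \<bullet> u \<and> w i \<bullet> u \<le> 2}"
    and cone: "\<And>y u. y \<in> closure \<Omega> \<inter> ball x r \<Longrightarrow> \<forall>i. 0 < w i \<bullet> u \<and> w i \<bullet> u \<le> 2 \<Longrightarrow> y + u \<in> \<Omega>"
    by blast
  define Q where "Q = {u. \<forall>i. 1/4 \<le> w i \<bullet> u \<and> w i \<bullet> u \<le> 1}"
  have "Q \<subseteq> {u. \<forall>i. 0 < w i \<bullet> u \<and> w i \<bullet> u \<le> 2}"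
  proof
    fix u assume "u \<in> Q"
    then have "1/4 \<le> w i \<bullet> u" "w i \<bullet> u \<le> 1" for i by (auto simp: Q_def)
    then have "0 < w i \<bullet> u \<and> w i \<bullet> u \<le> 2" for i by (smt (verit) divide_pos_pos)
    then show "u \<in> {u. \<forall>i. 0 < w i \<bullet> u \<and> w i \<bullet> u \<le> 2}" by blast
  qed
  then have Qb: "bounded Q" using bdd bounded_subset by blast
  have "closed Q" unfolding Q_def
    by (intro closed_Collect_all closed_Collect_conj closed_Collect_le continuous_intros)
  then have Qc: "compact Q" using Qb by (simp add: compact_eq_bounded_closed)
  obtain \<omega> \<theta> where k: "test UNIV \<omega>" "integral\<^sup>L lborel \<omega> = 1" "\<And>a b. test UNIV (\<theta> a b)" "\<And>a b. \<theta> a b = \<theta> b a"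
    "\<And>x. 8 * \<omega> (2 *\<^sub>R x) - \<omega> x = (\<Sum>a\<in>UNIV. \<Sum>b\<in>UNIV. pd a (pd b (\<theta> a b)) x)"
    "\<And>x. \<omega> x \<noteq> 0 \<Longrightarrow> \<forall>i. 1/4 \<le> w i \<bullet> x \<and> w i \<bullet> x \<le> 1"
    "\<And>x. \<omega> (2 *\<^sub>R x) \<noteq> 0 \<Longrightarrow> \<forall>i. 1/4 \<le> w i \<bullet> x \<and> w i \<bullet> x \<le> 1"
    "\<And>a b x. \<theta> a b x \<noteq> 0 \<Longrightarrow> \<forall>i. 1/4 \<le> w i \<bullet> x \<and> w i \<bullet> x \<le> 1"
    using kernels_exist[OF dual Qb[unfolded Q_def]] by blast
  \<comment> \<open>Half the radius makes \<open>D\<close> compact while staying in the open ball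
    where the cone is available.\<close>
  define D where "D = closure \<Omega> \<inter> cball x (r / 2)"
  have lk: "local_kernels \<omega> \<theta> Q D \<Omega>"
  proof
    show "compact D" unfolding D_def by (intro closed_Int_compact) auto
    fix y z z' and s :: real
    assume y: "y \<in> D" and z: "z \<in> Q" "z' \<in> Q" and s: "0 < s" "s \<le> 1"
    have "0 < w i \<bullet> (s *\<^sub>R (z + z')) \<and> w i \<bullet> (s *\<^sub>R (z + z')) \<le> 2" for i
    proof -
      have "1/4 \<le> w i \<bullet> z" "w i \<bullet> z \<le> 1" "1/4 \<le> w i \<bullet> z'" "w i \<bullet> z' \<le> 1" using z by (auto simp: Q_def)
      then have "0 < w i \<bullet> z + w i \<bullet> z'" "w i \<bullet> z + w i \<bullet> z' \<le> 2" by linarith+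
      then show ?thesis
        using s mult_mono[of s 1 "w i \<bullet> z + w i \<bullet> z'" 2] by (simp add: inner_add_right)
    qed
    moreover have "y \<in> closure \<Omega> \<inter> ball x r" using y r by (auto simp: D_def)
    ultimately show "y + s *\<^sub>R (z + z') \<in> \<Omega>" using cone by blast
  qed (use k Qc in \<open>auto simp: Q_def\<close>)
  have r2: "r / 2 > 0" using r by simp
  obtain \<psi> \<delta> where "test UNIV \<psi>" "\<delta> > 0" "\<And>y. y \<in> ball x \<delta> \<Longrightarrow> \<psi> y = 1" "\<And>y. \<psi> y \<noteq> 0 \<Longrightarrow> y \<in> cball x (r / 2)"
    using smooth_plateau[OF r2] by blast
  then show thesis using closure_subset[of \<Omega>] by (intro that[OF lk, of \<psi> \<delta>]) (auto simp: D_def)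
qed

theorem local_kernels_cover:
  assumes \<Omega>: "open \<Omega>" "bounded \<Omega>" "lipschitz_boundary \<Omega>"
  obtains n :: nat and \<zeta> \<omega> \<theta> Q D where
    "\<And>k. k < n \<Longrightarrow> local_kernels (\<omega> k) (\<theta> k) (Q k) (D k) \<Omega>" "\<And>k. k < n \<Longrightarrow> test UNIV (\<zeta> k)"
    "\<And>k y. k < n \<Longrightarrow> y \<in> \<Omega> \<Longrightarrow> \<zeta> k y \<noteq> 0 \<Longrightarrow> y \<in> D k"
    "\<And>y. y \<in> \<Omega> \<Longrightarrow> (\<Sum>k<n. \<zeta> k y) = 1"
proof -
  have "\<forall>x\<in>closure \<Omega>. \<exists>\<omega> \<theta> Q D \<psi> \<delta>. local_kernels \<omega> \<theta> Q D \<Omega> \<and> test UNIV \<psi> \<and> \<delta> > 0 \<and>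
    (\<forall>y\<in>ball x \<delta>. \<psi> y = 1) \<and> (\<forall>y\<in>\<Omega>. \<psi> y \<noteq> 0 \<longrightarrow> y \<in> D)"
    using local_kernels_exist[OF \<Omega>] by metis
  then obtain \<omega> \<theta> Q D \<psi> \<delta> where P: "\<And>x. x \<in> closure \<Omega> \<Longrightarrow> local_kernels (\<omega> x) (\<theta> x) (Q x) (D x) \<Omega> \<and> test UNIV (\<psi> x) \<and> \<delta> x > 0 \<and>
    (\<forall>y\<in>ball x (\<delta> x). \<psi> x y = 1) \<and> (\<forall>y\<in>\<Omega>. \<psi> x y \<noteq> 0 \<longrightarrow> y \<in> D x)"
    by metis
  have "compact (closure \<Omega>)" using \<Omega>(2) by simp
  moreover have "closure \<Omega> \<subseteq> (\<Union>x\<in>closure \<Omega>. ball x (\<delta> x))" using P by force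
  ultimately obtain X where X: "X \<subseteq> closure \<Omega>" "finite X" "closure \<Omega> \<subseteq> (\<Union>x\<in>X. ball x (\<delta> x))"
    using compactE_image[of "closure \<Omega>" "closure \<Omega>" "\<lambda>x. ball x (\<delta> x)"] by (metis open_ball)
  obtain n and e :: "nat \<Rightarrow> real^3" where e: "X = e ` {..<n}"
    using finite_imp_nat_seg_image_inj_on[OF X(2)] by (auto simp: lessThan_def)
  have eX: "e k \<in> closure \<Omega>" if "k < n" for k using X(1) e that by blast
  \<comment> \<open>The sums telescope to 1 minus a product, and over each point of the domain one
    factor of that product is 0. No division by a sum is involved, so smoothness is
    immediate.\<close>
  define \<zeta> where "\<zeta> k y = \<psi> (e k) y * (\<Prod>j<k. 1 - \<psi> (e j) y)" for k y
  have sum: "(\<Sum>k<m. \<zeta> k y) = 1 - (\<Prod>j<m. 1 - \<psi> (e j) y)" for m y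
    by (induction m) (auto simp: \<zeta>_def algebra_simps)
  show thesis
  proof (rule that[of n "\<lambda>k. \<omega> (e k)" "\<lambda>k. \<theta> (e k)" "\<lambda>k. Q (e k)" "\<lambda>k. D (e k)" \<zeta>])
    show "test UNIV (\<zeta> k)" if k: "k < n" for k
    proof -
      have "smooth (\<lambda>y. \<Prod>j<m. 1 - \<psi> (e j) y)" if "m \<le> n" for m
        using that
      proof (induction m)
        case (Suc m)
        have "smooth (\<psi> (e m))" using P[OF eX[of m]] Suc.prems by (auto intro: test_smooth)
        then show ?case using Suc by (auto intro!: smooth_mult smooth_diff)
      qed simp
      then show ?thesis unfolding \<zeta>_def[abs_def] using P[OF eX[OF k]] k
        by (intro test_mult_smooth(1)) auto
    qed
    show "(\<Sum>k<n. \<zeta> k y) = 1" if y: "y \<in> \<Omega>" for y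
    proof -
      obtain j where "j < n" "y \<in> ball (e j) (\<delta> (e j))" using X(3) y closure_subset[of \<Omega>] e by auto
      then have "1 - \<psi> (e j) y = 0" "j \<in> {..<n}" using P[OF eX] by auto
      then have "(\<Prod>j<n. 1 - \<psi> (e j) y) = 0" by (metis finite_lessThan prod_zero)
      then show ?thesis by (simp add: sum)
    qed
  qed (use P eX in \<open>auto simp: \<zeta>_def\<close>)
qed


section \<open>Boundedness of multiplication by a cutoff on the graph space of inc\<close>

section \<open>Cutting off\<close>

lemma L2norm_le_H1norm_test:
  "L2norm \<phi> \<le> H1norm_test \<phi>" "L2norm (pd j \<phi>) \<le> H1norm_test \<phi>"
proof -
  have s: "(L2norm (pd j \<phi>))\<^sup>2 \<le> (\<Sum>j\<in>UNIV. (L2norm (pd j \<phi>))\<^sup>2)"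
    by (rule member_le_sum) auto
  then have "0 \<le> (\<Sum>j\<in>UNIV. (L2norm (pd j \<phi>))\<^sup>2)" using zero_le_power2 order_trans by blast
  then show "L2norm \<phi> \<le> H1norm_test \<phi>" unfolding H1norm_test_def by (intro real_le_rsqrt) simp
  show "L2norm (pd j \<phi>) \<le> H1norm_test \<phi>" unfolding H1norm_test_def
    using s by (intro real_le_rsqrt) (simp add: add_increasing)
qed

lemma H1norm_test_cmult:
  assumes "test UNIV \<phi>" shows "H1norm_test (\<lambda>x. c * \<phi> x) = \<bar>c\<bar> * H1norm_test \<phi>"
proof -
  have "(L2norm (\<lambda>x. c * \<phi> x))\<^sup>2 + (\<Sum>j\<in>UNIV. (L2norm (pd j (\<lambda>x. c * \<phi> x)))\<^sup>2)
     = c\<^sup>2 * ((L2norm \<phi>)\<^sup>2 + (\<Sum>j\<in>UNIV. (L2norm (pd j \<phi>))\<^sup>2))"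
    by (simp add: pd_cmult_smooth[OF test_smooth[OF assms]] L2norm_cmult power_mult_distrib sum_distrib_left distrib_left)
  then show ?thesis by (simp add: H1norm_test_def real_sqrt_mult)
qed

lemma incD_cmult:
  assumes "test UNIV \<phi>" shows "incD g a b (\<lambda>x. c * \<phi> x) = c * incD g a b \<phi>"
proof -
  have "pd p (pd l (\<lambda>x. c * \<phi> x)) = (\<lambda>x. c * pd p (pd l \<phi>) x)" for p l
    by (simp add: pd_cmult_smooth test_smooth[OF assms] smooth_pd)
  then show ?thesis unfolding incD_def by (simp add: sum_distrib_left mult.left_commute[of _ c])
qed

lemma incD_zero [simp]: "incD g a b (\<lambda>x. 0) = 0" by (simp add: incD_def)

lemma H1norm_test_zero [simp]: "H1norm_test (\<lambda>x. 0) = 0" by (simp add: H1norm_test_def)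

text \<open>\<open>Hm1norm\<close> is a supremum over reals and says something only for sets bounded
  above; membership in \<open>Hcc\<close> provides the bound. Test functions of norm zero cannot be
  normalised and are covered by that bound directly.\<close>

lemma incD_le_Hm1norm:
  assumes g: "g \<in> Hcc \<Omega>" and \<phi>: "test UNIV \<phi>"
  shows "\<bar>incD g a b \<phi>\<bar> \<le> Hm1norm (incD g a b) * H1norm_test \<phi>"
proof -
  obtain C where C: "\<And>\<phi>. test UNIV \<phi> \<Longrightarrow> \<bar>incD g a b \<phi>\<bar> \<le> C * H1norm_test \<phi>"
    using g unfolding Hcc_def Hm1_tilde_def by blast
  show ?thesis
  proof (cases "H1norm_test \<phi> = 0")
    case True
    then show ?thesis using C[OF \<phi>] by simp
  next
    case False
    define N where "N = H1norm_test \<phi>"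
    have N: "N > 0" using False by (simp add: N_def less_le)
    define \<psi> where "\<psi> x = (1 / N) * \<phi> x" for x
    have \<psi>: "test UNIV \<psi>" "H1norm_test \<psi> = 1" "incD g a b \<psi> = incD g a b \<phi> / N"
      unfolding \<psi>_def[abs_def] using H1norm_test_cmult[OF \<phi>, of "1 / N"] incD_cmult[OF \<phi>, of g a b "1 / N"] N
      test_cmult[OF \<phi>, of "1 / N"] by (simp_all add: N_def[symmetric])
    have "\<bar>incD g a b \<psi>\<bar> \<le> Hm1norm (incD g a b)"
      unfolding Hm1norm_def
    proof (rule cSup_upper)
      show "\<bar>incD g a b \<psi>\<bar> \<in> {\<bar>incD g a b \<phi>\<bar> |\<phi>. test UNIV \<phi> \<and> H1norm_test \<phi> \<le> 1}"
        using \<psi>(1,2) by (intro CollectI exI[of _ \<psi>]) simp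
      show "bdd_above {\<bar>incD g a b \<phi>\<bar> |\<phi>. test UNIV \<phi> \<and> H1norm_test \<phi> \<le> 1}"
      proof (rule bdd_aboveI[of _ "\<bar>C\<bar>"], clarify)
        fix \<phi> assume "test UNIV \<phi>" "H1norm_test \<phi> \<le> 1"
        have "\<bar>incD g a b \<phi>\<bar> \<le> C * H1norm_test \<phi>" by (rule C) fact
        also have "\<dots> \<le> \<bar>C\<bar> * 1" using \<open>H1norm_test \<phi> \<le> 1\<close> by (intro mult_mono) auto
        finally show "\<bar>incD g a b \<phi>\<bar> \<le> \<bar>C\<bar>" by simp
      qed
    qed
    then show ?thesis using N unfolding \<psi>(3) N_def[symmetric] by (simp add: field_simps)
  qed
qed

lemma Hccnorm_ge:
  "L2norm (g i j) \<le> Hccnorm g" "Hm1norm (incD g a b) \<le> Hccnorm g" "0 \<le> Hccnorm g"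
proof -
  have nn: "0 \<le> (\<Sum>i\<in>UNIV. \<Sum>j\<in>UNIV. (f i j :: real)\<^sup>2)" for f :: "3 \<Rightarrow> 3 \<Rightarrow> real" by (intro sum_nonneg) auto
  have le: "(f i j)\<^sup>2 \<le> (\<Sum>i\<in>UNIV. \<Sum>j\<in>UNIV. (f i j :: real)\<^sup>2)" for f :: "3 \<Rightarrow> 3 \<Rightarrow> real" and i j
  proof -
    have "(f i j)\<^sup>2 \<le> (\<Sum>j\<in>UNIV. (f i j)\<^sup>2)" by (rule member_le_sum) auto
    also have "\<dots> \<le> (\<Sum>i\<in>UNIV. \<Sum>j\<in>UNIV. (f i j)\<^sup>2)"
      by (rule member_le_sum[where f = "\<lambda>i. \<Sum>j\<in>UNIV. (f i j)\<^sup>2"]) (auto intro: sum_nonneg)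
    finally show ?thesis .
  qed
  show "L2norm (g i j) \<le> Hccnorm g"
    using le[of "\<lambda>i j. L2norm (g i j)" i j] nn[of "\<lambda>a b. Hm1norm (incD g a b)"]
    unfolding Hccnorm_def by (intro real_le_rsqrt) linarith
  show "Hm1norm (incD g a b) \<le> Hccnorm g"
    using le[of "\<lambda>a b. Hm1norm (incD g a b)" a b] nn[of "\<lambda>i j. L2norm (g i j)"]
    unfolding Hccnorm_def by (intro real_le_rsqrt) linarith
  show "0 \<le> Hccnorm g" unfolding Hccnorm_def using nn by (intro real_sqrt_ge_zero add_nonneg_nonneg)
qed

lemma HccD:
  assumes "g \<in> Hcc \<Omega>"
  shows "g i j \<in> L2" "x \<notin> \<Omega> \<Longrightarrow> g i j x = 0" "g i j = g j i"
  using assms by (auto simp: Hcc_def L2Om_def)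

lemma abs_levi_le: "\<bar>levi i j k\<bar> \<le> 1"
proof -
  have "\<forall>i j k. \<bar>levi i j k\<bar> \<le> 1" by (simp add: forall_3 levi_values)
  then show ?thesis by blast
qed

text \<open>There are 3^4 = 81 terms with coefficients of modulus at most 1.\<close>

lemma levi_sum_le:
  assumes "\<And>p q l m. \<bar>F p q l m\<bar> \<le> B"
  shows "\<bar>\<Sum>p\<in>UNIV. \<Sum>q\<in>UNIV. \<Sum>l\<in>UNIV. \<Sum>m\<in>UNIV. levi a p q * levi b l m * F p q l m\<bar> \<le> 81 * B"
proof -
  have "\<bar>levi a p q * levi b l m * F p q l m\<bar> \<le> B" for p q l m
  proof -
    have "\<bar>levi a p q\<bar> * \<bar>levi b l m\<bar> \<le> 1 * 1" by (intro mult_mono abs_levi_le) auto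
    then have "(\<bar>levi a p q\<bar> * \<bar>levi b l m\<bar>) * \<bar>F p q l m\<bar> \<le> 1 * B" by (intro mult_mono assms) auto
    then show ?thesis by (simp add: abs_mult)
  qed
  then have "(\<Sum>p\<in>UNIV. \<Sum>q\<in>UNIV. \<Sum>l\<in>UNIV. \<Sum>m\<in>UNIV. \<bar>levi a p q * levi b l m * F p q l m\<bar>)
      \<le> (\<Sum>p\<in>(UNIV::3 set). \<Sum>q\<in>(UNIV::3 set). \<Sum>l\<in>(UNIV::3 set). \<Sum>m\<in>(UNIV::3 set). B)"
    by (intro sum_mono)
  moreover have "\<bar>\<Sum>p\<in>UNIV. \<Sum>q\<in>UNIV. \<Sum>l\<in>UNIV. \<Sum>m\<in>UNIV. levi a p q * levi b l m * F p q l m\<bar>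
      \<le> (\<Sum>p\<in>UNIV. \<Sum>q\<in>UNIV. \<Sum>l\<in>UNIV. \<Sum>m\<in>UNIV. \<bar>levi a p q * levi b l m * F p q l m\<bar>)"
    by (intro order_trans[OF sum_abs] sum_mono order_refl)
  ultimately show ?thesis by simp
qed

definition cut :: "sfield \<Rightarrow> mfield \<Rightarrow> mfield" where
  "cut \<zeta> g i j x = \<zeta> x * g i j x"

lemma test_derivatives_bounded:
  assumes "test UNIV \<zeta>"
  obtains B where "0 \<le> B" "\<And>x. \<bar>\<zeta> x\<bar> \<le> B" "\<And>i x. \<bar>pd i \<zeta> x\<bar> \<le> B" "\<And>i j x. \<bar>pd i (pd j \<zeta>) x\<bar> \<le> B"
proof -
  obtain B0 where B0: "B0 \<ge> 0" "\<And>x. \<bar>\<zeta> x\<bar> \<le> B0" using test_bounded[OF assms] by blast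
  have "\<exists>B\<ge>0. \<forall>x. \<bar>pd i \<zeta> x\<bar> \<le> B" for i using test_bounded[OF test_pd[OF assms]] by metis
  then obtain B1 where B1: "\<And>i. B1 i \<ge> 0" "\<And>i x. \<bar>pd i \<zeta> x\<bar> \<le> B1 i" by metis
  have "\<exists>B\<ge>0. \<forall>x. \<bar>pd i (pd j \<zeta>) x\<bar> \<le> B" for i j using test_bounded[OF test_pd[OF test_pd[OF assms]]] by metis
  then obtain B2 where B2: "\<And>i j. B2 i j \<ge> 0" "\<And>i j x. \<bar>pd i (pd j \<zeta>) x\<bar> \<le> B2 i j" by metis
  have 1: "B1 i \<le> (\<Sum>i\<in>UNIV. B1 i)" for i by (rule member_le_sum) (auto simp: B1)
  have 2: "B2 i j \<le> (\<Sum>i\<in>UNIV. \<Sum>j\<in>UNIV. B2 i j)" for i j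
    by (rule order_trans[OF member_le_sum[where f = "B2 i" and A = UNIV] member_le_sum[where f = "\<lambda>i. \<Sum>j\<in>UNIV. B2 i j"]])
      (auto simp: B2 sum_nonneg)
  have nn: "0 \<le> (\<Sum>i\<in>UNIV. B1 i)" "0 \<le> (\<Sum>i\<in>UNIV. \<Sum>j\<in>UNIV. B2 i j)" by (auto intro!: sum_nonneg B1 B2)
  show thesis
  proof (rule that[of "B0 + (\<Sum>i\<in>UNIV. B1 i) + (\<Sum>i\<in>UNIV. \<Sum>j\<in>UNIV. B2 i j)"])
    show "\<bar>\<zeta> x\<bar> \<le> B0 + (\<Sum>i\<in>UNIV. B1 i) + (\<Sum>i\<in>UNIV. \<Sum>j\<in>UNIV. B2 i j)" for x
      using B0(2)[of x] nn by linarith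
    show "\<bar>pd i \<zeta> x\<bar> \<le> B0 + (\<Sum>i\<in>UNIV. B1 i) + (\<Sum>i\<in>UNIV. \<Sum>j\<in>UNIV. B2 i j)" for i x
      using B1(2)[of i x] 1[of i] B0(1) nn by linarith
    show "\<bar>pd i (pd j \<zeta>) x\<bar> \<le> B0 + (\<Sum>i\<in>UNIV. B1 i) + (\<Sum>i\<in>UNIV. \<Sum>j\<in>UNIV. B2 i j)" for i j x
      using B2(2)[of i j x] 2[of i j] B0(1) nn by linarith
  qed (use B0(1) nn in linarith)
qed

text \<open>Testing inc of \<open>\<zeta>\<close> times \<open>g\<close> with \<open>\<phi>\<close>
  is testing inc \<open>g\<close> with \<open>\<zeta>\<close> times \<open>\<phi>\<close>, up to
  terms in which at least one derivative falls on \<open>\<zeta>\<close>. Those contain at most one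
  derivative of \<open>\<phi>\<close> and pair with \<open>g\<close> in L2.\<close>

lemma cut_bound:
  assumes \<zeta>: "test UNIV \<zeta>"
  obtains C where "0 \<le> C"
    "\<And>g i j. g \<in> Hcc \<Omega> \<Longrightarrow> L2norm (cut \<zeta> g i j) \<le> C * Hccnorm g"
    "\<And>g c d \<phi>. g \<in> Hcc \<Omega> \<Longrightarrow> test UNIV \<phi> \<Longrightarrow> \<bar>incD (cut \<zeta> g) c d \<phi>\<bar> \<le> C * Hccnorm g * H1norm_test \<phi>"
proof -
  obtain B where B: "0 \<le> B" "\<And>x. \<bar>\<zeta> x\<bar> \<le> B" "\<And>i x. \<bar>pd i \<zeta> x\<bar> \<le> B" "\<And>i j x. \<bar>pd i (pd j \<zeta>) x\<bar> \<le> B"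
    using test_derivatives_bounded[OF \<zeta>] by blast
  have m: "\<zeta> \<in> borel_measurable borel" "pd i \<zeta> \<in> borel_measurable borel" "pd i (pd j \<zeta>) \<in> borel_measurable borel" for i j
    by (rule test_measurable[OF \<zeta>] test_measurable[OF test_pd[OF \<zeta>]] test_measurable[OF test_pd[OF test_pd[OF \<zeta>]]])+
  have \<zeta>s: "smooth \<zeta>" by (rule test_smooth[OF \<zeta>])
  \<comment> \<open>One constant serves both estimates. It comes from the second: 250 = 81 * 3 + 7,
    with 81 Levi-Civita terms of three products each, and 7 = 1 + 3 * 2 from the H^1 norm of
    \<open>\<zeta>\<close> times \<open>\<phi>\<close>.\<close>
  have L2c: "L2norm (cut \<zeta> g i j) \<le> (250 * B) * Hccnorm g" if g: "g \<in> Hcc \<Omega>" for g i j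
  proof -
    have "L2norm (cut \<zeta> g i j) \<le> B * L2norm (g i j)"
      unfolding cut_def[abs_def] by (rule L2_mult_bounded(2)[OF HccD(1)[OF g] m(1) B(2)])
    also have "\<dots> \<le> (250 * B) * Hccnorm g" using B(1) by (intro mult_mono Hccnorm_ge) auto
    finally show ?thesis .
  qed
  have incc: "\<bar>incD (cut \<zeta> g) c d \<phi>\<bar> \<le> (250 * B) * Hccnorm g * H1norm_test \<phi>"
    if g: "g \<in> Hcc \<Omega>" and \<phi>: "test UNIV \<phi>" for g c d \<phi>
  proof -
    define N where "N = H1norm_test \<phi>"
    define G where "G = Hccnorm g"
    have N0: "0 \<le> N" and G0: "0 \<le> G" by (simp_all add: N_def G_def Hccnorm_ge)
    have \<phi>s: "smooth \<phi>" by (rule test_smooth[OF \<phi>])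
    have \<phi>L: "\<phi> \<in> L2" "pd i \<phi> \<in> L2" for i by (rule test_L2[OF \<phi>] test_L2[OF test_pd[OF \<phi>]])+
    have \<phi>N: "L2norm \<phi> \<le> N" "L2norm (pd i \<phi>) \<le> N" for i unfolding N_def by (rule L2norm_le_H1norm_test)+
    have mb: "(\<lambda>x. f x * h x) \<in> L2 \<and> L2norm (\<lambda>x. f x * h x) \<le> B * N"
      if "h \<in> L2" "L2norm h \<le> N" "f \<in> borel_measurable borel" "\<And>x. \<bar>f x\<bar> \<le> B" for f h
      using L2_mult_bounded[OF that(1,3,4)] mult_left_mono[OF that(2) B(1)] by auto
    \<comment> \<open>The part of the second derivative of the product in which
      \<open>\<zeta>\<close> is differentiated.\<close>
    define Z where "Z p l x = pd p (pd l \<zeta>) x * \<phi> x + (pd l \<zeta> x * pd p \<phi> x + pd p \<zeta> x * pd l \<phi> x)" for p l x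
    have Z: "Z p l \<in> L2 \<and> L2norm (Z p l) \<le> 3 * (B * N)" for p l
    proof -
      have z: "(\<lambda>x. pd p (pd l \<zeta>) x * \<phi> x) \<in> L2 \<and> L2norm (\<lambda>x. pd p (pd l \<zeta>) x * \<phi> x) \<le> B * N"
        "(\<lambda>x. pd l \<zeta> x * pd p \<phi> x) \<in> L2 \<and> L2norm (\<lambda>x. pd l \<zeta> x * pd p \<phi> x) \<le> B * N"
        "(\<lambda>x. pd p \<zeta> x * pd l \<phi> x) \<in> L2 \<and> L2norm (\<lambda>x. pd p \<zeta> x * pd l \<phi> x) \<le> B * N"
        by (intro mb \<phi>L \<phi>N m B)+
      have "L2norm (Z p l) \<le> L2norm (\<lambda>x. pd p (pd l \<zeta>) x * \<phi> x) + (L2norm (\<lambda>x. pd l \<zeta> x * pd p \<phi> x) + L2norm (\<lambda>x. pd p \<zeta> x * pd l \<phi> x))"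
        unfolding Z_def[abs_def] using z
        by (intro order_trans[OF L2norm_triangle] add_mono L2norm_triangle order_refl L2_add) auto
      then show ?thesis using z unfolding Z_def[abs_def] by (auto intro!: L2_add)
    qed
    have prod: "pd l (\<lambda>x. \<zeta> x * \<phi> x) = (\<lambda>x. pd l \<zeta> x * \<phi> x + \<zeta> x * pd l \<phi> x)" for l
      by (rule pd_mult_smooth[OF \<zeta>s \<phi>s])
    have prod2: "pd p (pd l (\<lambda>x. \<zeta> x * \<phi> x)) x = \<zeta> x * pd p (pd l \<phi>) x + Z p l x" for p l x
      unfolding prod by (simp add: pd_add_smooth smooth_mult smooth_pd \<zeta>s \<phi>s pd_mult_smooth Z_def)
    have \<zeta>\<phi>: "test UNIV (\<lambda>x. \<zeta> x * \<phi> x)" by (rule test_mult_smooth(1)[OF \<zeta> \<phi>s])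
    have H1: "H1norm_test (\<lambda>x. \<zeta> x * \<phi> x) \<le> 7 * (B * N)"
    proof -
      have "L2norm (pd j (\<lambda>x. \<zeta> x * \<phi> x)) \<le> 2 * (B * N)" for j
      proof -
        have z: "(\<lambda>x. pd j \<zeta> x * \<phi> x) \<in> L2 \<and> L2norm (\<lambda>x. pd j \<zeta> x * \<phi> x) \<le> B * N"
          "(\<lambda>x. \<zeta> x * pd j \<phi> x) \<in> L2 \<and> L2norm (\<lambda>x. \<zeta> x * pd j \<phi> x) \<le> B * N"
          by (intro mb \<phi>L \<phi>N m B)+
        then have "L2norm (\<lambda>x. pd j \<zeta> x * \<phi> x + \<zeta> x * pd j \<phi> x) \<le> L2norm (\<lambda>x. pd j \<zeta> x * \<phi> x) + L2norm (\<lambda>x. \<zeta> x * pd j \<phi> x)"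
          by (intro L2norm_triangle) auto
        then show ?thesis using z unfolding prod by linarith
      qed
      then have "(\<Sum>j\<in>UNIV. L2norm (pd j (\<lambda>x. \<zeta> x * \<phi> x))) \<le> (\<Sum>j\<in>(UNIV::3 set). 2 * (B * N))" by (intro sum_mono)
      moreover have "L2norm (\<lambda>x. \<zeta> x * \<phi> x) \<le> B * N" using mb[OF \<phi>L(1) \<phi>N(1) m(1) B(2)] by simp
      ultimately show ?thesis using H1norm_test_le[of "\<lambda>x. \<zeta> x * \<phi> x"] by simp
    qed
    have gL: "g i j \<in> L2" for i j by (rule HccD(1)[OF g])
    have split: "integral\<^sup>L lborel (\<lambda>x. cut \<zeta> g m q x * pd p (pd l \<phi>) x)
      = integral\<^sup>L lborel (\<lambda>x. g m q x * pd p (pd l (\<lambda>x. \<zeta> x * \<phi> x)) x) - ip (g m q) (Z p l)" for m q p l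
    proof -
      have "integral\<^sup>L lborel (\<lambda>x. cut \<zeta> g m q x * pd p (pd l \<phi>) x)
        = integral\<^sup>L lborel (\<lambda>x. g m q x * pd p (pd l (\<lambda>x. \<zeta> x * \<phi> x)) x - g m q x * Z p l x)"
        by (rule Bochner_Integration.integral_cong[OF refl]) (simp only: cut_def prod2, simp add: algebra_simps)
      also have "\<dots> = integral\<^sup>L lborel (\<lambda>x. g m q x * pd p (pd l (\<lambda>x. \<zeta> x * \<phi> x)) x) - integral\<^sup>L lborel (\<lambda>x. g m q x * Z p l x)"
        using L2_mult_integrable[OF gL test_L2[OF test_pd[OF test_pd[OF \<zeta>\<phi>]]], of m q p l] L2_mult_integrable[OF gL conjunct1[OF Z], of m q p l]
        by (rule Bochner_Integration.integral_diff)
      finally show ?thesis by (simp add: ip_def)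
    qed
    have "incD (cut \<zeta> g) c d \<phi> = incD g c d (\<lambda>x. \<zeta> x * \<phi> x)
      - (\<Sum>p\<in>UNIV. \<Sum>q\<in>UNIV. \<Sum>l\<in>UNIV. \<Sum>m\<in>UNIV. levi c p q * levi d l m * ip (g m q) (Z p l))"
      unfolding incD_def split by (simp only: right_diff_distrib sum_subtractf)
    moreover have "\<bar>\<Sum>p\<in>UNIV. \<Sum>q\<in>UNIV. \<Sum>l\<in>UNIV. \<Sum>m\<in>UNIV. levi c p q * levi d l m * ip (g m q) (Z p l)\<bar> \<le> 81 * (G * (3 * (B * N)))"
    proof (rule levi_sum_le)
      fix p q l m
      have "\<bar>ip (g m q) (Z p l)\<bar> \<le> L2norm (g m q) * L2norm (Z p l)" by (rule L2_Cauchy_Schwarz[OF gL]) (simp add: Z)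
      also have "\<dots> \<le> G * (3 * (B * N))" unfolding G_def using Z[of p l] by (intro mult_mono Hccnorm_ge) auto
      finally show "\<bar>ip (g m q) (Z p l)\<bar> \<le> G * (3 * (B * N))" .
    qed
    moreover have "\<bar>incD g c d (\<lambda>x. \<zeta> x * \<phi> x)\<bar> \<le> G * (7 * (B * N))"
    proof -
      have "\<bar>incD g c d (\<lambda>x. \<zeta> x * \<phi> x)\<bar> \<le> Hm1norm (incD g c d) * H1norm_test (\<lambda>x. \<zeta> x * \<phi> x)"
        by (rule incD_le_Hm1norm[OF g \<zeta>\<phi>])
      also have "\<dots> \<le> G * (7 * (B * N))" unfolding G_def by (intro mult_mono Hccnorm_ge H1) auto
      finally show ?thesis .
    qed
    ultimately have "\<bar>incD (cut \<zeta> g) c d \<phi>\<bar> \<le> 81 * (G * (3 * (B * N))) + G * (7 * (B * N))" by linarith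
    also have "\<dots> = (250 * B) * G * N" by (simp add: algebra_simps)
    finally show ?thesis by (simp add: G_def N_def)
  qed
  show thesis by (rule that[of "250 * B"]) (use B(1) L2c incc in auto)
qed

section \<open>L2 limits, uniqueness of weak derivatives, and passage from \<open>h1seq\<close> to
  \<open>H10\<close>\<close>

section \<open>Limits in \<open>H\<^sup>1\<close>\<close>

definition L2_tendsto :: "(nat \<Rightarrow> sfield) \<Rightarrow> sfield \<Rightarrow> bool" where
  "L2_tendsto F u \<longleftrightarrow> (\<forall>n. F n \<in> L2) \<and> u \<in> L2 \<and> (\<lambda>n. L2norm (\<lambda>x. F n x - u x)) \<longlonglongrightarrow> 0"

lemma L2_tendsto_add:
  assumes "L2_tendsto F u" "L2_tendsto G v" shows "L2_tendsto (\<lambda>n x. F n x + G n x) (\<lambda>x. u x + v x)"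
proof -
  have lim: "(\<lambda>n. L2norm (\<lambda>x. F n x - u x) + L2norm (\<lambda>x. G n x - v x)) \<longlonglongrightarrow> 0"
    using tendsto_add[of "\<lambda>n. L2norm (\<lambda>x. F n x - u x)" 0 sequentially "\<lambda>n. L2norm (\<lambda>x. G n x - v x)" 0] assms by (simp add: L2_tendsto_def)
  have "L2norm (\<lambda>x. F n x + G n x - (u x + v x)) \<le> L2norm (\<lambda>x. F n x - u x) + L2norm (\<lambda>x. G n x - v x)" for n
  proof -
    have "L2norm (\<lambda>x. (F n x - u x) + (G n x - v x)) \<le> L2norm (\<lambda>x. F n x - u x) + L2norm (\<lambda>x. G n x - v x)"
      by (rule L2norm_triangle) (use assms in \<open>auto simp: L2_tendsto_def\<close>)
    then show ?thesis by (simp add: algebra_simps)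
  qed
  then have "(\<lambda>n. L2norm (\<lambda>x. F n x + G n x - (u x + v x))) \<longlonglongrightarrow> 0"
    by (intro tendsto_sandwich[OF _ _ tendsto_const lim]) auto
  then show ?thesis using assms by (auto simp: L2_tendsto_def)
qed

lemma L2_tendsto_cmult: assumes "L2_tendsto F u" shows "L2_tendsto (\<lambda>n x. c * F n x) (\<lambda>x. c * u x)"
proof -
  have "L2norm (\<lambda>x. c * F n x - c * u x) = \<bar>c\<bar> * L2norm (\<lambda>x. F n x - u x)" for n
    using L2norm_cmult[of c "\<lambda>x. F n x - u x"] by (simp add: right_diff_distrib)
  then show ?thesis using assms by (auto simp: L2_tendsto_def intro: tendsto_mult_right_zero)
qed

lemma L2_tendsto_zero: "L2_tendsto (\<lambda>n x. 0) (\<lambda>x. 0)" by (simp add: L2_tendsto_def)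

lemma L2_tendsto_sum: "(\<And>i. i \<in> I \<Longrightarrow> L2_tendsto (F i) (u i)) \<Longrightarrow> L2_tendsto (\<lambda>n x. \<Sum>i\<in>I. F i n x) (\<lambda>x. \<Sum>i\<in>I. u i x)"
  by (induction I rule: infinite_finite_induct) (auto simp: L2_tendsto_zero intro: L2_tendsto_add)

lemma L2_tendsto_unique: "L2_tendsto F u \<Longrightarrow> L2_tendsto F v \<Longrightarrow> AE x in lborel. u x = v x"
  unfolding L2_tendsto_def by (rule L2_limit_unique[of F]) auto

lemma L2_tendsto_norm_le:
  assumes "L2_tendsto F u" "\<And>n. L2norm (F n) \<le> B" shows "L2norm u \<le> B"
proof -
  have L: "F n \<in> L2" "(\<lambda>x. F n x - u x) \<in> L2" for n using assms(1) by (auto simp: L2_tendsto_def)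
  have "L2norm u \<le> B + L2norm (\<lambda>x. F n x - u x)" for n
    using L2norm_triangle_diff[OF L, of n n] assms(2)[of n] by simp
  moreover have "(\<lambda>n. B + L2norm (\<lambda>x. F n x - u x)) \<longlonglongrightarrow> B + 0"
    using assms(1) by (intro tendsto_intros) (simp add: L2_tendsto_def)
  ultimately show ?thesis using LIMSEQ_le_const[of "\<lambda>n. B + L2norm (\<lambda>x. F n x - u x)" B "L2norm u"] by auto
qed

lemma L2_tendsto_ip:
  assumes "L2_tendsto F u" "h \<in> L2" shows "(\<lambda>n. ip (F n) h) \<longlonglongrightarrow> ip u h"
proof -
  have L: "F n \<in> L2" "u \<in> L2" for n using assms by (auto simp: L2_tendsto_def)
  have "(\<lambda>n. L2norm (\<lambda>x. F n x - u x) * L2norm h) \<longlonglongrightarrow> 0"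
    using assms(1) by (intro tendsto_mult_left_zero) (simp add: L2_tendsto_def)
  then have "(\<lambda>n. ip (F n) h - ip u h) \<longlonglongrightarrow> 0"
  proof (rule Lim_null_comparison[rotated])
    show "\<forall>\<^sub>F n in sequentially. norm (ip (F n) h - ip u h) \<le> L2norm (\<lambda>x. F n x - u x) * L2norm h"
      using L2_Cauchy_Schwarz[OF L2_diff[OF L] assms(2)] ip_diff[OF L assms(2)] by simp
  qed
  then show ?thesis by (simp add: LIM_zero_iff)
qed

lemma mollifier_exists: obtains K where "test UNIV K" "integral\<^sup>L lborel K = 1"
proof -
  have "norm x \<le> 3" if "\<forall>i. 1/4 \<le> (axis i 1 :: real^3) \<bullet> x \<and> axis i 1 \<bullet> x \<le> 1" for x
  proof -
    have "1/4 \<le> x $ i" "x $ i \<le> 1" for i using that by (auto simp: inner_axis')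
    from this[of 1] this[of 2] this[of 3] show ?thesis using norm_le_sum3[of x] by linarith
  qed
  then have "bounded {x. \<forall>i. 1/4 \<le> (axis i 1 :: real^3) \<bullet> x \<and> axis i 1 \<bullet> x \<le> 1}"
    by (intro boundedI[of _ 3]) auto
  moreover have "(axis i 1 :: real^3) \<bullet> axis j 1 = (if i = j then 1 else 0)" for i j by (simp add: inner_axis_axis)
  ultimately show thesis using kernels_exist[of "\<lambda>i. axis i 1" "\<lambda>i. axis i 1"] that by metis
qed

text \<open>Every value of a mollification of \<open>f\<close> is, up to a factor, the pairing of
  \<open>f\<close> with a reflected and translated copy of the kernel, hence zero; and the
  mollifications converge to \<open>f\<close>.\<close>

lemma fundamental_lemma:
  assumes f: "f \<in> L2" and 0: "\<And>\<phi>. test UNIV \<phi> \<Longrightarrow> ip f \<phi> = 0"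
  shows "AE x in lborel. f x = 0"
proof -
  obtain K where K: "test UNIV K" "integral\<^sup>L lborel K = 1" by (rule mollifier_exists)
  have [measurable]: "K \<in> borel_measurable borel" "f \<in> borel_measurable borel"
    by (rule test_measurable[OF K(1)] L2_measurable[OF f])+
  have "cv K s f x = 0" if s: "s > 0" for s x
  proof -
    define \<phi> where "\<phi> y = K ((1 / s) *\<^sub>R x + (- 1 / s) *\<^sub>R y)" for y
    have t: "test UNIV \<phi>" unfolding \<phi>_def[abs_def] by (rule test_affine[OF K(1)]) (use s in simp)
    have [measurable]: "\<phi> \<in> borel_measurable borel" by (rule test_measurable[OF t])
    have "ip f \<phi> = \<bar>- s\<bar> ^ 3 * integral\<^sup>L lborel (\<lambda>z. f (x + (- s) *\<^sub>R z) * \<phi> (x + (- s) *\<^sub>R z))"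
      unfolding ip_def by (rule integral_affine) (use s in auto)
    also have "(\<lambda>z. f (x + (- s) *\<^sub>R z) * \<phi> (x + (- s) *\<^sub>R z)) = (\<lambda>z. K z * f (x - s *\<^sub>R z))"
      using s by (auto simp: \<phi>_def algebra_simps)
    finally show ?thesis using 0[OF t] s by (simp add: cv_def)
  qed
  then have "(\<lambda>n. cv K ((1/2) ^ n) f) = (\<lambda>n x. 0)" by (auto intro!: ext)
  then have "(\<lambda>n::nat. L2norm (\<lambda>x. 0 - f x)) \<longlonglongrightarrow> 0" using cv_tendsto[OF K f] by (simp add: fun_eq_iff)
  then have "L2norm (\<lambda>x. 0 - f x) = 0" using LIMSEQ_unique[OF tendsto_const] by blast
  then have "L2norm f = 0" using L2norm_minus[of "\<lambda>x. 0" f] by simp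
  then show ?thesis by (rule L2norm_AE_zero[OF f])
qed

text \<open>The choice depends on the sequence only, so symmetric sequences have equal limits everywhere,
  not just almost everywhere.\<close>

definition L2lim :: "(real^3) set \<Rightarrow> (nat \<Rightarrow> sfield) \<Rightarrow> sfield" where
  "L2lim \<Omega> F = (SOME u. u \<in> L2Om \<Omega> \<and> L2_tendsto F u)"

lemma L2lim_eq:
  assumes "L2_tendsto F u" "u \<in> L2Om \<Omega>"
  shows "L2_tendsto F (L2lim \<Omega> F)" "L2lim \<Omega> F \<in> L2Om \<Omega>" "AE x in lborel. L2lim \<Omega> F x = u x"
proof -
  have "L2lim \<Omega> F \<in> L2Om \<Omega> \<and> L2_tendsto F (L2lim \<Omega> F)"
    unfolding L2lim_def by (rule someI[of "\<lambda>u. u \<in> L2Om \<Omega> \<and> L2_tendsto F u" u]) (use assms in simp)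
  then show "L2_tendsto F (L2lim \<Omega> F)" "L2lim \<Omega> F \<in> L2Om \<Omega>" by auto
  then show "AE x in lborel. L2lim \<Omega> F x = u x" using L2_tendsto_unique assms(1) by blast
qed

lemma bounded_Cauchy_limit:
  assumes "bounded_Cauchy B F" obtains u where "L2_tendsto F u" "\<And>x. (\<And>n. F n x = 0) \<Longrightarrow> u x = 0"
proof -
  have L: "F n \<in> L2" and C: "L2_Cauchy F" for n using assms by (auto simp: bounded_Cauchy_def)
  obtain u where "u \<in> L2" "(\<lambda>n. L2norm (\<lambda>x. F n x - u x)) \<longlonglongrightarrow> 0" "\<forall>x. (\<forall>n. F n x = 0) \<longrightarrow> u x = 0"
    using L2_complete[OF L C] by blast
  then show thesis using L by (intro that[of u]) (simp_all add: L2_tendsto_def)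
qed

text \<open>The limits of the derivatives are weak derivatives of the limit, since integration by
  parts passes to the limit. This ties the abstract choice \<open>wderiv\<close> to a concrete
  sequence.\<close>

lemma h1seq_L2lim:
  assumes F: "h1seq \<Omega> B F"
  shows "L2_tendsto F (L2lim \<Omega> F)" "L2lim \<Omega> F \<in> L2Om \<Omega>" "L2lim \<Omega> F \<in> H10 \<Omega>"
    and "L2_tendsto (\<lambda>n. pd c (F n)) (wderiv c (L2lim \<Omega> F))" "H1norm (L2lim \<Omega> F) \<le> 2 * B"
proof -
  define U where "U = L2lim \<Omega> F"
  have t: "test \<Omega> (F n)" for n using F by (simp add: h1seq_def)
  have t': "test UNIV (F n)" for n by (rule test_mono[OF t]) simp
  have b: "bounded_Cauchy B F" "bounded_Cauchy B (\<lambda>n. pd c (F n))" for c using F by (auto simp: h1seq_def)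
  have B0: "0 \<le> B" using b(1) L2norm_nonneg[of "F 0"] unfolding bounded_Cauchy_def by (meson order_trans)
  obtain u where u: "L2_tendsto F u" "\<And>x. (\<And>n. F n x = 0) \<Longrightarrow> u x = 0" using bounded_Cauchy_limit[OF b(1)] by blast
  have "F n x = 0" if "x \<notin> \<Omega>" for n x using t[of n] that by (meson subsetD test_support)
  then have "u \<in> L2Om \<Omega>" using u by (simp add: L2Om_def L2_tendsto_def)
  from L2lim_eq[OF u(1) this] have U: "L2_tendsto F U" "U \<in> L2Om \<Omega>" by (auto simp: U_def)
  have "\<exists>v. L2_tendsto (\<lambda>n. pd c (F n)) v" for c using bounded_Cauchy_limit[OF b(2)] by blast
  then obtain v where v: "\<And>c. L2_tendsto (\<lambda>n. pd c (F n)) (v c)" by metis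
  have wd: "is_wderiv c U (v c)" for c
    unfolding is_wderiv_def
  proof (intro conjI allI impI)
    show "v c \<in> L2" using v by (simp add: L2_tendsto_def)
    fix \<phi> assume \<phi>: "test UNIV \<phi>"
    have "(\<lambda>n. ip (F n) (pd c \<phi>)) \<longlonglongrightarrow> ip U (pd c \<phi>)" by (rule L2_tendsto_ip[OF U(1) test_L2[OF test_pd[OF \<phi>]]])
    moreover have "ip (F n) (pd c \<phi>) = - ip (pd c (F n)) \<phi>" for n
      unfolding ip_def by (rule integration_by_parts[OF t' test_smooth[OF \<phi>]])
    ultimately have "(\<lambda>n. - ip (pd c (F n)) \<phi>) \<longlonglongrightarrow> ip U (pd c \<phi>)" by simp
    moreover have "(\<lambda>n. - ip (pd c (F n)) \<phi>) \<longlonglongrightarrow> - ip (v c) \<phi>" by (intro tendsto_minus L2_tendsto_ip[OF v test_L2[OF \<phi>]])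
    ultimately have "ip U (pd c \<phi>) = - ip (v c) \<phi>" by (rule LIMSEQ_unique)
    then show "integral\<^sup>L lborel (\<lambda>x. U x * pd c \<phi> x) = - integral\<^sup>L lborel (\<lambda>x. v c x * \<phi> x)" by (simp add: ip_def)
  qed
  have w: "L2_tendsto (\<lambda>n. pd c (F n)) (wderiv c U)" for c
  proof -
    \<comment> \<open>The weak derivative picked by \<open>SOME\<close> may differ from
      \<open>v c\<close>, but by the fundamental lemma only on a null set.\<close>
    have w': "is_wderiv c U (wderiv c U)" unfolding wderiv_def by (rule someI[of "is_wderiv c U", OF wd])
    have L: "wderiv c U \<in> L2" "v c \<in> L2" using w' v by (auto simp: is_wderiv_def L2_tendsto_def)
    have "AE x in lborel. wderiv c U x - v c x = 0"
    proof (rule fundamental_lemma)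
      show "ip (\<lambda>x. wderiv c U x - v c x) \<phi> = 0" if "test UNIV \<phi>" for \<phi>
        using w' wd[of c] that by (simp add: ip_diff[OF L test_L2[OF that]]) (simp add: ip_def is_wderiv_def)
    qed (use L in auto)
    then have ae: "AE x in lborel. wderiv c U x = v c x" by simp
    have "L2norm (\<lambda>x. pd c (F n) x - wderiv c U x) = L2norm (\<lambda>x. pd c (F n) x - v c x)" for n
      using v[of c] L ae by (intro L2norm_cong_AE) (auto simp: L2_tendsto_def)
    then show ?thesis using v[of c] L by (simp add: L2_tendsto_def)
  qed
  show "L2_tendsto F (L2lim \<Omega> F)" "L2lim \<Omega> F \<in> L2Om \<Omega>" "L2_tendsto (\<lambda>n. pd c (F n)) (wderiv c (L2lim \<Omega> F))"
    using U w by (auto simp: U_def)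
  show "L2lim \<Omega> F \<in> H10 \<Omega>" unfolding H10_def U_def[symmetric]
    using U v t by (auto simp: L2_tendsto_def intro!: exI[of _ v] exI[of _ F])
  have "L2norm U \<le> B" using L2_tendsto_norm_le[OF U(1)] b(1) by (auto simp: bounded_Cauchy_def)
  moreover have "L2norm (wderiv c U) \<le> B" for c using L2_tendsto_norm_le[OF w] b(2)[of c] by (auto simp: bounded_Cauchy_def)
  ultimately have "(L2norm U)\<^sup>2 + (\<Sum>j\<in>UNIV. (L2norm (wderiv j U))\<^sup>2) \<le> B\<^sup>2 + (\<Sum>j\<in>(UNIV::3 set). B\<^sup>2)"
    by (intro add_mono sum_mono power_mono) auto
  \<comment> \<open>The function and its three derivatives contribute four equal squares.\<close>
  also have "\<dots> = (2 * B)\<^sup>2" by (simp add: power_mult_distrib)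
  finally show "H1norm (L2lim \<Omega> F) \<le> 2 * B"
    unfolding U_def[symmetric] H1norm_def using B0 by (intro real_le_lsqrt) auto
qed

section \<open>Gluing the local decompositions\<close>

section \<open>The global decomposition\<close>

definition field_in :: "(real^3) set \<Rightarrow> mfield \<Rightarrow> bool" where
  "field_in D g \<longleftrightarrow> (\<forall>i j. g i j \<in> L2 \<and> (\<forall>x. x \<notin> D \<longrightarrow> g i j x = 0) \<and> g i j = g j i)"

text \<open>The relation \<open>bd\<close> states which numbers count as a bound for a field:
  \<open>graph_bound\<close> for the local pieces, equality with \<open>Hccnorm\<close> for the
  glued construction.\<close>

definition decomposes :: "(real^3) set \<Rightarrow> mfield set \<Rightarrow> (mfield \<Rightarrow> real \<Rightarrow> bool) \<Rightarrow>
    (mfield \<Rightarrow> nat \<Rightarrow> mfield) \<Rightarrow> (mfield \<Rightarrow> nat \<Rightarrow> vfield) \<Rightarrow> real \<Rightarrow> bool" where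
  "decomposes U X bd S W C \<longleftrightarrow> 0 \<le> C \<and>
    (\<forall>g\<in>X. \<forall>N i j. S g N i j = S g N j i) \<and>
    (\<forall>g\<in>X. \<forall>i j. L2_tendsto (\<lambda>N x. S g N i j x + (pd i (W g N j) x + pd j (W g N i) x) / 2) (g i j)) \<and>
    (\<forall>g\<in>X. \<forall>M. bd g M \<longrightarrow> (\<forall>i j. h1seq U (C * M) (\<lambda>N. S g N i j)) \<and> (\<forall>l. h1seq U (C * M) (\<lambda>N. W g N l))) \<and>
    (\<forall>g\<in>X. \<forall>h\<in>X. \<forall>a b N.
       (\<forall>i j x. S (\<lambda>i j x. a * g i j x + b * h i j x) N i j x = a * S g N i j x + b * S h N i j x) \<and>
       (\<forall>l x. W (\<lambda>i j x. a * g i j x + b * h i j x) N l x = a * W g N l x + b * W h N l x))"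

lemma decomposesD:
  assumes "decomposes U X bd S W C"
  shows "0 \<le> C" "g \<in> X \<Longrightarrow> S g N i j = S g N j i"
    "g \<in> X \<Longrightarrow> L2_tendsto (\<lambda>N x. S g N i j x + (pd i (W g N j) x + pd j (W g N i) x) / 2) (g i j)"
    "g \<in> X \<Longrightarrow> bd g M \<Longrightarrow> h1seq U (C * M) (\<lambda>N. S g N i j)"
    "g \<in> X \<Longrightarrow> bd g M \<Longrightarrow> h1seq U (C * M) (\<lambda>N. W g N l)"
    "g \<in> X \<Longrightarrow> h \<in> X \<Longrightarrow> S (\<lambda>i j x. a * g i j x + b * h i j x) N i j x = a * S g N i j x + b * S h N i j x"
    "g \<in> X \<Longrightarrow> h \<in> X \<Longrightarrow> W (\<lambda>i j x. a * g i j x + b * h i j x) N l x = a * W g N l x + b * W h N l x"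
  using assms unfolding decomposes_def by simp_all

text \<open>Bounds inc on test functions instead of through \<open>Hm1norm\<close>, so no supremum
  has to be evaluated for cut off fields.\<close>

definition graph_bound :: "mfield \<Rightarrow> real \<Rightarrow> bool" where
  "graph_bound g M \<longleftrightarrow> (\<forall>i j. L2norm (g i j) \<le> M) \<and>
    (\<forall>c d \<phi>. test UNIV \<phi> \<longrightarrow> \<bar>incD g c d \<phi>\<bar> \<le> M * H1norm_test \<phi>)"

lemma local_decomposition:
  assumes "local_kernels \<omega> \<theta> Q D U"
  shows "\<exists>S W C. decomposes U {g. field_in D g} graph_bound S W C"
proof -
  interpret local_kernels \<omega> \<theta> Q D U by fact
  have sf: "supp_field g" if "field_in D g" for g using that by (auto simp: supp_field_def supp_D_def field_in_def)
  define C where "C = (\<Sum>k\<in>UNIV. \<Sum>l\<in>UNIV. \<bar>S_const k l\<bar>) + (\<Sum>l\<in>UNIV. \<bar>W_const l\<bar>)"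
  have nn: "0 \<le> (\<Sum>k\<in>UNIV. \<Sum>l\<in>UNIV. \<bar>S_const k l\<bar>)" "0 \<le> (\<Sum>l\<in>UNIV. \<bar>W_const l\<bar>)" by (auto intro!: sum_nonneg)
  have "\<bar>S_const k l\<bar> \<le> (\<Sum>k\<in>UNIV. \<Sum>l\<in>UNIV. \<bar>S_const k l\<bar>)" for k l
    by (rule order_trans[OF member_le_sum[where f = "\<lambda>l. \<bar>S_const k l\<bar>" and A = UNIV] member_le_sum[where f = "\<lambda>k. \<Sum>l\<in>UNIV. \<bar>S_const k l\<bar>"]])
      (auto simp: sum_nonneg)
  then have CS: "S_const k l \<le> C" for k l using nn(2) unfolding C_def by (smt (verit))
  have "\<bar>W_const l\<bar> \<le> (\<Sum>l\<in>UNIV. \<bar>W_const l\<bar>)" for l by (rule member_le_sum) auto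
  then have CW: "W_const l \<le> C" for l using nn(1) unfolding C_def by (smt (verit))
  have "decomposes U {g. field_in D g} graph_bound S W C"
    unfolding decomposes_def
  proof (intro conjI ballI allI impI; (unfold mem_Collect_eq)?)
    show "0 \<le> C" using nn by (simp add: C_def)
    show "S g N i j = S g N j i" if "field_in D g" for g N i j by (rule S_sym[OF sf[OF that]])
    show "L2_tendsto (\<lambda>N x. S g N i j x + (pd i (W g N j) x + pd j (W g N i) x) / 2) (g i j)" if g: "field_in D g" for g i j
    proof -
      have gL: "g i j \<in> L2" using g by (simp add: field_in_def)
      have "(\<lambda>x. S g N i j x + (pd i (W g N j) x + pd j (W g N i) x) / 2) = av N (av N (g i j))" for N
        using averages_decomposition[OF sf[OF g], of N i j] by auto
      moreover have "av N h \<in> L2" if "h \<in> L2" for N h unfolding av_def by (rule cv_Young(1)[OF \<omega>(1) that]) simp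
      ultimately show ?thesis using averages_tendsto[OF gL] gL by (simp add: L2_tendsto_def)
    qed
    have M0: "0 \<le> M" if "graph_bound g M" for g M
      using that order_trans[OF L2norm_nonneg] by (auto simp: graph_bound_def)
    show "h1seq U (C * M) (\<lambda>N. S g N i j)" if "field_in D g" "graph_bound g M" for g M i j
      using S_h1seq[OF sf[OF that(1)], of M i j] that(2) mult_right_mono[OF CS M0[OF that(2)]]
      by (auto simp: graph_bound_def intro: h1seq_mono)
    show "h1seq U (C * M) (\<lambda>N. W g N l)" if "field_in D g" "graph_bound g M" for g M l
      using W_h1seq[OF sf[OF that(1)], of M l] that(2) mult_right_mono[OF CW M0[OF that(2)]]
      by (auto simp: graph_bound_def intro: h1seq_mono)
    show "S (\<lambda>i j x. a * g i j x + b * h i j x) N i j x = a * S g N i j x + b * S h N i j x"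
      if "field_in D g" "field_in D h" for g h a b N i j x by (rule S_linear[OF sf[OF that(1)] sf[OF that(2)]])
    show "W (\<lambda>i j x. a * g i j x + b * h i j x) N l x = a * W g N l x + b * W h N l x"
      if "field_in D g" "field_in D h" for g h a b N l x by (rule W_linear[OF sf[OF that(1)] sf[OF that(2)]])
  qed
  then show ?thesis by blast
qed

text \<open>Each cut off field is decomposed with the kernels of its own patch and the results are
  added. All properties in \<open>decomposes\<close> survive finite sums, and cutting off is
  linear.\<close>

theorem global_decomposition:
  assumes \<Omega>: "open \<Omega>" "bounded \<Omega>" "lipschitz_boundary \<Omega>"
  shows "\<exists>S W C. decomposes \<Omega> (Hcc \<Omega>) (\<lambda>g M. M = Hccnorm g) S W C"
proof -
  obtain n :: nat and \<zeta> \<omega> \<theta> Q D where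
    lk: "\<And>k. k < n \<Longrightarrow> local_kernels (\<omega> k) (\<theta> k) (Q k) (D k) \<Omega>" and \<zeta>: "\<And>k. k < n \<Longrightarrow> test UNIV (\<zeta> k)"
    and \<zeta>D: "\<And>k y. k < n \<Longrightarrow> y \<in> \<Omega> \<Longrightarrow> \<zeta> k y \<noteq> 0 \<Longrightarrow> y \<in> D k"
    and one: "\<And>y. y \<in> \<Omega> \<Longrightarrow> (\<Sum>k<n. \<zeta> k y) = 1"
  proof (rule local_kernels_cover[OF \<Omega>], goal_cases)
    case (1 n \<zeta> \<omega> \<theta> Q D)
    show ?case by (rule that[of n \<omega> \<theta> Q D \<zeta>]; rule 1(2-5); assumption)
  qed
  have "\<exists>S W C. decomposes \<Omega> {g. field_in (D k) g} graph_bound S W C" if "k < n" for k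
    by (rule local_decomposition[OF lk[OF that]])
  then obtain S W C where "\<And>k. k < n \<Longrightarrow> decomposes \<Omega> {g. field_in (D k) g} graph_bound (S k) (W k) (C k)" by metis
  note P = decomposesD[OF this, unfolded mem_Collect_eq]
  have "\<exists>B\<ge>0. \<forall>g\<in>Hcc \<Omega>. graph_bound (cut (\<zeta> k) g) (B * Hccnorm g)" if "k < n" for k
    using cut_bound[OF \<zeta>[OF that], of \<Omega>] unfolding graph_bound_def by metis
  then obtain B where B: "\<And>k. k < n \<Longrightarrow> 0 \<le> B k"
    "\<And>k g. k < n \<Longrightarrow> g \<in> Hcc \<Omega> \<Longrightarrow> graph_bound (cut (\<zeta> k) g) (B k * Hccnorm g)" by metis
  have cutf: "field_in (D k) (cut (\<zeta> k) g)" if k: "k < n" and g: "g \<in> Hcc \<Omega>" for k g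
    unfolding field_in_def
  proof (intro allI conjI impI)
    fix i j x
    obtain b where b: "\<And>x. \<bar>\<zeta> k x\<bar> \<le> b" using test_bounded[OF \<zeta>[OF k]] by blast
    show "cut (\<zeta> k) g i j \<in> L2"
      unfolding cut_def[abs_def] by (rule L2_mult_bounded(1)[OF HccD(1)[OF g] test_measurable[OF \<zeta>[OF k]] b])
    show "cut (\<zeta> k) g i j x = 0" if "x \<notin> D k"
      using HccD(2)[OF g, of x i j] \<zeta>D[OF k, of x] that by (cases "x \<in> \<Omega>") (auto simp: cut_def)
    show "cut (\<zeta> k) g i j = cut (\<zeta> k) g j i" using HccD(3)[OF g, of i j] by (simp add: cut_def[abs_def])
  qed
  define SS where "SS g N i j x = (\<Sum>k<n. S k (cut (\<zeta> k) g) N i j x)" for g N i j x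
  define WW where "WW g N l x = (\<Sum>k<n. W k (cut (\<zeta> k) g) N l x)" for g N l x
  define CC where "CC = (\<Sum>k<n. C k * B k)"
  have Sh: "h1seq \<Omega> (C k * (B k * Hccnorm g)) (\<lambda>N. S k (cut (\<zeta> k) g) N i j)"
    and Wh: "h1seq \<Omega> (C k * (B k * Hccnorm g)) (\<lambda>N. W k (cut (\<zeta> k) g) N l)"
    if k: "k < n" and g: "g \<in> Hcc \<Omega>" for k g i j l
    by (rule P(4)[OF k cutf[OF k g] B(2)[OF k g]] P(5)[OF k cutf[OF k g] B(2)[OF k g]])+
  have CC: "(\<Sum>k<n. C k * (B k * G)) = CC * G" for G by (simp add: CC_def sum_distrib_right mult.assoc)
  have SSh: "h1seq \<Omega> (CC * Hccnorm g) (\<lambda>N. SS g N i j)" if g: "g \<in> Hcc \<Omega>" for g i j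
    unfolding SS_def[abs_def] CC[symmetric] by (rule h1seq_sum) (use Sh g in auto)
  have WWh: "h1seq \<Omega> (CC * Hccnorm g) (\<lambda>N. WW g N l)" if g: "g \<in> Hcc \<Omega>" for g l
    unfolding WW_def[abs_def] CC[symmetric] by (rule h1seq_sum) (use Wh g in auto)
  have cut_lin: "cut f (\<lambda>i j x. a * g i j x + b * h i j x) = (\<lambda>i j x. a * cut f g i j x + b * cut f h i j x)" for f g h a b
    by (simp add: cut_def[abs_def] algebra_simps)
  have "decomposes \<Omega> (Hcc \<Omega>) (\<lambda>g M. M = Hccnorm g) SS WW CC"
    unfolding decomposes_def
  proof (intro conjI ballI allI impI)
    show "0 \<le> CC" unfolding CC_def using P(1) B(1) by (intro sum_nonneg mult_nonneg_nonneg) auto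
    show "SS g N i j = SS g N j i" if g: "g \<in> Hcc \<Omega>" for g N i j
    proof -
      have "S k (cut (\<zeta> k) g) N i j = S k (cut (\<zeta> k) g) N j i" if "k < n" for k
        by (rule P(2)[OF that cutf[OF that g]])
      then show ?thesis unfolding SS_def[abs_def] by (intro ext sum.cong) auto
    qed
    show "L2_tendsto (\<lambda>N x. SS g N i j x + (pd i (WW g N j) x + pd j (WW g N i) x) / 2) (g i j)" if g: "g \<in> Hcc \<Omega>" for g i j
    proof -
      have Wt: "test \<Omega> (W k (cut (\<zeta> k) g) N l)" if "k < n" for k N l
        using Wh[OF that g] by (simp add: h1seq_def)
      have "L2_tendsto (\<lambda>N x. \<Sum>k<n. S k (cut (\<zeta> k) g) N i j x + (pd i (W k (cut (\<zeta> k) g) N j) x + pd j (W k (cut (\<zeta> k) g) N i) x) / 2) (\<lambda>x. \<Sum>k<n. cut (\<zeta> k) g i j x)"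
        by (rule L2_tendsto_sum, rule P(3), simp, rule cutf[OF _ g], simp)
      \<comment> \<open>Outside the domain both sides are 0 by the zero extension, so a partition of
        unity over the domain gives equality at every point.\<close>
      moreover have "(\<lambda>x. \<Sum>k<n. cut (\<zeta> k) g i j x) = g i j"
      proof
        fix x
        show "(\<Sum>k<n. cut (\<zeta> k) g i j x) = g i j x"
          using one[of x] HccD(2)[OF g, of x i j]
          by (cases "x \<in> \<Omega>") (simp_all add: cut_def sum_distrib_right[symmetric])
      qed
      moreover have "pd c (WW g N l) = (\<lambda>x. \<Sum>k<n. pd c (W k (cut (\<zeta> k) g) N l) x)" for c l N
        unfolding WW_def[abs_def] by (rule pd_sum_smooth) (rule test_smooth[OF Wt], simp)
      ultimately show ?thesis by (simp add: SS_def sum.distrib sum_divide_distrib[symmetric])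
    qed
    show "SS (\<lambda>i j x. a * g i j x + b * h i j x) N i j x = a * SS g N i j x + b * SS h N i j x"
      if g: "g \<in> Hcc \<Omega>" and h: "h \<in> Hcc \<Omega>" for g h a b N i j x
    proof -
      have "S k (\<lambda>i j x. a * cut (\<zeta> k) g i j x + b * cut (\<zeta> k) h i j x) N i j x = a * S k (cut (\<zeta> k) g) N i j x + b * S k (cut (\<zeta> k) h) N i j x" if "k < n" for k
        by (rule P(6)[OF that cutf[OF that g] cutf[OF that h]])
      then show ?thesis by (simp add: SS_def cut_lin sum_distrib_left sum.distrib)
    qed
    show "WW (\<lambda>i j x. a * g i j x + b * h i j x) N l x = a * WW g N l x + b * WW h N l x"
      if g: "g \<in> Hcc \<Omega>" and h: "h \<in> Hcc \<Omega>" for g h a b N l x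
    proof -
      have "W k (\<lambda>i j x. a * cut (\<zeta> k) g i j x + b * cut (\<zeta> k) h i j x) N l x = a * W k (cut (\<zeta> k) g) N l x + b * W k (cut (\<zeta> k) h) N l x" if "k < n" for k
        by (rule P(7)[OF that cutf[OF that g] cutf[OF that h]])
      then show ?thesis by (simp add: WW_def cut_lin sum_distrib_left sum.distrib)
    qed
  qed (use SSh WWh in auto)
  then show ?thesis by blast
qed

section \<open>Convergence of the partial sums in the graph norm, and the final assembly\<close>

section \<open>Density\<close>

lemma levi_symmetric_zero:
  assumes "\<And>p q. F p q = F q p" shows "(\<Sum>p\<in>UNIV. \<Sum>q\<in>UNIV. levi a p q * F p q) = 0"
proof -
  have "\<forall>a. (\<Sum>p\<in>UNIV. \<Sum>q\<in>UNIV. levi a p q * F p q) = 0"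
    by (simp add: forall_3 sum_3 levi_values assms[of 2 1] assms[of 3 1] assms[of 3 2])
  then show ?thesis by blast
qed

text \<open>One integration by parts leaves third derivatives of the test function, which are
  symmetric in all indices. In each half of the symmetrised gradient, one Levi-Civita symbol is
  contracted with two of these indices.\<close>

lemma incD_def_zero:
  assumes W: "\<And>l. test UNIV (W l)" and \<psi>: "test UNIV \<psi>"
  shows "incD (\<lambda>i j x. (pd i (W j) x + pd j (W i) x) / 2) a b \<psi> = 0"
proof -
  define J where "J m q p l = integral\<^sup>L lborel (\<lambda>x. W m x * pd q (pd p (pd l \<psi>)) x)" for m q p l
  have \<psi>s: "smooth \<psi>" by (rule test_smooth[OF \<psi>])
  have J1: "J m q p l = J m p q l" for m q p l
    unfolding J_def using pd_commute[OF smooth_pd[OF \<psi>s, of l], of q p] by simp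
  have J2: "J m q p l = J m l p q" for m q p l
  proof -
    have "pd q (pd p (pd l \<psi>)) = pd l (pd p (pd q \<psi>))"
      using pd_commute[OF \<psi>s] pd_commute[OF smooth_pd[OF \<psi>s]] by metis
    then show ?thesis by (simp add: J_def)
  qed
  have I: "integral\<^sup>L lborel (\<lambda>x. (pd m (W q) x + pd q (W m) x) / 2 * pd p (pd l \<psi>) x) = - (J q m p l + J m q p l) / 2" for m q p l
  proof -
    have e: "integral\<^sup>L lborel (\<lambda>x. pd c (W k) x * pd p (pd l \<psi>) x) = - J k c p l" for c k
      using integration_by_parts[OF W smooth_pd[OF smooth_pd[OF \<psi>s]], of k c p l] by (simp add: J_def)
    have i: "integrable lborel (\<lambda>x. pd c (W k) x * pd p (pd l \<psi>) x)" for c k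
      by (intro L2_mult_integrable test_L2[of UNIV] test_pd W \<psi>)
    have "(\<lambda>x. (pd m (W q) x + pd q (W m) x) / 2 * pd p (pd l \<psi>) x) = (\<lambda>x. (1/2) * (pd m (W q) x * pd p (pd l \<psi>) x + pd q (W m) x * pd p (pd l \<psi>) x))"
      by (auto simp: field_simps)
    then have "integral\<^sup>L lborel (\<lambda>x. (pd m (W q) x + pd q (W m) x) / 2 * pd p (pd l \<psi>) x)
      = (1/2) * (integral\<^sup>L lborel (\<lambda>x. pd m (W q) x * pd p (pd l \<psi>) x) + integral\<^sup>L lborel (\<lambda>x. pd q (W m) x * pd p (pd l \<psi>) x))"
      by (simp only: integral_mult_right_zero Bochner_Integration.integral_add[OF i i])
    then show ?thesis unfolding e by simp
  qed
  have A: "(\<Sum>p\<in>UNIV. \<Sum>q\<in>UNIV. levi a p q * (\<Sum>l\<in>UNIV. \<Sum>m\<in>UNIV. levi b l m * J m q p l)) = 0"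
    by (rule levi_symmetric_zero) (simp only: J1)
  have B: "(\<Sum>l\<in>UNIV. \<Sum>m\<in>UNIV. levi b l m * J q m p l) = 0" for p q
    by (rule levi_symmetric_zero) (rule J2)
  have "incD (\<lambda>i j x. (pd i (W j) x + pd j (W i) x) / 2) a b \<psi>
     = (\<Sum>p\<in>UNIV. \<Sum>q\<in>UNIV. levi a p q * ((-1/2) * ((\<Sum>l\<in>UNIV. \<Sum>m\<in>UNIV. levi b l m * J q m p l) + (\<Sum>l\<in>UNIV. \<Sum>m\<in>UNIV. levi b l m * J m q p l))))"
    unfolding incD_def I sum.distrib[symmetric] sum_distrib_left
    by (intro sum.cong refl) (simp add: field_simps)
  also have "\<dots> = (-1/2) * (\<Sum>p\<in>UNIV. \<Sum>q\<in>UNIV. levi a p q * (\<Sum>l\<in>UNIV. \<Sum>m\<in>UNIV. levi b l m * J m q p l))"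
    unfolding B by (simp add: sum_distrib_left)
  finally show ?thesis unfolding A by simp
qed

lemma incD_add:
  assumes "\<And>i j. g i j \<in> L2" "\<And>i j. h i j \<in> L2" and \<psi>: "test UNIV \<psi>"
  shows "incD (\<lambda>i j x. g i j x + h i j x) a b \<psi> = incD g a b \<psi> + incD h a b \<psi>"
proof -
  have "integral\<^sup>L lborel (\<lambda>x. (g m q x + h m q x) * pd p (pd l \<psi>) x)
    = integral\<^sup>L lborel (\<lambda>x. g m q x * pd p (pd l \<psi>) x) + integral\<^sup>L lborel (\<lambda>x. h m q x * pd p (pd l \<psi>) x)" for m q p l
    unfolding distrib_right
    by (intro Bochner_Integration.integral_add L2_mult_integrable assms test_L2[of UNIV] test_pd)
  then show ?thesis unfolding incD_def by (simp add: distrib_left sum.distrib)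
qed

text \<open>Splitting the two derivatives of inc evenly between the field and the test function
  shows that H^1 smallness of a field makes its inc small in H^{-1}.\<close>

lemma incD_test_le:
  assumes s: "\<And>i j. test UNIV (s i j)" and e: "\<And>i j c. L2norm (pd c (s i j)) \<le> e" and \<psi>: "test UNIV \<psi>"
  shows "\<bar>incD s a b \<psi>\<bar> \<le> 81 * (e * H1norm_test \<psi>)"
  unfolding incD_def
proof (rule levi_sum_le)
  fix p q l m
  have "integral\<^sup>L lborel (\<lambda>x. s m q x * pd p (pd l \<psi>) x) = - ip (pd p (s m q)) (pd l \<psi>)"
    unfolding ip_def by (rule integration_by_parts[OF s smooth_pd[OF test_smooth[OF \<psi>]]])
  moreover have "\<bar>ip (pd p (s m q)) (pd l \<psi>)\<bar> \<le> L2norm (pd p (s m q)) * L2norm (pd l \<psi>)"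
    by (intro L2_Cauchy_Schwarz test_L2[of UNIV] test_pd s \<psi>)
  moreover have "\<dots> \<le> e * H1norm_test \<psi>"
    by (intro mult_mono e L2norm_le_H1norm_test order_trans[OF L2norm_nonneg e]) auto
  ultimately show "\<bar>integral\<^sup>L lborel (\<lambda>x. s m q x * pd p (pd l \<psi>) x)\<bar> \<le> e * H1norm_test \<psi>" by linarith
qed

lemma Hm1norm_le:
  assumes "\<And>\<phi>. test UNIV \<phi> \<Longrightarrow> H1norm_test \<phi> \<le> 1 \<Longrightarrow> \<bar>T \<phi>\<bar> \<le> e" shows "Hm1norm T \<le> e"
  unfolding Hm1norm_def
proof (rule cSup_least)
  have "\<bar>T (\<lambda>x. 0)\<bar> \<in> {\<bar>T \<phi>\<bar> |\<phi>. test UNIV \<phi> \<and> H1norm_test \<phi> \<le> 1}"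
    by (auto intro!: exI[of _ "\<lambda>x. 0"])
  then show "{\<bar>T \<phi>\<bar> |\<phi>. test UNIV \<phi> \<and> H1norm_test \<phi> \<le> 1} \<noteq> {}" by blast
qed (use assms in auto)

text \<open>L2 convergence alone does not control inc of the error. Two approximants
  \<open>M\<close> and \<open>N\<close> differ by a difference of \<open>S\<close> terms plus a
  symmetrised gradient; inc annihilates the latter and the former is small in H^1. Against a fixed
  test function inc is continuous in L2, so \<open>M\<close> may tend to infinity.\<close>

lemma incD_limit_bound:
  assumes S: "\<And>N i j. test UNIV (S N i j)" and W: "\<And>N l. test UNIV (W N l)"
    and lim: "\<And>i j. L2_tendsto (\<lambda>N x. S N i j x + (pd i (W N j) x + pd j (W N i) x) / 2) (g i j)"
    and e: "\<And>M i j c. M \<ge> N \<Longrightarrow> L2norm (\<lambda>x. pd c (S M i j) x - pd c (S N i j) x) \<le> e"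
    and \<psi>: "test UNIV \<psi>"
  shows "\<bar>incD (\<lambda>i j x. g i j x - (S N i j x + (pd i (W N j) x + pd j (W N i) x) / 2)) a b \<psi>\<bar> \<le> 81 * (e * H1norm_test \<psi>)"
proof -
  define A where "A N i j x = S N i j x + (pd i (W N j) x + pd j (W N i) x) / 2" for N i j x
  have AL: "A N i j \<in> L2" "g i j \<in> L2" for N i j using lim[of i j] by (auto simp: L2_tendsto_def A_def[abs_def])
  have bound: "\<bar>incD (\<lambda>i j x. A M i j x - A N i j x) a b \<psi>\<bar> \<le> 81 * (e * H1norm_test \<psi>)" if M: "M \<ge> N" for M
  proof -
    define s where "s i j x = S M i j x - S N i j x" for i j x
    define w where "w l x = W M l x - W N l x" for l x
    have st: "test UNIV (s i j)" for i j unfolding s_def[abs_def] by (intro test_diff S)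
    have wt: "test UNIV (w l)" for l unfolding w_def[abs_def] by (intro test_diff W)
    have pw: "pd c (w l) = (\<lambda>x. pd c (W M l) x - pd c (W N l) x)" for c l
      unfolding w_def[abs_def] by (intro pd_diff_smooth test_smooth[OF W])
    have ps: "pd c (s i j) = (\<lambda>x. pd c (S M i j) x - pd c (S N i j) x)" for c i j
      unfolding s_def[abs_def] by (intro pd_diff_smooth test_smooth[OF S])
    have dt: "test UNIV (\<lambda>x. (pd i (w j) x + pd j (w i) x) / 2)" for i j
      using test_cmult[OF test_add[OF test_pd[OF wt] test_pd[OF wt]], of "1/2"] by simp
    have "(\<lambda>i j x. A M i j x - A N i j x) = (\<lambda>i j x. s i j x + (pd i (w j) x + pd j (w i) x) / 2)"
      by (auto simp: A_def s_def pw fun_eq_iff field_simps)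
    then have "incD (\<lambda>i j x. A M i j x - A N i j x) a b \<psi> = incD s a b \<psi> + incD (\<lambda>i j x. (pd i (w j) x + pd j (w i) x) / 2) a b \<psi>"
      using incD_add[OF test_L2[OF st] test_L2[OF dt] \<psi>] by simp
    also have "\<dots> = incD s a b \<psi>" using incD_def_zero[OF wt \<psi>] by simp
    finally show ?thesis using incD_test_le[OF st _ \<psi>, where e = e and a = a and b = b] e[OF M] ps by simp
  qed
  have Rt: "(\<lambda>M. incD (\<lambda>i j x. A M i j x - A N i j x) a b \<psi>) \<longlonglongrightarrow> incD (\<lambda>i j x. g i j x - A N i j x) a b \<psi>"
    unfolding incD_def
  proof (intro tendsto_sum tendsto_mult tendsto_const)
    fix p q l m
    have "L2_tendsto (\<lambda>M x. A M m q x + (-1) * A N m q x) (\<lambda>x. g m q x + (-1) * A N m q x)"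
    proof (rule L2_tendsto_add)
      show "L2_tendsto (\<lambda>M. A M m q) (g m q)" using lim[of m q] by (simp add: A_def[abs_def])
      show "L2_tendsto (\<lambda>M x. (-1) * A N m q x) (\<lambda>x. (-1) * A N m q x)" using AL(1)[of N m q] L2_cmult[of "A N m q" "-1"] by (simp add: L2_tendsto_def)
    qed
    from L2_tendsto_ip[OF this test_L2[OF test_pd[OF test_pd[OF \<psi>]]], of p l]
    show "(\<lambda>M. LINT x|lborel. (A M m q x - A N m q x) * pd p (pd l \<psi>) x) \<longlonglongrightarrow> (LINT x|lborel. (g m q x - A N m q x) * pd p (pd l \<psi>) x)"
      by (simp add: ip_def)
  qed
  have "\<bar>incD (\<lambda>i j x. g i j x - A N i j x) a b \<psi>\<bar> \<le> 81 * (e * H1norm_test \<psi>)"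
    by (rule LIMSEQ_le_const2[OF tendsto_rabs[OF Rt]]) (use bound in blast)
  then show ?thesis by (simp add: A_def)
qed

lemma sqrt_double_sum_le:
  fixes f :: "3 \<Rightarrow> 3 \<Rightarrow> real"
  assumes "\<And>i j. 0 \<le> f i j" "\<And>i j. f i j \<le> c"
  shows "sqrt (\<Sum>i\<in>UNIV. \<Sum>j\<in>UNIV. (f i j)\<^sup>2) \<le> 3 * c"
proof (rule real_le_lsqrt)
  have "(\<Sum>i\<in>UNIV. \<Sum>j\<in>UNIV. (f i j)\<^sup>2) \<le> (\<Sum>i\<in>(UNIV::3 set). \<Sum>j\<in>(UNIV::3 set). c\<^sup>2)"
    by (intro sum_mono power_mono assms)
  then show "(\<Sum>i\<in>UNIV. \<Sum>j\<in>UNIV. (f i j)\<^sup>2) \<le> (3 * c)\<^sup>2" by (simp add: power_mult_distrib)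
  show "0 \<le> 3 * c" using assms(1)[of 1 1] assms(2)[of 1 1] by linarith
qed

lemma sqrt_sum_le:
  fixes f :: "3 \<Rightarrow> real"
  assumes "\<And>i. 0 \<le> f i" "\<And>i. f i \<le> c"
  shows "sqrt (\<Sum>i\<in>UNIV. (f i)\<^sup>2) \<le> 3 * c"
proof (rule real_le_lsqrt)
  have "(\<Sum>i\<in>UNIV. (f i)\<^sup>2) \<le> (\<Sum>i\<in>(UNIV::3 set). c\<^sup>2)"
    by (intro sum_mono power_mono assms)
  moreover have "(\<Sum>i\<in>(UNIV::3 set). c\<^sup>2) = 3 * c\<^sup>2" "(3 * c)\<^sup>2 = 9 * c\<^sup>2" by (simp_all add: power_mult_distrib)
  ultimately show "(\<Sum>i\<in>UNIV. (f i)\<^sup>2) \<le> (3 * c)\<^sup>2" using zero_le_power2[of c] by linarith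
  show "0 \<le> 3 * c" using assms(1)[of 1] assms(2)[of 1] by linarith
qed

lemma Hccnorm_le:
  assumes "\<And>i j. L2norm (g i j) \<le> e" "\<And>a b. \<bar>Hm1norm (incD g a b)\<bar> \<le> e'"
  shows "Hccnorm g \<le> 3 * e + 3 * e'"
proof -
  define X Y where "X = (\<Sum>i\<in>UNIV. \<Sum>j\<in>UNIV. (L2norm (g i j))\<^sup>2)" and "Y = (\<Sum>a\<in>UNIV. \<Sum>b\<in>UNIV. \<bar>Hm1norm (incD g a b)\<bar>\<^sup>2)"
  have "sqrt X \<le> 3 * e" unfolding X_def by (rule sqrt_double_sum_le) (use assms in auto)
  moreover have "sqrt Y \<le> 3 * e'" unfolding Y_def by (rule sqrt_double_sum_le) (use assms in auto)
  moreover have "Hccnorm g = sqrt (X + Y)" by (simp add: Hccnorm_def X_def Y_def)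
  moreover have "0 \<le> X" "0 \<le> Y" unfolding X_def Y_def by (intro sum_nonneg; simp)+
  ultimately show ?thesis using sqrt_add_le_add_sqrt[of X Y] by simp
qed

text \<open>One threshold for finitely many matrix entries or derivatives, indexed below by pairs
  and triples.\<close>

lemma eventually_small:
  assumes "\<And>i :: 'i :: finite. \<exists>N. \<forall>n\<ge>N. P i (n::nat)"
  obtains N where "\<And>i n. n \<ge> N \<Longrightarrow> P i n"
proof -
  from assms obtain N where N: "\<And>i n. n \<ge> N i \<Longrightarrow> P i n" by metis
  have "N i \<le> Max (range N)" for i by simp
  then show thesis using that[of "Max (range N)"] N by (meson order_trans)
qed

theorem mainTheorem16:
  fixes \<Omega> :: "(real^3) set"
  assumes "bounded \<Omega>" "open \<Omega>" "connected \<Omega>" "simply_connected \<Omega>"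
    and "lipschitz_boundary \<Omega>" "connected (frontier \<Omega>)"
  shows "(\<exists>(S0 :: mfield \<Rightarrow> mfield) (S1 :: mfield \<Rightarrow> vfield).
      (\<forall>g\<in>Hcc \<Omega>. (\<forall>i j. S0 g i j \<in> H10 \<Omega> \<and> S0 g i j = S0 g j i) \<and> (\<forall>i. S1 g i \<in> H10 \<Omega>)) \<and>
      (\<forall>g\<in>Hcc \<Omega>. \<forall>h\<in>Hcc \<Omega>. \<forall>a b :: real.
         (\<forall>i j. AE x in lborel. S0 (\<lambda>i j x. a * g i j x + b * h i j x) i j x
                                = a * S0 g i j x + b * S0 h i j x) \<and>
         (\<forall>i. AE x in lborel. S1 (\<lambda>i j x. a * g i j x + b * h i j x) i x
                                = a * S1 g i x + b * S1 h i x)) \<and>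
      (\<exists>C. \<forall>g\<in>Hcc \<Omega>. sqrt (\<Sum>i\<in>UNIV. \<Sum>j\<in>UNIV. (H1norm (S0 g i j))\<^sup>2) \<le> C * Hccnorm g) \<and>
      (\<exists>C. \<forall>g\<in>Hcc \<Omega>. sqrt (\<Sum>i\<in>UNIV. (H1norm (S1 g i))\<^sup>2) \<le> C * Hccnorm g) \<and>
      (\<forall>g\<in>Hcc \<Omega>. \<forall>i j. AE x in lborel.
         g i j x = S0 g i j x + (wderiv j (S1 g i) x + wderiv i (S1 g j) x) / 2))
    \<and> (\<forall>g\<in>Hcc \<Omega>. \<forall>\<epsilon>>0. \<exists>\<phi> :: mfield.
         (\<forall>i j. test \<Omega> (\<phi> i j) \<and> \<phi> i j = \<phi> j i) \<and>
         Hccnorm (\<lambda>i j x. g i j x - \<phi> i j x) < \<epsilon>)"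
proof -
  obtain S :: "mfield \<Rightarrow> nat \<Rightarrow> mfield" and W :: "mfield \<Rightarrow> nat \<Rightarrow> vfield" and C :: real
    where D: "decomposes \<Omega> (Hcc \<Omega>) (\<lambda>g M. M = Hccnorm g) S W C"
    using global_decomposition[OF assms(2,1,5)] by blast
  note C = decomposesD(1)[OF D] and Ssym = decomposesD(2)[OF D] and lim = decomposesD(3)[OF D]
    and Sh = decomposesD(4)[OF D _ refl] and Wh = decomposesD(5)[OF D _ refl]
    and Slin = decomposesD(6)[OF D] and Wlin = decomposesD(7)[OF D]
  define S0 where "S0 g i j = L2lim \<Omega> (\<lambda>N. S g N i j)" for g i j
  define S1 where "S1 g i = L2lim \<Omega> (\<lambda>N. W g N i)" for g i
  have Hnn: "0 \<le> H1norm f" for f by (simp add: H1norm_def sum_nonneg)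
  \<comment> \<open>Partial sums are linear pointwise, but the limit is chosen for each sequence
    separately, so linearity survives almost everywhere only.\<close>
  have lin: "AE x in lborel. L2lim \<Omega> (\<lambda>N x. a * F N x + b * G N x) x = a * L2lim \<Omega> F x + b * L2lim \<Omega> G x"
    if "h1seq \<Omega> A F" "h1seq \<Omega> B G" for a b A B F G
  proof (rule L2lim_eq(3))
    show "L2_tendsto (\<lambda>N x. a * F N x + b * G N x) (\<lambda>x. a * L2lim \<Omega> F x + b * L2lim \<Omega> G x)"
      by (intro L2_tendsto_add L2_tendsto_cmult h1seq_L2lim(1)[OF that(1)] h1seq_L2lim(1)[OF that(2)])
    show "(\<lambda>x. a * L2lim \<Omega> F x + b * L2lim \<Omega> G x) \<in> L2Om \<Omega>"
      using h1seq_L2lim(2)[OF that(1)] h1seq_L2lim(2)[OF that(2)] by (auto simp: L2Om_def)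
  qed
  show ?thesis
  proof (intro conjI exI[of _ S0] exI[of _ S1] ballI allI impI)
    fix g i j assume g: "g \<in> Hcc \<Omega>"
    show "S0 g i j \<in> H10 \<Omega>" unfolding S0_def by (rule h1seq_L2lim(3)[OF Sh[OF g]])
    show "S0 g i j = S0 g j i" unfolding S0_def by (subst Ssym[OF g]) (rule refl)
    show "S1 g i \<in> H10 \<Omega>" unfolding S1_def by (rule h1seq_L2lim(3)[OF Wh[OF g]])
  next
    fix g h i j and a b :: real assume g: "g \<in> Hcc \<Omega>" and h: "h \<in> Hcc \<Omega>"
    have 1: "(\<lambda>N. S (\<lambda>i j x. a * g i j x + b * h i j x) N i j) = (\<lambda>N x. a * S g N i j x + b * S h N i j x)"
      using Slin[OF g h] by (intro ext)
    have 2: "(\<lambda>N. W (\<lambda>i j x. a * g i j x + b * h i j x) N i) = (\<lambda>N x. a * W g N i x + b * W h N i x)"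
      using Wlin[OF g h] by (intro ext)
    show "AE x in lborel. S0 (\<lambda>i j x. a * g i j x + b * h i j x) i j x = a * S0 g i j x + b * S0 h i j x"
      unfolding S0_def 1 by (rule lin[OF Sh[OF g] Sh[OF h]])
    show "AE x in lborel. S1 (\<lambda>i j x. a * g i j x + b * h i j x) i x = a * S1 g i x + b * S1 h i x"
      unfolding S1_def 2 by (rule lin[OF Wh[OF g] Wh[OF h]])
  next
    \<comment> \<open>The 6 is 3 times 2: the root of nine entries, and the factor 2 of
      \<open>h1seq_L2lim\<close>.\<close>
    have "sqrt (\<Sum>i\<in>UNIV. \<Sum>j\<in>UNIV. (H1norm (S0 g i j))\<^sup>2) \<le> (6 * C) * Hccnorm g" if g: "g \<in> Hcc \<Omega>" for g
    proof -
      have "sqrt (\<Sum>i\<in>UNIV. \<Sum>j\<in>UNIV. (H1norm (S0 g i j))\<^sup>2) \<le> 3 * (2 * (C * Hccnorm g))"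
        by (rule sqrt_double_sum_le[OF Hnn]) (simp only: S0_def, rule h1seq_L2lim(5)[OF Sh[OF g]])
      then show ?thesis by simp
    qed
    then show "\<exists>C. \<forall>g\<in>Hcc \<Omega>. sqrt (\<Sum>i\<in>UNIV. \<Sum>j\<in>UNIV. (H1norm (S0 g i j))\<^sup>2) \<le> C * Hccnorm g" by blast
    have "sqrt (\<Sum>i\<in>UNIV. (H1norm (S1 g i))\<^sup>2) \<le> (6 * C) * Hccnorm g" if g: "g \<in> Hcc \<Omega>" for g
    proof -
      have "sqrt (\<Sum>i\<in>UNIV. (H1norm (S1 g i))\<^sup>2) \<le> 3 * (2 * (C * Hccnorm g))"
        by (rule sqrt_sum_le[OF Hnn]) (simp only: S1_def, rule h1seq_L2lim(5)[OF Wh[OF g]])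
      then show ?thesis by simp
    qed
    then show "\<exists>C. \<forall>g\<in>Hcc \<Omega>. sqrt (\<Sum>i\<in>UNIV. (H1norm (S1 g i))\<^sup>2) \<le> C * Hccnorm g" by blast
  next
    fix g i j assume g: "g \<in> Hcc \<Omega>"
    \<comment> \<open>The field and its claimed decomposition are L2 limits of the same partial
      sums.\<close>
    have "L2_tendsto (\<lambda>N x. S g N i j x + (1/2) * (pd i (W g N j) x + pd j (W g N i) x))
       (\<lambda>x. S0 g i j x + (1/2) * (wderiv i (S1 g j) x + wderiv j (S1 g i) x))"
      unfolding S0_def S1_def
      by (intro L2_tendsto_add L2_tendsto_cmult h1seq_L2lim(1)[OF Sh[OF g]] h1seq_L2lim(4)[OF Wh[OF g]])
    then have "L2_tendsto (\<lambda>N x. S g N i j x + (pd i (W g N j) x + pd j (W g N i) x) / 2)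
       (\<lambda>x. S0 g i j x + (wderiv j (S1 g i) x + wderiv i (S1 g j) x) / 2)" by (simp add: add.commute)
    from L2_tendsto_unique[OF lim[OF g] this]
    show "AE x in lborel. g i j x = S0 g i j x + (wderiv j (S1 g i) x + wderiv i (S1 g j) x) / 2" .
  next
    fix g and \<epsilon> :: real assume g: "g \<in> Hcc \<Omega>" and \<epsilon>: "\<epsilon> > 0"
    define A where "A N i j x = S g N i j x + (pd i (W g N j) x + pd j (W g N i) x) / 2" for N i j x
    have St: "test \<Omega> (S g N i j)" and Wt: "test \<Omega> (W g N l)" for N i j l
      using Sh[OF g] Wh[OF g] by (auto simp: h1seq_def)
    have At: "test \<Omega> (A N i j)" for N i j
      using test_add[OF St test_cmult[OF test_add[OF test_pd[OF Wt] test_pd[OF Wt]], of "1/2"]] by (simp add: A_def[abs_def])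
    have Asym: "A N i j = A N j i" for N i j
      unfolding A_def[abs_def] by (simp add: Ssym[OF g, of N i j] add.commute)
    \<comment> \<open>The final estimate is \<open>3 * e + 3 * (81 * e) = 246 * e\<close>, which 300
      covers.\<close>
    define e where "e = \<epsilon> / 300"
    have e: "e > 0" using \<epsilon> by (simp add: e_def)
    have "\<exists>N. \<forall>n\<ge>N. L2norm (\<lambda>x. A n (fst ij) (snd ij) x - g (fst ij) (snd ij) x) \<le> e" for ij
      using LIMSEQ_D[OF conjunct2[OF conjunct2[OF lim[OF g, unfolded L2_tendsto_def]]] e, of "fst ij" "snd ij"]
      unfolding A_def by (auto intro: less_imp_le)
    then obtain N1 where N1: "\<And>ij n. n \<ge> N1 \<Longrightarrow> L2norm (\<lambda>x. A n (fst ij) (snd ij) x - g (fst ij) (snd ij) x) \<le> e"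
      using eventually_small[of "\<lambda>ij n. L2norm (\<lambda>x. A n (fst ij) (snd ij) x - g (fst ij) (snd ij) x) \<le> e"] by blast
    have "\<exists>N. \<forall>n\<ge>N. \<forall>m\<ge>n. L2norm (\<lambda>x. pd (fst ijc) (S g m (fst (snd ijc)) (snd (snd ijc))) x - pd (fst ijc) (S g n (fst (snd ijc)) (snd (snd ijc))) x) \<le> e" for ijc
      using Sh[OF g, of "fst (snd ijc)" "snd (snd ijc)"] e unfolding h1seq_def bounded_Cauchy_def L2_Cauchy_def by (meson order_trans)
    then obtain N2 where N2: "\<And>ijc n. n \<ge> N2 \<Longrightarrow> \<forall>m\<ge>n. L2norm (\<lambda>x. pd (fst ijc) (S g m (fst (snd ijc)) (snd (snd ijc))) x - pd (fst ijc) (S g n (fst (snd ijc)) (snd (snd ijc))) x) \<le> e"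
      using eventually_small[of "\<lambda>ijc n. \<forall>m\<ge>n. L2norm (\<lambda>x. pd (fst ijc) (S g m (fst (snd ijc)) (snd (snd ijc))) x - pd (fst ijc) (S g n (fst (snd ijc)) (snd (snd ijc))) x) \<le> e"] by blast
    define N where "N = max N1 N2"
    have L: "L2norm (\<lambda>x. g i j x - A N i j x) \<le> e" for i j
      using N1[of N "(i, j)"] L2norm_minus[of "A N i j" "g i j"] by (simp add: N_def)
    have Hb: "\<bar>incD (\<lambda>i j x. g i j x - A N i j x) a b \<psi>\<bar> \<le> 81 * (e * H1norm_test \<psi>)" if "test UNIV \<psi>" for a b \<psi>
      unfolding A_def
    proof (rule incD_limit_bound[OF _ _ lim[OF g] _ that])
      show "test UNIV (S g N i j)" "test UNIV (W g N l)" for N i j l by (rule test_mono[OF St] test_mono[OF Wt]; simp)+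
      show "L2norm (\<lambda>x. pd c (S g M i j) x - pd c (S g N i j) x) \<le> e" if "M \<ge> N" for M i j c
        using N2[of N "(c, i, j)"] that by (simp add: N_def)
    qed
    have Hm: "\<bar>Hm1norm (incD (\<lambda>i j x. g i j x - A N i j x) a b)\<bar> \<le> 81 * e" for a b
    proof -
      define T where "T = incD (\<lambda>i j x. g i j x - A N i j x) a b"
      have T: "\<bar>T \<psi>\<bar> \<le> 81 * e" if "test UNIV \<psi>" "H1norm_test \<psi> \<le> 1" for \<psi>
      proof -
        have "e * H1norm_test \<psi> \<le> e * 1" using that(2) e by (intro mult_left_mono) auto
        then show ?thesis using Hb[OF that(1), of a b] by (simp add: T_def)
      qed
      \<comment> \<open>The zero test function contributes the value 0 to a set bounded by
        \<open>T\<close>; this settles the sign of the supremum, as the norm estimate asks for its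
        absolute value.\<close>
      have "0 \<le> Hm1norm T"
        unfolding Hm1norm_def
      proof (rule cSup_upper2[of "\<bar>T (\<lambda>x. 0)\<bar>"])
        show "\<bar>T (\<lambda>x. 0)\<bar> \<in> {\<bar>T \<phi>\<bar> |\<phi>. test UNIV \<phi> \<and> H1norm_test \<phi> \<le> 1}" by (auto intro!: exI[of _ "\<lambda>x. 0"])
        show "bdd_above {\<bar>T \<phi>\<bar> |\<phi>. test UNIV \<phi> \<and> H1norm_test \<phi> \<le> 1}" using T by (auto intro!: bdd_aboveI[of _ "81 * e"])
      qed simp
      moreover have "Hm1norm T \<le> 81 * e" by (rule Hm1norm_le[OF T])
      ultimately show ?thesis by (simp add: T_def)
    qed
    have "Hccnorm (\<lambda>i j x. g i j x - A N i j x) \<le> 3 * e + 3 * (81 * e)" by (rule Hccnorm_le[OF L Hm])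
    also have "\<dots> < \<epsilon>" using \<epsilon> by (simp add: e_def)
    finally have "Hccnorm (\<lambda>i j x. g i j x - A N i j x) < \<epsilon>" .
    then show "\<exists>\<phi> :: mfield. (\<forall>i j. test \<Omega> (\<phi> i j) \<and> \<phi> i j = \<phi> j i) \<and> Hccnorm (\<lambda>i j x. g i j x - \<phi> i j x) < \<epsilon>"
      using At Asym by blast
  qed
qed

end
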